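(* Let $(\mathcal P,g)$ be a Riemannian manifold equipped with an affine connection $\nabla$ and its $g$-dual connection $\nabla^*$, and let $A$, $M$, $M_g$ be the midpoint means of $\nabla$, $\nabla^*$ and the Levi--Civita connection $\nabla^g$. Fix a pair $(P,Q)\in\mathcal P\times\mathcal P$ and set $o:=M_g(P,Q)$. Assume that the midpoint constructions $A(P,Q)$, $M(P,Q)$, $M_g(P,Q)$ and $M_g(A(P,Q),M(P,Q))$ are uniquely defined (the pair $(P,Q)$ is joined by a unique geodesic of each of $\nabla,\nabla^*,\nabla^g$, and the pair $(A(P,Q),M(P,Q))$ by a unique $\nabla^g$-geodesic). Suppose that there exist an isometry $s$ of $(\mathcal P,g)$ and an $s$-invariant domain $\mathcal U\subset\mathcal P$ such that $P,Q\in\mathcal U$ and all the geodesic segments defining the midpoints $A(P,Q)$, $M(P,Q)$, $M_g(P,Q)$ and $M_g(A(P,Q),M(P,Q))$ are contained in $\mathcal U$. Assume further that (a) $s(o)=o$ and $ds_o=-\mathrm{id}_{T_o\mathcal P}$; (b) $s_*\nabla=\nabla^*$ on $\mathcal U$; (c) $\mathrm{Fix}(s)\cap\mathcal U=\{o\}$, where $\mathrm{Fix}(s):=\{X\in\mathcal P: s(X)=X\}$. Then $$M_g\bigl(A(P,Q),M(P,Q)\bigr)=M_g(P,Q).$$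
   Context: Dual connection: $\nabla^*$ is determined by $X[g(Y,Z)]=g(\nabla_XY,Z)+g(Y,\nabla^*_XZ)$ for all vector fields. Midpoint mean of a connection $D$: $M_D(P,Q)=\gamma(1/2)$, where $\gamma:[0,1]\to\mathcal P$ is the unique affinely parametrized $D$-geodesic with $\gamma(0)=P,\gamma(1)=Q$; $A=M_\nabla$, $M=M_{\nabla^*}$, $M_g=M_{\nabla^g}$. Push-forward: for a diffeomorphism $s$ and affine connection $D$, $(s_*D)_{s_*X}(s_*Y):=s_*(D_XY)$. When $s(\mathcal U)=\mathcal U$, the same notation is used for the connections restricted to $\mathcal U$. *)

theory Defs
  imports "HOL-Analysis.Analysis" "HOL-Library.Function_Algebras"
begin

section \<open>Smooth functions between Euclidean spaces\<close>

text \<open>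
  Derivatives are taken within the set, so that the notion serves both for open sets and for
  nondegenerate intervals such as \<open>{0..1}\<close> (one-sided derivatives at the end points).
  Only sets of these kinds and their relatively open subsets are used below; on them the
  derivative is unique.
\<close>

primrec Ck_on :: "nat \<Rightarrow> 'a::real_normed_vector set \<Rightarrow> ('a \<Rightarrow> 'b::real_normed_vector) \<Rightarrow> bool" where
  "Ck_on 0 S f \<longleftrightarrow> continuous_on S f"
| "Ck_on (Suc k) S f \<longleftrightarrow>
     f differentiable_on S \<and> (\<forall>v. Ck_on k S (\<lambda>x. frechet_derivative f (at x within S) v))"

definition smooth_on :: "'a::real_normed_vector set \<Rightarrow> ('a \<Rightarrow> 'b::real_normed_vector) \<Rightarrow> bool" where
  "smooth_on S f \<longleftrightarrow> (\<forall>k. Ck_on k S f)"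

section \<open>Smooth manifolds\<close>

text \<open>
  A manifold is a whole type \<open>'p\<close> (Hausdorff, second countable) with an atlas. A chart is its
  domain together with the coordinate map, whose values outside the domain are irrelevant.
\<close>

type_synonym ('p, 'e) chart = "'p set \<times> ('p \<Rightarrow> 'e)"

definition smooth_atlas ::
  "('p::{second_countable_topology,t2_space}, 'e::euclidean_space) chart set \<Rightarrow> bool" where
  "smooth_atlas \<A> \<longleftrightarrow>
     (\<Union>(U, \<phi>)\<in>\<A>. U) = UNIV \<and>
     (\<forall>(U, \<phi>)\<in>\<A>. open U \<and> open (\<phi> ` U) \<and> homeomorphism U (\<phi> ` U) \<phi> (inv_into U \<phi>)) \<and>
     (\<forall>(U, \<phi>)\<in>\<A>. \<forall>(V, \<psi>)\<in>\<A>. smooth_on (\<phi> ` (U \<inter> V)) (\<psi> \<circ> inv_into U \<phi>))"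

definition smooth_funs ::
  "('p::{second_countable_topology,t2_space}, 'e::euclidean_space) chart set \<Rightarrow> ('p \<Rightarrow> real) set" where
  "smooth_funs \<A> = {f. \<forall>(U, \<phi>)\<in>\<A>. smooth_on (\<phi> ` U) (f \<circ> inv_into U \<phi>)}"

definition smooth_map ::
  "('p::{second_countable_topology,t2_space}, 'e::euclidean_space) chart set \<Rightarrow> ('p \<Rightarrow> 'p) \<Rightarrow> bool" where
  "smooth_map \<A> s \<longleftrightarrow>
     continuous_on UNIV s \<and>
     (\<forall>(U, \<phi>)\<in>\<A>. \<forall>(V, \<psi>)\<in>\<A>. smooth_on (\<phi> ` (U \<inter> s -` V)) (\<psi> \<circ> s \<circ> inv_into U \<phi>))"

definition diffeomorphism ::
  "('p::{second_countable_topology,t2_space}, 'e::euclidean_space) chart set \<Rightarrow> ('p \<Rightarrow> 'p) \<Rightarrow> bool" where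
  "diffeomorphism \<A> s \<longleftrightarrow> bij s \<and> smooth_map \<A> s \<and> smooth_map \<A> (inv s)"

section \<open>Tangent vectors and vector fields\<close>

text \<open>
  Tangent vectors at \<open>p\<close> are the derivations at \<open>p\<close> of the algebra of smooth functions; they are
  made total by the value \<open>0\<close> on nonsmooth functions. Sums, differences and \<open>0\<close> of vectors and
  vector fields, and products of functions, are the pointwise ones.
\<close>

type_synonym 'p tvec = "('p \<Rightarrow> real) \<Rightarrow> real"
type_synonym 'p vfield = "'p \<Rightarrow> 'p tvec"

definition tscale :: "real \<Rightarrow> 'p tvec \<Rightarrow> 'p tvec" (infixr "*\<^sub>T" 75) where
  "c *\<^sub>T v = (\<lambda>f. c * v f)"

definition tangent_space ::
  "('p::{second_countable_topology,t2_space}, 'e::euclidean_space) chart set \<Rightarrow> 'p \<Rightarrow> 'p tvec set" where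
  "tangent_space \<A> p = {v.
     (\<forall>f\<in>smooth_funs \<A>. \<forall>h\<in>smooth_funs \<A>. v (f + h) = v f + v h) \<and>
     (\<forall>f\<in>smooth_funs \<A>. \<forall>c. v (\<lambda>q. c * f q) = c * v f) \<and>
     (\<forall>f\<in>smooth_funs \<A>. \<forall>h\<in>smooth_funs \<A>. v (f * h) = f p * v h + h p * v f) \<and>
     (\<forall>f. f \<notin> smooth_funs \<A> \<longrightarrow> v f = 0)}"

definition vector_fields ::
  "('p::{second_countable_topology,t2_space}, 'e::euclidean_space) chart set \<Rightarrow> 'p vfield set" where
  "vector_fields \<A> = {X. (\<forall>p. X p \<in> tangent_space \<A> p) \<and>
                          (\<forall>f\<in>smooth_funs \<A>. (\<lambda>p. X p f) \<in> smooth_funs \<A>)}"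

definition lie_bracket :: "'p vfield \<Rightarrow> 'p vfield \<Rightarrow> 'p vfield" where
  "lie_bracket X Y = (\<lambda>p f. X p (\<lambda>q. Y q f) - Y p (\<lambda>q. X q f))"

definition differential ::
  "('p::{second_countable_topology,t2_space}, 'e::euclidean_space) chart set
     \<Rightarrow> ('p \<Rightarrow> 'p) \<Rightarrow> 'p tvec \<Rightarrow> 'p tvec" where
  "differential \<A> s v = (\<lambda>f. if f \<in> smooth_funs \<A> then v (f \<circ> s) else 0)"

definition push_field ::
  "('p::{second_countable_topology,t2_space}, 'e::euclidean_space) chart set
     \<Rightarrow> ('p \<Rightarrow> 'p) \<Rightarrow> 'p vfield \<Rightarrow> 'p vfield" where
  "push_field \<A> s X = (\<lambda>q. differential \<A> s (X (inv s q)))"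

section \<open>Riemannian metrics and affine connections\<close>

type_synonym 'p metric = "'p \<Rightarrow> 'p tvec \<Rightarrow> 'p tvec \<Rightarrow> real"

definition riemannian_metric ::
  "('p::{second_countable_topology,t2_space}, 'e::euclidean_space) chart set \<Rightarrow> 'p metric \<Rightarrow> bool" where
  "riemannian_metric \<A> g \<longleftrightarrow>
     (\<forall>p. \<forall>u\<in>tangent_space \<A> p. \<forall>v\<in>tangent_space \<A> p. \<forall>w\<in>tangent_space \<A> p. \<forall>c.
        g p u v = g p v u \<and>
        g p (u + v) w = g p u w + g p v w \<and>
        g p (c *\<^sub>T u) v = c * g p u v \<and>
        (u \<noteq> 0 \<longrightarrow> g p u u > 0)) \<and>
     (\<forall>X\<in>vector_fields \<A>. \<forall>Y\<in>vector_fields \<A>. (\<lambda>p. g p (X p) (Y p)) \<in> smooth_funs \<A>)"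

definition isometry ::
  "('p::{second_countable_topology,t2_space}, 'e::euclidean_space) chart set
     \<Rightarrow> 'p metric \<Rightarrow> ('p \<Rightarrow> 'p) \<Rightarrow> bool" where
  "isometry \<A> g s \<longleftrightarrow> diffeomorphism \<A> s \<and>
     (\<forall>p. \<forall>v\<in>tangent_space \<A> p. \<forall>w\<in>tangent_space \<A> p.
        g (s p) (differential \<A> s v) (differential \<A> s w) = g p v w)"

text \<open>A connection is an operator on global vector fields: \<open>D X Y\<close> is \<open>D\<^sub>X Y\<close>.\<close>

type_synonym 'p connection = "'p vfield \<Rightarrow> 'p vfield \<Rightarrow> 'p vfield"

definition affine_connection ::
  "('p::{second_countable_topology,t2_space}, 'e::euclidean_space) chart set
     \<Rightarrow> 'p connection \<Rightarrow> bool" where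
  "affine_connection \<A> D \<longleftrightarrow>
     (\<forall>X\<in>vector_fields \<A>. \<forall>Y\<in>vector_fields \<A>. D X Y \<in> vector_fields \<A>) \<and>
     (\<forall>X\<in>vector_fields \<A>. \<forall>Y\<in>vector_fields \<A>. \<forall>Z\<in>vector_fields \<A>.
        D (X + Y) Z = D X Z + D Y Z \<and>
        D X (Y + Z) = D X Y + D X Z) \<and>
     (\<forall>f\<in>smooth_funs \<A>. \<forall>X\<in>vector_fields \<A>. \<forall>Y\<in>vector_fields \<A>.
        D (\<lambda>p. f p *\<^sub>T X p) Y = (\<lambda>p. f p *\<^sub>T D X Y p) \<and>
        D X (\<lambda>p. f p *\<^sub>T Y p) = (\<lambda>p. X p f *\<^sub>T Y p + f p *\<^sub>T D X Y p))"

definition dual_connection ::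
  "('p::{second_countable_topology,t2_space}, 'e::euclidean_space) chart set
     \<Rightarrow> 'p metric \<Rightarrow> 'p connection \<Rightarrow> 'p connection \<Rightarrow> bool" where
  "dual_connection \<A> g D D' \<longleftrightarrow> affine_connection \<A> D' \<and>
     (\<forall>X\<in>vector_fields \<A>. \<forall>Y\<in>vector_fields \<A>. \<forall>Z\<in>vector_fields \<A>. \<forall>p.
        X p (\<lambda>q. g q (Y q) (Z q)) = g p (D X Y p) (Z p) + g p (Y p) (D' X Z p))"

definition levi_civita ::
  "('p::{second_countable_topology,t2_space}, 'e::euclidean_space) chart set
     \<Rightarrow> 'p metric \<Rightarrow> 'p connection \<Rightarrow> bool" where
  "levi_civita \<A> g D \<longleftrightarrow> affine_connection \<A> D \<and>
     (\<forall>X\<in>vector_fields \<A>. \<forall>Y\<in>vector_fields \<A>. D X Y - D Y X = lie_bracket X Y) \<and>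
     (\<forall>X\<in>vector_fields \<A>. \<forall>Y\<in>vector_fields \<A>. \<forall>Z\<in>vector_fields \<A>. \<forall>p.
        X p (\<lambda>q. g q (Y q) (Z q)) = g p (D X Y p) (Z p) + g p (Y p) (D X Z p))"

text \<open>
  For a diffeomorphism \<open>s\<close>, the push-forward \<open>s\<^sub>*\<close> is a bijection of the vector fields with
  inverse \<open>(inv s)\<^sub>*\<close>, so the next definition is \<open>(s\<^sub>*D)\<^bsub>s\<^sub>*X\<^esub>(s\<^sub>*Y) = s\<^sub>*(D\<^sub>X Y)\<close> solved for \<open>s\<^sub>*D\<close>.
\<close>

definition push_connection ::
  "('p::{second_countable_topology,t2_space}, 'e::euclidean_space) chart set
     \<Rightarrow> ('p \<Rightarrow> 'p) \<Rightarrow> 'p connection \<Rightarrow> 'p connection" where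
  "push_connection \<A> s D =
     (\<lambda>X Y. push_field \<A> s (D (push_field \<A> (inv s) X) (push_field \<A> (inv s) Y)))"

text \<open>
  Equality of the restrictions of two connections to an open set \<open>U\<close>: as connections are local and
  every vector field on \<open>U\<close> agrees near any given point with a global one, global fields suffice.
\<close>

definition connections_agree_on ::
  "('p::{second_countable_topology,t2_space}, 'e::euclidean_space) chart set
     \<Rightarrow> 'p set \<Rightarrow> 'p connection \<Rightarrow> 'p connection \<Rightarrow> bool" where
  "connections_agree_on \<A> U D D' \<longleftrightarrow>
     (\<forall>X\<in>vector_fields \<A>. \<forall>Y\<in>vector_fields \<A>. \<forall>p\<in>U. D X Y p = D' X Y p)"

section \<open>Geodesics and midpoint means\<close>

definition smooth_curve ::
  "('p::{second_countable_topology,t2_space}, 'e::euclidean_space) chart set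
     \<Rightarrow> (real \<Rightarrow> 'p) \<Rightarrow> bool" where
  "smooth_curve \<A> \<gamma> \<longleftrightarrow> continuous_on {0..1} \<gamma> \<and>
     (\<forall>(U, \<phi>)\<in>\<A>. smooth_on ({0..1} \<inter> \<gamma> -` U) (\<phi> \<circ> \<gamma>))"

definition velocity ::
  "('p::{second_countable_topology,t2_space}, 'e::euclidean_space) chart set
     \<Rightarrow> (real \<Rightarrow> 'p) \<Rightarrow> real \<Rightarrow> 'p tvec" where
  "velocity \<A> \<gamma> t =
     (\<lambda>f. if f \<in> smooth_funs \<A> then vector_derivative (f \<circ> \<gamma>) (at t within {0..1}) else 0)"

definition fields_along ::
  "('p::{second_countable_topology,t2_space}, 'e::euclidean_space) chart set
     \<Rightarrow> (real \<Rightarrow> 'p) \<Rightarrow> (real \<Rightarrow> 'p tvec) set" where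
  "fields_along \<A> \<gamma> = {V. (\<forall>t\<in>{0..1}. V t \<in> tangent_space \<A> (\<gamma> t)) \<and>
                            (\<forall>f\<in>smooth_funs \<A>. smooth_on {0..1} (\<lambda>t. V t f))}"

text \<open>
  The covariant derivative \<open>D/dt\<close> along \<open>\<gamma>\<close> is the unique operator with the following properties;
  the last one is \<open>D/dt (Y \<circ> \<gamma>) = D\<^bsub>\<gamma>'(t)\<^esub> Y\<close>, where the right-hand side is \<open>D\<^sub>X Y\<close> at \<open>\<gamma>(t)\<close>
  for any vector field \<open>X\<close> with value \<open>\<gamma>'(t)\<close> there.
\<close>

definition covariant_derivative_along ::
  "('p::{second_countable_topology,t2_space}, 'e::euclidean_space) chart set
     \<Rightarrow> 'p connection \<Rightarrow> (real \<Rightarrow> 'p) \<Rightarrow> ((real \<Rightarrow> 'p tvec) \<Rightarrow> real \<Rightarrow> 'p tvec) \<Rightarrow> bool" where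
  "covariant_derivative_along \<A> D \<gamma> T \<longleftrightarrow>
     (\<forall>V\<in>fields_along \<A> \<gamma>. T V \<in> fields_along \<A> \<gamma>) \<and>
     (\<forall>V\<in>fields_along \<A> \<gamma>. \<forall>W\<in>fields_along \<A> \<gamma>. \<forall>t\<in>{0..1}. T (V + W) t = T V t + T W t) \<and>
     (\<forall>V\<in>fields_along \<A> \<gamma>. \<forall>h. smooth_on {0..1} h \<longrightarrow> (\<forall>t\<in>{0..1}.
        T (\<lambda>r. h r *\<^sub>T V r) t = vector_derivative h (at t within {0..1}) *\<^sub>T V t + h t *\<^sub>T T V t)) \<and>
     (\<forall>X\<in>vector_fields \<A>. \<forall>Y\<in>vector_fields \<A>. \<forall>t\<in>{0..1}.
        X (\<gamma> t) = velocity \<A> \<gamma> t \<longrightarrow> T (Y \<circ> \<gamma>) t = D X Y (\<gamma> t))"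

definition geodesic ::
  "('p::{second_countable_topology,t2_space}, 'e::euclidean_space) chart set
     \<Rightarrow> 'p connection \<Rightarrow> (real \<Rightarrow> 'p) \<Rightarrow> bool" where
  "geodesic \<A> D \<gamma> \<longleftrightarrow> smooth_curve \<A> \<gamma> \<and>
     (\<exists>T. covariant_derivative_along \<A> D \<gamma> T \<and> (\<forall>t\<in>{0..1}. T (velocity \<A> \<gamma>) t = 0))"

text \<open>Curves are normalised outside \<open>{0..1}\<close>, so that uniqueness of a geodesic is equality.\<close>

definition geodesics_between ::
  "('p::{second_countable_topology,t2_space}, 'e::euclidean_space) chart set
     \<Rightarrow> 'p connection \<Rightarrow> 'p \<Rightarrow> 'p \<Rightarrow> (real \<Rightarrow> 'p) set" where
  "geodesics_between \<A> D P Q = {\<gamma> \<in> extensional {0..1}. geodesic \<A> D \<gamma> \<and> \<gamma> 0 = P \<and> \<gamma> 1 = Q}"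

definition uniquely_joined ::
  "('p::{second_countable_topology,t2_space}, 'e::euclidean_space) chart set
     \<Rightarrow> 'p connection \<Rightarrow> 'p \<Rightarrow> 'p \<Rightarrow> bool" where
  "uniquely_joined \<A> D P Q \<longleftrightarrow> (\<exists>!\<gamma>. \<gamma> \<in> geodesics_between \<A> D P Q)"

definition geodesic_segment ::
  "('p::{second_countable_topology,t2_space}, 'e::euclidean_space) chart set
     \<Rightarrow> 'p connection \<Rightarrow> 'p \<Rightarrow> 'p \<Rightarrow> real \<Rightarrow> 'p" where
  "geodesic_segment \<A> D P Q = (THE \<gamma>. \<gamma> \<in> geodesics_between \<A> D P Q)"

definition midpoint_mean ::
  "('p::{second_countable_topology,t2_space}, 'e::euclidean_space) chart set
     \<Rightarrow> 'p connection \<Rightarrow> 'p \<Rightarrow> 'p \<Rightarrow> 'p" where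
  "midpoint_mean \<A> D P Q = geodesic_segment \<A> D P Q (1/2)"

end

theory Submission
  imports Defs
begin

text \<open>
  The isometry \<open>s\<close> is a point reflection about \<open>c\<close>, the metric midpoint of \<open>P\<close> and \<open>Q\<close>. Let \<open>\<gamma>\<close> be the
  Levi-Civita geodesic from \<open>P\<close> to \<open>Q\<close>. The Levi-Civita connection is unique, hence invariant under the
  isometry (\<open>levi_civita_push\<close>), so \<open>t \<mapsto> s (\<gamma> (1 - t))\<close> is again a geodesic. As \<open>s\<close> fixes \<open>c\<close> and acts as
  \<open>- id\<close> there, this geodesic has at \<open>t = 1/2\<close> the position and velocity of \<open>\<gamma>\<close>, and therefore equals
  \<open>\<gamma>\<close>. Thus \<open>s\<close> exchanges \<open>P\<close> and \<open>Q\<close>.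

  A diffeomorphism maps geodesics of a connection to geodesics of the pushed-forward one
  (\<open>geodesic_image\<close>). Since \<open>s\<^sub>*D = D'\<close> on \<open>U\<close>, the reversed image of the \<open>D\<close>-segment from \<open>P\<close> to \<open>Q\<close>
  is a \<open>D'\<close>-geodesic from \<open>P\<close> to \<open>Q\<close>, hence the \<open>D'\<close>-segment, so that \<open>s\<close> maps the \<open>D\<close>-midpoint \<open>A\<close> to the
  \<open>D'\<close>-midpoint \<open>M\<close>. An isometry preserves duality, so also \<open>s\<^sub>*D' = D\<close> on \<open>U\<close>
  (\<open>dual_connection_push_swap\<close>) and \<open>s\<close> maps \<open>M\<close> to \<open>A\<close>. Hence \<open>s\<close> reverses the Levi-Civita segment
  from \<open>A\<close> to \<open>M\<close> and fixes its midpoint. That midpoint lies in \<open>U\<close>, where \<open>c\<close> is the only fixed point.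

  The analytic core is that a geodesic is determined by its position and velocity at one time
  (\<open>geodesic_unique\<close>). This is uniqueness for the geodesic equation in coordinates, and reaching
  coordinates takes some work: connections, tangent vectors and covariant derivatives are given by
  their action on global functions and fields, so coordinate functions and frames must be extended
  to the manifold with smooth cut-off functions (\<open>adapted_frame_exists\<close>). This in turn rests on a
  calculus for \<open>smooth_on\<close>.
\<close>

section \<open>Calculus of smooth functions on sets with unique derivatives\<close>

text \<open>
  The points of the set accumulate along every coordinate axis, so a function has at most one
  derivative within the set. Both open sets and the relatively open parts of \<open>{0..1}\<close> qualify, so one
  calculus serves charts and curves alike.
\<close>

definition determines_derivatives :: "'a::euclidean_space set \<Rightarrow> bool" where
  "determines_derivatives S \<longleftrightarrow>
     (\<forall>x\<in>S. \<forall>b\<in>Basis. \<forall>e>0. \<exists>d. 0 < \<bar>d\<bar> \<and> \<bar>d\<bar> < e \<and> x + d *\<^sub>R b \<in> S)"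

lemma determines_derivatives_openin:
  assumes "determines_derivatives S" "openin (top_of_set S) T"
  shows "determines_derivatives T"
  unfolding determines_derivatives_def
proof (intro ballI allI impI)
  fix x b :: 'a and e :: real
  assume x: "x \<in> T" and b: "b \<in> Basis" and e: "e > 0"
  obtain r where r: "r > 0" "ball x r \<inter> S \<subseteq> T"
    using assms(2) x by (auto simp: openin_contains_ball)
  have "x \<in> S" using assms(2) x openin_imp_subset by blast
  then obtain d where d: "0 < \<bar>d\<bar>" "\<bar>d\<bar> < min e r" "x + d *\<^sub>R b \<in> S"
    using assms(1) b e r(1) unfolding determines_derivatives_def by (metis min_less_iff_conj)
  moreover have "x + d *\<^sub>R b \<in> ball x r" using d b by (simp add: dist_norm)
  ultimately show "\<exists>d. 0 < \<bar>d\<bar> \<and> \<bar>d\<bar> < e \<and> x + d *\<^sub>R b \<in> T"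
    using r(2) by (intro exI[of _ d]) auto
qed

lemma determines_derivatives_UNIV: "determines_derivatives (UNIV :: 'a::euclidean_space set)"
  unfolding determines_derivatives_def
proof (intro ballI allI impI)
  fix x b :: "'a" and e :: real assume "e > 0"
  then show "\<exists>d. 0 < \<bar>d\<bar> \<and> \<bar>d\<bar> < e \<and> x + d *\<^sub>R b \<in> UNIV" by (intro exI[of _ "e / 2"]) auto
qed

lemma determines_derivatives_open: "open S \<Longrightarrow> determines_derivatives S"
  by (rule determines_derivatives_openin[OF determines_derivatives_UNIV]) (auto simp only: openin_open)

lemma determines_derivatives_unit_interval: "determines_derivatives {0..1::real}"
  unfolding determines_derivatives_def
proof (intro ballI allI impI)
  fix x b e :: real
  assume "x \<in> {0..1}" "b \<in> Basis" "e > 0"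
  then show "\<exists>d. 0 < \<bar>d\<bar> \<and> \<bar>d\<bar> < e \<and> x + d *\<^sub>R b \<in> {0..1}"
    by (intro exI[of _ "if x < 1/2 then min (e/2) (1/4) else - min (e/2) (1/4)"]) auto
qed

lemma frechet_derivative_within_cong:
  assumes "x \<in> S" "\<And>y. y \<in> S \<Longrightarrow> f y = g y"
  shows "frechet_derivative f (at x within S) = frechet_derivative g (at x within S)"
proof -
  have "(f has_derivative f') (at x within S) \<longleftrightarrow> (g has_derivative f') (at x within S)" for f'
    using assms has_derivative_transform[OF assms(1), of g f f']
      has_derivative_transform[OF assms(1), of f g f'] by auto
  then show ?thesis by (simp add: frechet_derivative_def)
qed

lemma Ck_on_cong:
  assumes "Ck_on k S f" "\<And>x. x \<in> S \<Longrightarrow> f x = g x"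
  shows "Ck_on k S g"
  using assms
proof (induction k arbitrary: f g)
  case 0
  then show ?case by (auto cong: continuous_on_cong)
next
  case (Suc k)
  have "g differentiable_on S"
    unfolding differentiable_on_def
  proof
    fix x assume x: "x \<in> S"
    then obtain f' where "(f has_derivative f') (at x within S)"
      using Suc.prems(1) by (auto simp: differentiable_on_def differentiable_def)
    then have "(g has_derivative f') (at x within S)"
      by (rule has_derivative_transform[rotated 2]) (use x Suc.prems(2) in auto)
    then show "g differentiable (at x within S)" by (rule differentiableI)
  qed
  moreover have "Ck_on k S (\<lambda>x. frechet_derivative g (at x within S) v)" for v
  proof (rule Suc.IH)
    show "Ck_on k S (\<lambda>x. frechet_derivative f (at x within S) v)" using Suc.prems(1) by simp
    show "frechet_derivative f (at x within S) v = frechet_derivative g (at x within S) v"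
      if "x \<in> S" for x
      using frechet_derivative_within_cong[of x S f g] that Suc.prems(2) by simp
  qed
  ultimately show ?case by simp
qed

text \<open>
  The working form of the recursion: any derivative may be used, since it must be the one that
  \<open>frechet_derivative\<close> selects.
\<close>

lemma Ck_on_SucI:
  assumes S: "determines_derivatives S"
    and f: "\<And>x. x \<in> S \<Longrightarrow> (f has_derivative f' x) (at x within S)"
    and f': "\<And>v. Ck_on k S (\<lambda>x. f' x v)"
  shows "Ck_on (Suc k) S f"
proof -
  have "frechet_derivative f (at x within S) = f' x" if "x \<in> S" for x
  proof (rule frechet_derivative_unique_within)
    show "(f has_derivative frechet_derivative f (at x within S)) (at x within S)"
      using f[OF that] frechet_derivative_works differentiableI by blast
  qed (use S f that in \<open>auto simp: determines_derivatives_def\<close>)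
  then have "Ck_on k S (\<lambda>x. frechet_derivative f (at x within S) v)" for v
    by (intro Ck_on_cong[OF f'[of v]]) auto
  then show ?thesis
    using f by (auto simp: differentiable_on_def differentiable_def)
qed

lemma Ck_on_SucD:
  assumes "Ck_on (Suc k) S f"
  shows "\<exists>f'. (\<forall>x\<in>S. (f has_derivative f' x) (at x within S)) \<and> (\<forall>v. Ck_on k S (\<lambda>x. f' x v))"
proof (intro exI[of _ "\<lambda>x. frechet_derivative f (at x within S)"] conjI ballI allI)
  show "(f has_derivative frechet_derivative f (at x within S)) (at x within S)" if "x \<in> S" for x
    using assms that frechet_derivative_works by (auto simp: differentiable_on_def)
  show "Ck_on k S (\<lambda>x. frechet_derivative f (at x within S) v)" for v
    using assms by simp
qed

lemma Ck_on_Suc_imp: "Ck_on (Suc k) S f \<Longrightarrow> Ck_on k S f"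
proof (induction k arbitrary: f)
  case 0
  then show ?case by (simp add: differentiable_imp_continuous_on)
next
  case (Suc k)
  then show ?case by (metis Ck_on.simps(2))
qed

lemma Ck_on_subset:
  assumes "Ck_on k S f" "T \<subseteq> S" "determines_derivatives T"
  shows "Ck_on k T f"
  using assms(1)
proof (induction k arbitrary: f)
  case 0
  then show ?case using assms(2) continuous_on_subset by auto
next
  case (Suc k)
  obtain f' where f': "\<And>x. x \<in> S \<Longrightarrow> (f has_derivative f' x) (at x within S)"
    "\<And>v. Ck_on k S (\<lambda>x. f' x v)" using Ck_on_SucD[OF Suc.prems(1)] by blast
  show ?case
    using f' assms(2,3) by (intro Ck_on_SucI[of _ _ f'] Suc.IH) (auto intro: has_derivative_subset)
qed

text \<open>
  Near a point of a relatively open \<open>T \<subseteq> S\<close> the filters within \<open>T\<close> and within \<open>S\<close> coincide, so the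
  derivatives that enter the two instances of \<open>Ck_on\<close> are literally the same.
\<close>

lemma Ck_on_locally:
  assumes "\<And>x. x \<in> S \<Longrightarrow> \<exists>T. openin (top_of_set S) T \<and> x \<in> T \<and> Ck_on k T f"
  shows "Ck_on k S f"
  using assms
proof (induction k arbitrary: f)
  case 0
  show ?case
    unfolding Ck_on.simps continuous_on_eq_continuous_within
  proof
    fix x assume "x \<in> S"
    then obtain T where T: "openin (top_of_set S) T" "x \<in> T" "continuous_on T f"
      using 0 by auto
    then obtain W where W: "open W" "T = S \<inter> W" by (auto simp: openin_open)
    have "at x within T = at x within S"
      using W T by (intro at_within_nhd[of _ W]) auto
    then show "continuous (at x within S) f"
      using T continuous_on_eq_continuous_within by metis
  qed
next
  case (Suc k)
  have loc: "\<exists>T. openin (top_of_set S) T \<and> x \<in> T \<and> f differentiable_on T \<and>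
      (\<forall>y\<in>T. at y within T = at y within S) \<and>
      (\<forall>v. Ck_on k T (\<lambda>x. frechet_derivative f (at x within T) v))" if x: "x \<in> S" for x
  proof -
    from Suc.prems[OF x] obtain T
      where T: "openin (top_of_set S) T" "x \<in> T" "Ck_on (Suc k) T f" by auto
    then obtain W where W: "open W" "T = S \<inter> W" by (auto simp: openin_open)
    have "at y within T = at y within S" if "y \<in> T" for y
      using W that by (intro at_within_nhd[of _ W]) auto
    with T show ?thesis by auto
  qed
  have "f differentiable_on S"
    using loc unfolding differentiable_on_def by metis
  moreover have "Ck_on k S (\<lambda>x. frechet_derivative f (at x within S) v)" for v
  proof (rule Suc.IH)
    fix x assume "x \<in> S"
    then obtain T where T: "openin (top_of_set S) T" "x \<in> T"
        "\<And>y. y \<in> T \<Longrightarrow> at y within T = at y within S"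
        "Ck_on k T (\<lambda>x. frechet_derivative f (at x within T) v)"
      using loc by metis
    then show "\<exists>T. openin (top_of_set S) T \<and> x \<in> T \<and>
        Ck_on k T (\<lambda>x. frechet_derivative f (at x within S) v)"
      using Ck_on_cong[OF T(4)] by (intro exI[of _ T]) auto
  qed
  ultimately show ?case by simp
qed

lemma Ck_on_const:
  assumes "determines_derivatives S"
  shows "Ck_on k S (\<lambda>x. c)"
proof (induction k arbitrary: c)
  case (Suc k)
  show ?case
    by (rule Ck_on_SucI[of _ _ "\<lambda>x v. 0"]) (use assms Suc in \<open>auto intro!: derivative_eq_intros\<close>)
qed simp

lemma Ck_on_add:
  assumes "determines_derivatives S" "Ck_on k S f" "Ck_on k S g"
  shows "Ck_on k S (\<lambda>x. f x + g x)"
  using assms(2,3)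
proof (induction k arbitrary: f g)
  case 0
  then show ?case by (auto intro: continuous_intros)
next
  case (Suc k)
  obtain f' where f': "\<And>x. x \<in> S \<Longrightarrow> (f has_derivative f' x) (at x within S)"
    "\<And>v. Ck_on k S (\<lambda>x. f' x v)" using Ck_on_SucD[OF Suc.prems(1)] by blast
  obtain g' where g': "\<And>x. x \<in> S \<Longrightarrow> (g has_derivative g' x) (at x within S)"
    "\<And>v. Ck_on k S (\<lambda>x. g' x v)" using Ck_on_SucD[OF Suc.prems(2)] by blast
  show ?case
    by (rule Ck_on_SucI[of _ _ "\<lambda>x v. f' x v + g' x v"])
       (use assms(1) f' g' in \<open>auto intro!: derivative_eq_intros Suc.IH\<close>)
qed

lemma Ck_on_bilinear:
  assumes "determines_derivatives S" "bounded_bilinear h" "Ck_on k S f" "Ck_on k S g"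
  shows "Ck_on k S (\<lambda>x. h (f x) (g x))"
  using assms(3,4)
proof (induction k arbitrary: f g)
  case 0
  then show ?case using bounded_bilinear.continuous_on[OF assms(2)] by auto
next
  case (Suc k)
  obtain f' where f': "\<And>x. x \<in> S \<Longrightarrow> (f has_derivative f' x) (at x within S)"
    "\<And>v. Ck_on k S (\<lambda>x. f' x v)" using Ck_on_SucD[OF Suc.prems(1)] by blast
  obtain g' where g': "\<And>x. x \<in> S \<Longrightarrow> (g has_derivative g' x) (at x within S)"
    "\<And>v. Ck_on k S (\<lambda>x. g' x v)" using Ck_on_SucD[OF Suc.prems(2)] by blast
  have fg: "Ck_on k S f" "Ck_on k S g" using Suc.prems Ck_on_Suc_imp by blast+
  show ?case
    by (rule Ck_on_SucI[of _ _ "\<lambda>x v. h (f x) (g' x v) + h (f' x v) (g x)"])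
       (use assms(1) f' g' fg in
         \<open>auto intro!: Suc.IH Ck_on_add bounded_bilinear.FDERIV[OF assms(2)]\<close>)
qed

lemma Ck_on_linear_comp:
  assumes "determines_derivatives S" "bounded_linear h" "Ck_on k S f"
  shows "Ck_on k S (\<lambda>x. h (f x))"
  using assms(3)
proof (induction k arbitrary: f)
  case 0
  then show ?case using bounded_linear.continuous_on[OF assms(2)] by auto
next
  case (Suc k)
  obtain f' where f': "\<And>x. x \<in> S \<Longrightarrow> (f has_derivative f' x) (at x within S)"
    "\<And>v. Ck_on k S (\<lambda>x. f' x v)" using Ck_on_SucD[OF Suc.prems(1)] by blast
  show ?case
    by (rule Ck_on_SucI[of _ _ "\<lambda>x v. h (f' x v)"])
       (use assms(1) f' in \<open>auto intro!: Suc.IH bounded_linear.has_derivative[OF assms(2)]\<close>)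
qed

lemma Ck_on_id:
  assumes "determines_derivatives S"
  shows "Ck_on k S (\<lambda>x. x)"
proof (cases k)
  case (Suc k)
  show ?thesis
    unfolding Suc
    by (rule Ck_on_SucI[of _ _ "\<lambda>x v. v"])
       (use assms in \<open>auto intro!: Ck_on_const derivative_eq_intros\<close>)
qed simp

lemma Ck_on_sum:
  assumes "determines_derivatives S" "\<And>i. i \<in> I \<Longrightarrow> Ck_on k S (f i)"
  shows "Ck_on k S (\<lambda>x. \<Sum>i\<in>I. f i x)"
  using assms(2)
proof (induction I rule: infinite_finite_induct)
  case (insert i I)
  then show ?case by (simp add: Ck_on_add[OF assms(1)])
qed (simp_all add: Ck_on_const[OF assms(1)])

lemma Ck_on_compose:
  fixes f :: "'a::euclidean_space \<Rightarrow> 'b::euclidean_space" and g :: "'b \<Rightarrow> 'c::real_normed_vector"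
  assumes S: "determines_derivatives S" and f: "Ck_on k S f" and g: "Ck_on k T g" and im: "f ` S \<subseteq> T"
  shows "Ck_on k S (\<lambda>x. g (f x))"
  using f g
proof (induction k arbitrary: g)
  case 0
  then show ?case using im continuous_on_compose2 by auto
next
  case (Suc k)
  obtain f' where f': "\<And>x. x \<in> S \<Longrightarrow> (f has_derivative f' x) (at x within S)"
    "\<And>v. Ck_on k S (\<lambda>x. f' x v)" using Ck_on_SucD[OF Suc.prems(1)] by blast
  obtain g' where g': "\<And>x. x \<in> T \<Longrightarrow> (g has_derivative g' x) (at x within T)"
    "\<And>v. Ck_on k T (\<lambda>x. g' x v)" using Ck_on_SucD[OF Suc.prems(2)] by blast
  have fk: "Ck_on k S f" using Suc.prems Ck_on_Suc_imp by blast
  \<comment> \<open>The chain rule, with the inner derivative expanded in the basis so that only derivatives of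
     \<open>g\<close> in fixed directions, to which the induction hypothesis applies, are composed with \<open>f\<close>.\<close>
  show ?case
  proof (rule Ck_on_SucI[of _ _ "\<lambda>x v. \<Sum>b\<in>Basis. (f' x v \<bullet> b) *\<^sub>R g' (f x) b"])
    fix x assume x: "x \<in> S"
    have g1: "(g has_derivative g' (f x)) (at (f x) within f ` S)"
      using x im by (intro has_derivative_subset[OF g'(1)]) auto
    then interpret bounded_linear "g' (f x)" by (rule has_derivative_bounded_linear)
    have "((\<lambda>x. g (f x)) has_derivative (\<lambda>v. g' (f x) (f' x v))) (at x within S)"
      by (rule has_derivative_in_compose[OF f'(1)[OF x] g1])
    also have "(\<lambda>v. g' (f x) (f' x v)) = (\<lambda>v. \<Sum>b\<in>Basis. (f' x v \<bullet> b) *\<^sub>R g' (f x) b)"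
    proof
      fix v
      have "g' (f x) (f' x v) = g' (f x) (\<Sum>b\<in>Basis. (f' x v \<bullet> b) *\<^sub>R b)"
        by (simp add: euclidean_representation)
      then show "g' (f x) (f' x v) = (\<Sum>b\<in>Basis. (f' x v \<bullet> b) *\<^sub>R g' (f x) b)"
        by (simp add: sum scaleR)
    qed
    finally show "((\<lambda>x. g (f x)) has_derivative (\<lambda>v. \<Sum>b\<in>Basis. (f' x v \<bullet> b) *\<^sub>R g' (f x) b))
        (at x within S)" .
  next
    show "Ck_on k S (\<lambda>x. \<Sum>b\<in>Basis. (f' x v \<bullet> b) *\<^sub>R g' (f x) b)" for v
      by (intro Ck_on_sum Ck_on_bilinear[OF _ bounded_bilinear_scaleR] S
          Ck_on_linear_comp[OF _ bounded_linear_inner_left] f' Suc.IH fk g')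
  qed (rule S)
qed

lemma Ck_on_inverse:
  fixes f :: "'a::euclidean_space \<Rightarrow> real"
  assumes S: "determines_derivatives S" and f: "Ck_on k S f" and nz: "\<And>x. x \<in> S \<Longrightarrow> f x \<noteq> 0"
  shows "Ck_on k S (\<lambda>x. inverse (f x))"
  using f
proof (induction k)
  case 0
  then show ?case using nz by (auto intro: continuous_on_inverse)
next
  case (Suc k)
  obtain f' where f': "\<And>x. x \<in> S \<Longrightarrow> (f has_derivative f' x) (at x within S)"
    "\<And>v. Ck_on k S (\<lambda>x. f' x v)" using Ck_on_SucD[OF Suc.prems(1)] by blast
  have "Ck_on k S (\<lambda>x. inverse (f x))" using Suc Ck_on_Suc_imp by blast
  then show ?case
    by (intro Ck_on_SucI[of _ _ "\<lambda>x v. (-1) * (inverse (f x) * f' x v * inverse (f x))"]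
          S Ck_on_bilinear[OF _ bounded_bilinear_mult] Ck_on_const f')
       (use Deriv.has_derivative_inverse[OF nz f'(1)] in auto)
qed

lemma smooth_on_cong:
  "\<lbrakk>smooth_on S f; \<And>x. x \<in> S \<Longrightarrow> f x = g x\<rbrakk> \<Longrightarrow> smooth_on S g"
  by (auto simp: smooth_on_def intro!: Ck_on_cong[of _ S f g])

lemma smooth_on_subset:
  "\<lbrakk>smooth_on S f; T \<subseteq> S; determines_derivatives T\<rbrakk> \<Longrightarrow> smooth_on T f"
  by (auto simp: smooth_on_def intro!: Ck_on_subset[of _ S f T])

lemma smooth_on_locally:
  assumes "\<And>x. x \<in> S \<Longrightarrow> \<exists>T. openin (top_of_set S) T \<and> x \<in> T \<and> smooth_on T f"
  shows "smooth_on S f"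
  unfolding smooth_on_def using assms by (auto simp: smooth_on_def intro!: Ck_on_locally)

lemma smooth_on_const: "determines_derivatives S \<Longrightarrow> smooth_on S (\<lambda>x. c)"
  by (auto simp: smooth_on_def intro!: Ck_on_const)

lemma smooth_on_id: "determines_derivatives S \<Longrightarrow> smooth_on S (\<lambda>x. x)"
  by (auto simp: smooth_on_def intro!: Ck_on_id)

lemma smooth_on_add:
  "\<lbrakk>determines_derivatives S; smooth_on S f; smooth_on S g\<rbrakk> \<Longrightarrow> smooth_on S (\<lambda>x. f x + g x)"
  by (auto simp: smooth_on_def intro!: Ck_on_add)

lemma smooth_on_sum:
  "\<lbrakk>determines_derivatives S; \<And>i. i \<in> I \<Longrightarrow> smooth_on S (f i)\<rbrakk> \<Longrightarrow> smooth_on S (\<lambda>x. \<Sum>i\<in>I. f i x)"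
  by (auto simp: smooth_on_def intro!: Ck_on_sum)

lemma smooth_on_bilinear:
  "\<lbrakk>determines_derivatives S; bounded_bilinear h; smooth_on S f; smooth_on S g\<rbrakk>
     \<Longrightarrow> smooth_on S (\<lambda>x. h (f x) (g x))"
  by (auto simp: smooth_on_def intro!: Ck_on_bilinear[of S h])

lemmas smooth_on_mult = smooth_on_bilinear[OF _ bounded_bilinear_mult]
lemmas smooth_on_scaleR = smooth_on_bilinear[OF _ bounded_bilinear_scaleR]

lemma smooth_on_linear_comp:
  "\<lbrakk>determines_derivatives S; bounded_linear h; smooth_on S f\<rbrakk> \<Longrightarrow> smooth_on S (\<lambda>x. h (f x))"
  by (auto simp: smooth_on_def intro!: Ck_on_linear_comp[of S h])

lemma smooth_on_minus:
  "\<lbrakk>determines_derivatives S; smooth_on S f\<rbrakk> \<Longrightarrow> smooth_on S (\<lambda>x. - f x)"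
  by (rule smooth_on_linear_comp[OF _ bounded_linear_minus[OF bounded_linear_ident]])

lemma smooth_on_diff:
  "\<lbrakk>determines_derivatives S; smooth_on S f; smooth_on S g\<rbrakk> \<Longrightarrow> smooth_on S (\<lambda>x. f x - g x)"
  using smooth_on_add[OF _ _ smooth_on_minus, of S f g] by simp

lemma smooth_on_compose:
  fixes f :: "'a::euclidean_space \<Rightarrow> 'b::euclidean_space" and g :: "'b \<Rightarrow> 'c::real_normed_vector"
  shows "\<lbrakk>determines_derivatives S; smooth_on S f; smooth_on T g; f ` S \<subseteq> T\<rbrakk>
    \<Longrightarrow> smooth_on S (\<lambda>x. g (f x))"
  by (auto simp: smooth_on_def intro!: Ck_on_compose[of S _ f T g])

lemma smooth_on_inverse:
  fixes f :: "'a::euclidean_space \<Rightarrow> real"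
  shows "\<lbrakk>determines_derivatives S; smooth_on S f; \<And>x. x \<in> S \<Longrightarrow> f x \<noteq> 0\<rbrakk>
    \<Longrightarrow> smooth_on S (\<lambda>x. inverse (f x))"
  by (auto simp: smooth_on_def intro!: Ck_on_inverse)

lemma smooth_on_imp_continuous_on: "smooth_on S f \<Longrightarrow> continuous_on S f"
  unfolding smooth_on_def by (drule spec[of _ 0]) simp

lemma smooth_on_imp_differentiable:
  assumes "smooth_on S f"
  shows "f differentiable_on S"
proof -
  have "Ck_on (Suc 0) S f" using assms by (simp only: smooth_on_def)
  then show ?thesis by simp
qed

lemma smooth_on_frechet_derivative:
  assumes "smooth_on S f"
  shows "smooth_on S (\<lambda>x. frechet_derivative f (at x within S) v)"
  unfolding smooth_on_def
proof
  fix k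
  have "Ck_on (Suc k) S f" using assms by (simp only: smooth_on_def)
  then show "Ck_on k S (\<lambda>x. frechet_derivative f (at x within S) v)" by simp
qed

lemma smooth_on_has_derivative:
  "\<lbrakk>smooth_on S f; x \<in> S\<rbrakk>
     \<Longrightarrow> (f has_derivative frechet_derivative f (at x within S)) (at x within S)"
  using smooth_on_imp_differentiable[of S f] frechet_derivative_works[of f "at x within S"]
  by (simp add: differentiable_on_def)

section \<open>Smooth cut-off functions on a Euclidean space\<close>

text \<open>
  Besides \<open>exp (- 1 / x)\<close> itself (\<open>n = 0\<close>) the family contains all its multiples by powers of \<open>1 / x\<close>:
  it is closed under differentiation up to linear combinations, so all its members are shown to be
  smooth by one induction.
\<close>

definition flat_at_0 :: "nat \<Rightarrow> real \<Rightarrow> real" where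
  "flat_at_0 n x = (if x > 0 then inverse x ^ n * exp (- inverse x) else 0)"

text \<open>Substituting \<open>y = 1 / x\<close>, this is the decay of \<open>y ^ n / exp y\<close> at infinity.\<close>

lemma flat_at_0_tendsto: "(flat_at_0 n \<longlongrightarrow> 0) (at 0)"
proof -
  have "((\<lambda>y::real. y ^ n / exp y) \<longlongrightarrow> 0) at_top" by (rule tendsto_power_div_exp_0)
  then have "((\<lambda>x::real. inverse x ^ n / exp (inverse x)) \<longlongrightarrow> 0) (at_right 0)"
    using filterlim_inverse_at_top_right by (rule filterlim_compose)
  moreover have "\<forall>\<^sub>F x::real in at_right 0. inverse x ^ n / exp (inverse x) = flat_at_0 n x"
    by (auto simp: eventually_at_filter flat_at_0_def exp_minus divide_inverse)
  ultimately have "(flat_at_0 n \<longlongrightarrow> 0) (at_right 0)" by (rule Lim_transform_eventually)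
  moreover have "(flat_at_0 n \<longlongrightarrow> 0) (at_left 0)"
    by (rule Lim_transform_eventually[OF tendsto_const])
       (auto simp: eventually_at_filter flat_at_0_def)
  ultimately show ?thesis by (simp add: filterlim_split_at)
qed

lemma flat_at_0_has_derivative:
  "(flat_at_0 n has_real_derivative (flat_at_0 (n + 2) x - n * flat_at_0 (n + 1) x)) (at x)"
proof (cases x "0::real" rule: linorder_cases)
  case less
  have "((\<lambda>x. 0) has_real_derivative 0) (at x)" by simp
  then have "(flat_at_0 n has_real_derivative 0) (at x)"
    by (rule has_field_derivative_transform_within_open[of _ _ _ "{..<0}"])
       (use less in \<open>auto simp: flat_at_0_def\<close>)
  then show ?thesis using less by (simp add: flat_at_0_def)
next
  case equal
  have "((\<lambda>h. flat_at_0 n h / h) \<longlongrightarrow> 0) (at 0)"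
    by (rule Lim_transform_eventually[OF flat_at_0_tendsto[of "n + 1"]])
       (auto simp: flat_at_0_def divide_inverse eventually_at_filter)
  then show ?thesis using equal by (simp add: DERIV_def flat_at_0_def)
next
  case greater
  have "((\<lambda>x. inverse x ^ n * exp (- inverse x)) has_real_derivative
      (flat_at_0 (n + 2) x - n * flat_at_0 (n + 1) x)) (at x)"
  proof -
    have "n * (x * inverse x ^ n) = n * inverse x ^ (n - 1)"
      using greater by (cases n) auto
    then have "n * inverse x ^ (n - 1) * (inverse x)\<^sup>2 = n * inverse x ^ (n + 1)"
      using greater by (simp add: field_simps power2_eq_square)
    then show ?thesis
      using greater
      by (auto intro!: derivative_eq_intros simp: flat_at_0_def algebra_simps power2_eq_square)
  qed
  then show ?thesis
    by (rule has_field_derivative_transform_within_open[of _ _ _ "{0<..}"])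
       (use greater in \<open>auto simp: flat_at_0_def\<close>)
qed

lemma smooth_on_flat_at_0: "smooth_on UNIV (flat_at_0 n)"
proof -
  have "Ck_on k UNIV (flat_at_0 n)" for k
  proof (induction k arbitrary: n)
    case 0
    show ?case
      by (auto intro!: DERIV_isCont flat_at_0_has_derivative continuous_at_imp_continuous_on)
  next
    case (Suc k)
    show ?case
    proof (rule Ck_on_SucI[of _ _ "\<lambda>x v. flat_at_0 (n + 2) x * v + (- real n * v) * flat_at_0 (n + 1) x"])
      show "Ck_on k UNIV (\<lambda>x. flat_at_0 (n + 2) x * v + (- real n * v) * flat_at_0 (n + 1) x)" for v
        by (intro Ck_on_add Ck_on_bilinear[OF _ bounded_bilinear_mult] Ck_on_const Suc
            determines_derivatives_UNIV)
      show "(flat_at_0 n has_derivative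
          (\<lambda>v. flat_at_0 (n + 2) x * v + (- real n * v) * flat_at_0 (n + 1) x)) (at x)" for x
        using flat_at_0_has_derivative[of n x] unfolding has_field_derivative_def
        by (rule has_derivative_eq_rhs) (auto simp: algebra_simps)
    qed (rule determines_derivatives_UNIV)
  qed
  then show ?thesis by (simp add: smooth_on_def)
qed

text \<open>
  The function is \<open>u / (u + w)\<close>, where \<open>u\<close> is positive exactly inside the larger ball and \<open>w\<close> exactly
  outside the smaller one; both are \<open>flat_at_0\<close> of a quadratic polynomial.
\<close>

lemma smooth_plateau_function:
  fixes a :: "'e::euclidean_space"
  assumes "0 < r"
  shows "\<exists>\<rho> :: 'e \<Rightarrow> real. smooth_on UNIV \<rho> \<and>
    (\<forall>x\<in>cball a r. \<rho> x = 1) \<and> (\<forall>x. x \<notin> ball a (2 * r) \<longrightarrow> \<rho> x = 0)"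
proof -
  define u where "u x = flat_at_0 0 ((2 * r)\<^sup>2 - (x - a) \<bullet> (x - a))" for x
  define w where "w x = flat_at_0 0 ((x - a) \<bullet> (x - a) - r\<^sup>2)" for x
  note ddU = determines_derivatives_UNIV
  have sq: "smooth_on UNIV (\<lambda>x. (x - a) \<bullet> (x - a))"
    by (intro smooth_on_bilinear[OF _ bounded_bilinear_inner] smooth_on_diff smooth_on_id
        smooth_on_const ddU)
  have u: "smooth_on UNIV u" unfolding u_def
    by (rule smooth_on_compose[OF ddU _ smooth_on_flat_at_0])
       (intro smooth_on_diff smooth_on_const sq ddU, simp)
  have w: "smooth_on UNIV w" unfolding w_def
    by (rule smooth_on_compose[OF ddU _ smooth_on_flat_at_0])
       (intro smooth_on_diff smooth_on_const sq ddU, simp)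
  have sq_norm: "(x - a) \<bullet> (x - a) = (dist a x)\<^sup>2" for x
    by (simp add: dist_norm norm_minus_commute[of a x] power2_norm_eq_inner)
  have u0: "u x = 0" if "x \<notin> ball a (2 * r)" for x
  proof -
    have "(2 * r)\<^sup>2 \<le> (dist a x)\<^sup>2" using that assms by (intro power_mono) auto
    then show ?thesis by (simp add: u_def flat_at_0_def sq_norm)
  qed
  have w0: "w x = 0" if "x \<in> cball a r" for x
  proof -
    have "(dist a x)\<^sup>2 \<le> r\<^sup>2" using that assms by (intro power_mono) auto
    then show ?thesis by (simp add: w_def flat_at_0_def sq_norm)
  qed
  have u1: "u x > 0" if "x \<in> ball a (2 * r)" for x
  proof -
    have "(dist a x)\<^sup>2 < (2 * r)\<^sup>2" using that assms by (intro power_strict_mono) auto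
    then show ?thesis by (simp add: u_def flat_at_0_def sq_norm)
  qed
  have w1: "w x > 0" if "x \<notin> cball a r" for x
  proof -
    have "r\<^sup>2 < (dist a x)\<^sup>2" using that assms by (intro power_strict_mono) auto
    then show ?thesis by (simp add: w_def flat_at_0_def sq_norm)
  qed
  have nn: "u x \<ge> 0" "w x \<ge> 0" for x by (simp_all add: u_def w_def flat_at_0_def)
  have pos: "u x + w x > 0" for x
  proof (cases "x \<in> cball a r")
    case True
    then have "x \<in> ball a (2 * r)" using assms by auto
    then show ?thesis using u1 nn(2)[of x] by (simp add: add_pos_nonneg)
  next
    case False
    then show ?thesis using w1 nn(1)[of x] by (simp add: add_nonneg_pos)
  qed
  show ?thesis
  proof (intro exI[of _ "\<lambda>x. u x * inverse (u x + w x)"] conjI ballI allI impI)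
    show "smooth_on UNIV (\<lambda>x. u x * inverse (u x + w x))"
      using pos by (intro smooth_on_mult smooth_on_inverse smooth_on_add ddU u w) (metis less_irrefl)
    show "u x * inverse (u x + w x) = 1" if "x \<in> cball a r" for x
      using w0[OF that] pos[of x] by simp
    show "u x * inverse (u x + w x) = 0" if "x \<notin> ball a (2 * r)" for x
      using u0[OF that] by simp
  qed
qed

section \<open>Smooth functions, maps and curves on a manifold\<close>

locale smooth_manifold =
  fixes \<A> :: "('p::{second_countable_topology,t2_space}, 'e::euclidean_space) chart set"
  assumes atlas: "smooth_atlas \<A>"
begin

lemma chart_around: obtains U \<phi> where "(U, \<phi>) \<in> \<A>" "p \<in> U"
proof -
  have "p \<in> (\<Union>(U, \<phi>)\<in>\<A>. U)" using atlas by (simp add: smooth_atlas_def)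
  then show thesis using that by auto
qed

lemma chart_props:
  assumes "(U, \<phi>) \<in> \<A>"
  shows "open U" "open (\<phi> ` U)" "homeomorphism U (\<phi> ` U) \<phi> (inv_into U \<phi>)"
  using atlas assms by (auto simp: smooth_atlas_def)

lemma chart_inverse:
  assumes "(U, \<phi>) \<in> \<A>"
  shows "q \<in> U \<Longrightarrow> inv_into U \<phi> (\<phi> q) = q"
    and "y \<in> \<phi> ` U \<Longrightarrow> \<phi> (inv_into U \<phi> y) = y"
    and "y \<in> \<phi> ` U \<Longrightarrow> inv_into U \<phi> y \<in> U"
  using chart_props(3)[OF assms] by (auto simp: homeomorphism_def f_inv_into_f inv_into_into)

lemma chart_inj: "(U, \<phi>) \<in> \<A> \<Longrightarrow> inj_on \<phi> U"
  using chart_inverse(1) by (metis inj_onI)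

lemma open_chart_image:
  assumes "(U, \<phi>) \<in> \<A>" "open W"
  shows "open (\<phi> ` (U \<inter> W))"
proof -
  have "openin (top_of_set (\<phi> ` U)) (\<phi> ` (U \<inter> W))"
    by (rule homeomorphism_imp_open_map[OF chart_props(3)[OF assms(1)]]) (use assms in auto)
  then show ?thesis using chart_props(2)[OF assms(1)] openin_open_trans by blast
qed

lemma openin_chart_image:
  assumes "(U, \<phi>) \<in> \<A>" "open W"
  shows "openin (top_of_set (\<phi> ` U)) (\<phi> ` (U \<inter> W))"
  using open_chart_image[OF assms] by (intro open_subset) auto

lemma determines_derivatives_chart:
  "(U, \<phi>) \<in> \<A> \<Longrightarrow> open W \<Longrightarrow> determines_derivatives (\<phi> ` (U \<inter> W))"
  "(U, \<phi>) \<in> \<A> \<Longrightarrow> determines_derivatives (\<phi> ` U)"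
  using open_chart_image chart_props(2) by (auto intro: determines_derivatives_open)

lemma smooth_transition:
  assumes "(U, \<phi>) \<in> \<A>" "(V, \<psi>) \<in> \<A>"
  shows "smooth_on (\<phi> ` (U \<inter> V)) (\<psi> \<circ> inv_into U \<phi>)"
  using atlas assms by (auto simp: smooth_atlas_def)

lemma smooth_funsD:
  "\<lbrakk>f \<in> smooth_funs \<A>; (U, \<phi>) \<in> \<A>\<rbrakk> \<Longrightarrow> smooth_on (\<phi> ` U) (f \<circ> inv_into U \<phi>)"
  by (auto simp: smooth_funs_def)

lemma smooth_funsI:
  "(\<And>U \<phi>. (U, \<phi>) \<in> \<A> \<Longrightarrow> smooth_on (\<phi> ` U) (f \<circ> inv_into U \<phi>)) \<Longrightarrow> f \<in> smooth_funs \<A>"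
  by (auto simp: smooth_funs_def)

lemma smooth_funs_const: "(\<lambda>q. c) \<in> smooth_funs \<A>"
  by (rule smooth_funsI) (simp add: o_def smooth_on_const determines_derivatives_chart)

lemma smooth_funs_add:
  assumes "f \<in> smooth_funs \<A>" "h \<in> smooth_funs \<A>"
  shows "(\<lambda>q. f q + h q) \<in> smooth_funs \<A>"
  using smooth_on_add[OF determines_derivatives_chart(2) smooth_funsD smooth_funsD, OF _ assms(1) _ assms(2)]
  by (intro smooth_funsI) (simp add: o_def)

lemma smooth_funs_mult:
  assumes "f \<in> smooth_funs \<A>" "h \<in> smooth_funs \<A>"
  shows "(\<lambda>q. f q * h q) \<in> smooth_funs \<A>"
  using smooth_on_mult[OF determines_derivatives_chart(2) smooth_funsD smooth_funsD, OF _ assms(1) _ assms(2)]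
  by (intro smooth_funsI) (simp add: o_def)

lemma smooth_funs_cmult: "f \<in> smooth_funs \<A> \<Longrightarrow> (\<lambda>q. c * f q) \<in> smooth_funs \<A>"
  by (intro smooth_funs_mult smooth_funs_const)

lemma smooth_funs_diff:
  "f \<in> smooth_funs \<A> \<Longrightarrow> h \<in> smooth_funs \<A> \<Longrightarrow> (\<lambda>q. f q - h q) \<in> smooth_funs \<A>"
  using smooth_funs_add[OF _ smooth_funs_cmult[of h "-1"]] by simp

lemma smooth_funs_compose_smooth_map:
  assumes f: "f \<in> smooth_funs \<A>" and s: "smooth_map \<A> s"
  shows "f \<circ> s \<in> smooth_funs \<A>"
proof (rule smooth_funsI, rule smooth_on_locally)
  fix U \<phi> y assume U: "(U, \<phi>) \<in> \<A>" and y: "y \<in> \<phi> ` U"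
  then obtain q where q: "q \<in> U" "y = \<phi> q" by auto
  obtain V \<psi> where V: "(V, \<psi>) \<in> \<A>" "s q \<in> V" using chart_around by blast
  have W: "open (s -` V)"
    using s chart_props(1)[OF V(1)] open_vimage by (auto simp: smooth_map_def)
  let ?T = "\<phi> ` (U \<inter> s -` V)"
  have "smooth_on ?T (\<psi> \<circ> s \<circ> inv_into U \<phi>)"
    using s U V by (auto simp: smooth_map_def)
  then have "smooth_on ?T (\<lambda>x. (f \<circ> inv_into V \<psi>) ((\<psi> \<circ> s \<circ> inv_into U \<phi>) x))"
    by (rule smooth_on_compose[OF determines_derivatives_chart(1)[OF U W] _ smooth_funsD[OF f V(1)]])
       (use chart_inverse[OF U] in auto)
  then have "smooth_on ?T (f \<circ> s \<circ> inv_into U \<phi>)"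
    by (rule smooth_on_cong) (use chart_inverse[OF U] chart_inverse[OF V(1)] in auto)
  then show "\<exists>T. openin (top_of_set (\<phi> ` U)) T \<and> y \<in> T \<and> smooth_on T (f \<circ> s \<circ> inv_into U \<phi>)"
    using openin_chart_image[OF U W] q V(2) by (intro exI[of _ ?T]) auto
qed

text \<open>
  Smoothness is checked near each point of another chart domain: inside \<open>U\<close> the function is composed
  with a transition map, and outside \<open>U\<close> it vanishes on a neighbourhood, because the preimage of the
  compact \<open>K\<close> is closed in the Hausdorff space \<open>'p\<close>.
\<close>

lemma smooth_funs_extend_by_zero:
  assumes U: "(U, \<phi>) \<in> \<A>" and u: "smooth_on (\<phi> ` U) u"
    and K: "compact K" "K \<subseteq> \<phi> ` U" and u0: "\<And>y. y \<in> \<phi> ` U - K \<Longrightarrow> u y = 0"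
  shows "(\<lambda>q. if q \<in> U then u (\<phi> q) else 0) \<in> smooth_funs \<A>" (is "?F \<in> _")
proof (rule smooth_funsI, rule smooth_on_locally)
  fix V \<psi> y assume V: "(V, \<psi>) \<in> \<A>" and y: "y \<in> \<psi> ` V"
  then obtain q where q: "q \<in> V" "y = \<psi> q" by auto
  show "\<exists>T. openin (top_of_set (\<psi> ` V)) T \<and> y \<in> T \<and> smooth_on T (?F \<circ> inv_into V \<psi>)"
  proof (cases "q \<in> U")
    case True
    let ?T = "\<psi> ` (V \<inter> U)"
    have "smooth_on ?T (\<lambda>x. u ((\<phi> \<circ> inv_into V \<psi>) x))"
      by (rule smooth_on_compose[OF determines_derivatives_chart(1)[OF V chart_props(1)[OF U]]
            smooth_transition[OF V U] u])
         (use chart_inverse[OF V] in auto)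
    then have "smooth_on ?T (?F \<circ> inv_into V \<psi>)"
      by (rule smooth_on_cong) (use chart_inverse[OF V] in auto)
    then show ?thesis
      using openin_chart_image[OF V chart_props(1)[OF U]] q True by (intro exI[of _ ?T]) auto
  next
    case False
    define C where "C = inv_into U \<phi> ` K"
    have "continuous_on K (inv_into U \<phi>)"
      using chart_props(3)[OF U] K(2) by (auto simp: homeomorphism_def intro: continuous_on_subset)
    then have "closed C" unfolding C_def
      using K(1) by (intro compact_imp_closed compact_continuous_image)
    then have W: "open (- C)" by auto
    have CU: "C \<subseteq> U" unfolding C_def using chart_inverse(3)[OF U] K(2) by auto
    have F0: "?F r = 0" if "r \<notin> C" for r
    proof (cases "r \<in> U")
      case True
      then have "\<phi> r \<notin> K"
        using that chart_inverse(1)[OF U True] unfolding C_def by (metis image_eqI)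
      then show ?thesis using True u0[of "\<phi> r"] by auto
    qed simp
    let ?T = "\<psi> ` (V \<inter> - C)"
    have "smooth_on ?T (?F \<circ> inv_into V \<psi>)"
    proof (rule smooth_on_cong[OF smooth_on_const[OF determines_derivatives_chart(1)[OF V W]]])
      fix x assume "x \<in> ?T"
      then obtain r where "r \<in> V" "r \<notin> C" "x = \<psi> r" by auto
      then show "0 = (?F \<circ> inv_into V \<psi>) x" using F0[of r] chart_inverse(1)[OF V, of r] by (simp split: if_splits)
    qed
    then show ?thesis
      using openin_chart_image[OF V W] q False CU by (intro exI[of _ ?T]) auto
  qed
qed

lemma openin_curve_preimage:
  assumes "continuous_on {0..1} \<gamma>" "open W"
  shows "openin (top_of_set {0..1::real}) ({0..1} \<inter> \<gamma> -` W)"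
  using assms by (metis continuous_openin_preimage_gen)

lemma determines_derivatives_curve_preimage:
  "continuous_on {0..1} \<gamma> \<Longrightarrow> open W \<Longrightarrow> determines_derivatives ({0..1::real} \<inter> \<gamma> -` W)"
  using determines_derivatives_openin[OF determines_derivatives_unit_interval] openin_curve_preimage
  by blast

lemma smooth_curveD:
  assumes "smooth_curve \<A> \<gamma>"
  shows "continuous_on {0..1} \<gamma>" "(U, \<phi>) \<in> \<A> \<Longrightarrow> smooth_on ({0..1} \<inter> \<gamma> -` U) (\<phi> \<circ> \<gamma>)"
  using assms by (auto simp: smooth_curve_def)

lemma smooth_fun_along_curve:
  assumes f: "f \<in> smooth_funs \<A>" and \<gamma>: "smooth_curve \<A> \<gamma>"
  shows "smooth_on {0..1} (f \<circ> \<gamma>)"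
proof (rule smooth_on_locally)
  fix t :: real assume t: "t \<in> {0..1}"
  obtain U \<phi> where U: "(U, \<phi>) \<in> \<A>" "\<gamma> t \<in> U" using chart_around by blast
  note oU = chart_props(1)[OF U(1)]
  let ?T = "{0..1} \<inter> \<gamma> -` U"
  have "smooth_on ?T (\<lambda>x. (f \<circ> inv_into U \<phi>) ((\<phi> \<circ> \<gamma>) x))"
    by (rule smooth_on_compose[OF determines_derivatives_curve_preimage[OF smooth_curveD(1)[OF \<gamma>] oU]
          smooth_curveD(2)[OF \<gamma> U(1)] smooth_funsD[OF f U(1)]]) auto
  then have "smooth_on ?T (f \<circ> \<gamma>)"
    by (rule smooth_on_cong) (use chart_inverse[OF U(1)] in auto)
  then show "\<exists>T. openin (top_of_set {0..1}) T \<and> t \<in> T \<and> smooth_on T (f \<circ> \<gamma>)"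
    using openin_curve_preimage[OF smooth_curveD(1)[OF \<gamma>] oU] t U(2) by (intro exI[of _ ?T]) auto
qed

lemma smooth_curve_image:
  assumes s: "smooth_map \<A> s" and \<gamma>: "smooth_curve \<A> \<gamma>"
  shows "smooth_curve \<A> (s \<circ> \<gamma>)"
  unfolding smooth_curve_def
proof (intro conjI, goal_cases)
  case 1
  have "continuous_on (\<gamma> ` {0..1}) s"
    using s by (auto simp: smooth_map_def intro: continuous_on_subset)
  then show ?case using smooth_curveD(1)[OF \<gamma>] continuous_on_compose by blast
next
  case 2
  note c = smooth_curveD(1)[OF \<gamma>]
  have "smooth_on ({0..1} \<inter> (s \<circ> \<gamma>) -` V) (\<psi> \<circ> (s \<circ> \<gamma>))" if V: "(V, \<psi>) \<in> \<A>" for V \<psi>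
  proof (rule smooth_on_locally)
    fix t assume t: "t \<in> {0..1} \<inter> (s \<circ> \<gamma>) -` V"
    obtain U \<phi> where U: "(U, \<phi>) \<in> \<A>" "\<gamma> t \<in> U" using chart_around by blast
    have W: "open (U \<inter> s -` V)"
      using s chart_props(1)[OF V] chart_props(1)[OF U(1)] open_vimage
      by (auto simp: smooth_map_def)
    let ?T = "{0..1} \<inter> \<gamma> -` (U \<inter> s -` V)"
    note dd = determines_derivatives_curve_preimage[OF c W]
    have "smooth_on ?T (\<phi> \<circ> \<gamma>)"
      by (rule smooth_on_subset[OF smooth_curveD(2)[OF \<gamma> U(1)] _ dd]) auto
    moreover have "smooth_on (\<phi> ` (U \<inter> s -` V)) (\<psi> \<circ> s \<circ> inv_into U \<phi>)"
      using s U V by (auto simp: smooth_map_def)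
    ultimately have "smooth_on ?T (\<lambda>x. (\<psi> \<circ> s \<circ> inv_into U \<phi>) ((\<phi> \<circ> \<gamma>) x))"
      by (rule smooth_on_compose[OF dd]) auto
    then have sm: "smooth_on ?T (\<psi> \<circ> (s \<circ> \<gamma>))"
      by (rule smooth_on_cong) (use chart_inverse[OF U(1)] in auto)
    have "openin (top_of_set ({0..1} \<inter> (s \<circ> \<gamma>) -` V)) ?T"
      by (rule openin_subset_trans[OF openin_curve_preimage[OF c W]]) auto
    then show "\<exists>T. openin (top_of_set ({0..1} \<inter> (s \<circ> \<gamma>) -` V)) T \<and> t \<in> T \<and>
        smooth_on T (\<psi> \<circ> (s \<circ> \<gamma>))"
      using sm t U(2) by (intro exI[of _ ?T]) auto
  qed
  then show ?case by auto
qed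

section \<open>Velocities and adapted frames\<close>

lemma at_within_unit_interval_nontrivial: "t \<in> {0..1} \<Longrightarrow> at t within {0..1::real} \<noteq> bot"
  by (auto simp: trivial_limit_within islimpt_Icc)

lemma smooth_on_has_vector_derivative:
  fixes h :: "real \<Rightarrow> 'b::real_normed_vector"
  assumes "smooth_on {0..1} h" "t \<in> {0..1}"
  shows "(h has_vector_derivative vector_derivative h (at t within {0..1})) (at t within {0..1})"
  using smooth_on_imp_differentiable[OF assms(1)] assms(2) vector_derivative_works[of h "at t within {0..1}"]
  by (auto simp: differentiable_on_def)

lemma velocity_has_derivative:
  assumes "f \<in> smooth_funs \<A>" "smooth_curve \<A> \<gamma>" "t \<in> {0..1}"
  shows "((f \<circ> \<gamma>) has_vector_derivative velocity \<A> \<gamma> t f) (at t within {0..1})"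
  using smooth_on_has_vector_derivative[OF smooth_fun_along_curve[OF assms(1,2)] assms(3)] assms(1)
  by (simp add: velocity_def)

lemma velocity_eqI:
  assumes "f \<in> smooth_funs \<A>" "t \<in> {0..1}"
    "((f \<circ> \<gamma>) has_vector_derivative d) (at t within {0..1})"
  shows "velocity \<A> \<gamma> t f = d"
  using vector_derivative_within[OF at_within_unit_interval_nontrivial[OF assms(2)] assms(3)] assms(1)
  by (simp add: velocity_def)

lemma velocity_in_chart:
  assumes U: "(U, \<phi>) \<in> \<A>" "\<gamma> t \<in> U" and \<gamma>: "smooth_curve \<A> \<gamma>" and t: "t \<in> {0..1}"
  obtains d where "\<And>f. f \<in> smooth_funs \<A> \<Longrightarrow>
    velocity \<A> \<gamma> t f = frechet_derivative (f \<circ> inv_into U \<phi>) (at (\<phi> (\<gamma> t)) within \<phi> ` U) d"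
proof -
  note c = smooth_curveD(1)[OF \<gamma>] and oU = chart_props(1)[OF U(1)]
  let ?S = "{0..1} \<inter> \<gamma> -` U"
  obtain W where W: "open W" "?S = {0..1} \<inter> W"
    using openin_curve_preimage[OF c oU] by (auto simp: openin_open)
  have eqf: "at t within ?S = at t within {0..1}"
  proof (rule at_within_nhd[OF _ W(1)])
    show "t \<in> W" using W(2) t U(2) by blast
    show "?S \<inter> W - {t} = {0..1} \<inter> W - {t}" using W(2) by blast
  qed
  define x' where "x' = vector_derivative (\<phi> \<circ> \<gamma>) (at t within ?S)"
  have "(\<phi> \<circ> \<gamma>) differentiable (at t within ?S)"
    using smooth_on_imp_differentiable[OF smooth_curveD(2)[OF \<gamma> U(1)]] t U(2)
    by (auto simp: differentiable_on_def)
  then have x: "((\<phi> \<circ> \<gamma>) has_derivative (\<lambda>h. h *\<^sub>R x')) (at t within ?S)"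
    unfolding x'_def by (metis vector_derivative_works has_vector_derivative_def)
  show thesis
  proof (rule that[of x'])
    fix f assume f: "f \<in> smooth_funs \<A>"
    let ?F = "f \<circ> inv_into U \<phi>"
    let ?D = "frechet_derivative ?F (at (\<phi> (\<gamma> t)) within \<phi> ` U)"
    have D: "(?F has_derivative ?D) (at (\<phi> (\<gamma> t)) within \<phi> ` U)"
      using smooth_on_has_derivative[OF smooth_funsD[OF f U(1)]] U(2) by auto
    then interpret bounded_linear ?D by (rule has_derivative_bounded_linear)
    have "(?F has_derivative ?D) (at ((\<phi> \<circ> \<gamma>) t) within (\<phi> \<circ> \<gamma>) ` ?S)"
      using has_derivative_subset[OF D, of "(\<phi> \<circ> \<gamma>) ` ?S"] by auto
    from has_derivative_in_compose[OF x this]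
    have "((\<lambda>r. ?F ((\<phi> \<circ> \<gamma>) r)) has_derivative (\<lambda>h. h *\<^sub>R ?D x')) (at t within ?S)"
      by (simp add: scaleR)
    then have "((f \<circ> \<gamma>) has_derivative (\<lambda>h. h *\<^sub>R ?D x')) (at t within ?S)"
      by (rule has_derivative_transform[rotated 2])
         (use t U(2) chart_inverse(1)[OF U(1)] in auto)
    then show "velocity \<A> \<gamma> t f = ?D x'"
      unfolding eqf by (intro velocity_eqI f t) (simp add: has_vector_derivative_def)
  qed
qed

lemma tangent_spaceI:
  assumes "\<And>f h. \<lbrakk>f \<in> smooth_funs \<A>; h \<in> smooth_funs \<A>\<rbrakk> \<Longrightarrow> v (\<lambda>q. f q + h q) = v f + v h"
    "\<And>f c. f \<in> smooth_funs \<A> \<Longrightarrow> v (\<lambda>q. c * f q) = c * v f"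
    "\<And>f h. \<lbrakk>f \<in> smooth_funs \<A>; h \<in> smooth_funs \<A>\<rbrakk>
       \<Longrightarrow> v (\<lambda>q. f q * h q) = f p * v h + h p * v f"
    "\<And>f. f \<notin> smooth_funs \<A> \<Longrightarrow> v f = 0"
  shows "v \<in> tangent_space \<A> p"
  using assms by (auto simp: tangent_space_def plus_fun_def times_fun_def)

lemma tangent_spaceD:
  assumes "v \<in> tangent_space \<A> p"
  shows "\<lbrakk>f \<in> smooth_funs \<A>; h \<in> smooth_funs \<A>\<rbrakk> \<Longrightarrow> v (\<lambda>q. f q + h q) = v f + v h"
    "f \<in> smooth_funs \<A> \<Longrightarrow> v (\<lambda>q. c * f q) = c * v f"
    "\<lbrakk>f \<in> smooth_funs \<A>; h \<in> smooth_funs \<A>\<rbrakk> \<Longrightarrow> v (\<lambda>q. f q * h q) = f p * v h + h p * v f"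
    "f \<notin> smooth_funs \<A> \<Longrightarrow> v f = 0"
  using assms by (auto simp: tangent_space_def plus_fun_def times_fun_def)

text \<open>
  Vectors and connections are only given on global functions and fields, so coordinates \<open>X\<close> and
  coordinate fields \<open>E\<close> have to be globally smooth objects. They behave as a chart and its
  coordinate frame on \<open>{q. \<beta> q \<noteq> 0}\<close>. The spanning property is demanded for velocities only, where
  it is the chain rule; for arbitrary derivations it would require Hadamard's lemma.
\<close>

definition adapted_frame :: "('p \<Rightarrow> 'e) \<Rightarrow> ('e \<Rightarrow> 'p vfield) \<Rightarrow> ('p \<Rightarrow> real) \<Rightarrow> bool" where
  "adapted_frame X E \<beta> \<longleftrightarrow>
     \<beta> \<in> smooth_funs \<A> \<and> (\<forall>b. (\<lambda>q. X q \<bullet> b) \<in> smooth_funs \<A>) \<and> (\<forall>b. E b \<in> vector_fields \<A>) \<and>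
     (\<forall>\<gamma> t f. smooth_curve \<A> \<gamma> \<longrightarrow> t \<in> {0..1} \<longrightarrow> \<beta> (\<gamma> t) \<noteq> 0 \<longrightarrow> f \<in> smooth_funs \<A> \<longrightarrow>
       velocity \<A> \<gamma> t f = (\<Sum>b\<in>Basis. velocity \<A> \<gamma> t (\<lambda>q. X q \<bullet> b) * E b (\<gamma> t) f)) \<and>
     (\<forall>q b b'. \<beta> q \<noteq> 0 \<longrightarrow> E b q (\<lambda>q. X q \<bullet> b') = b \<bullet> b') \<and>
     inj_on X {q. \<beta> q \<noteq> 0} \<and> open (X ` {q. \<beta> q \<noteq> 0}) \<and>
     (\<forall>f. f \<in> smooth_funs \<A> \<longrightarrow>
       smooth_on (X ` {q. \<beta> q \<noteq> 0}) (f \<circ> inv_into {q. \<beta> q \<noteq> 0} X))"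

lemma adapted_frameD:
  assumes "adapted_frame X E \<beta>"
  shows "\<beta> \<in> smooth_funs \<A>" "(\<lambda>q. X q \<bullet> b) \<in> smooth_funs \<A>" "E b \<in> vector_fields \<A>"
    "\<lbrakk>smooth_curve \<A> \<gamma>; t \<in> {0..1}; \<beta> (\<gamma> t) \<noteq> 0; f \<in> smooth_funs \<A>\<rbrakk> \<Longrightarrow>
       velocity \<A> \<gamma> t f = (\<Sum>b\<in>Basis. velocity \<A> \<gamma> t (\<lambda>q. X q \<bullet> b) * E b (\<gamma> t) f)"
    "\<beta> q \<noteq> 0 \<Longrightarrow> E b q (\<lambda>q. X q \<bullet> b') = b \<bullet> b'"
    "inj_on X {q. \<beta> q \<noteq> 0}" "open (X ` {q. \<beta> q \<noteq> 0})"
    "f \<in> smooth_funs \<A> \<Longrightarrow> smooth_on (X ` {q. \<beta> q \<noteq> 0}) (f \<circ> inv_into {q. \<beta> q \<noteq> 0} X)"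
  using assms unfolding adapted_frame_def by blast+

text \<open>
  In a chart with a ball of radius \<open>4r\<close> around the image of \<open>p\<close>, a cut-off \<open>\<rho>1\<close> that is \<open>1\<close> up to \<open>2r\<close>
  extends the coordinates and the coordinate fields by zero, and \<open>\<beta>\<close> is a second cut-off \<open>\<rho>0\<close> supported
  where \<open>\<rho>1\<close> is constant, so that multiplication by \<open>\<rho>1\<close> is invisible wherever \<open>\<beta> \<noteq> 0\<close>.
\<close>

lemma adapted_frame_exists: "\<exists>X E \<beta>. adapted_frame X E \<beta> \<and> \<beta> p \<noteq> 0"
proof -
  obtain U \<phi> where U: "(U, \<phi>) \<in> \<A>" "p \<in> U" using chart_around by blast
  note inv = chart_inverse[OF U(1)] and oS = chart_props(2)[OF U(1)]
  note dd = determines_derivatives_chart(2)[OF U(1)]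
  define a where "a = \<phi> p"
  obtain r where r: "r > 0" "cball a (2 * (2 * r)) \<subseteq> \<phi> ` U"
  proof -
    obtain e where "e > 0" "cball a e \<subseteq> \<phi> ` U"
      using oS U(2) unfolding a_def open_contains_cball by blast
    then show thesis using that[of "e / 4"] by simp
  qed
  obtain \<rho>1 :: "'e \<Rightarrow> real" where \<rho>1: "smooth_on UNIV \<rho>1" "\<And>x. x \<in> cball a (2 * r) \<Longrightarrow> \<rho>1 x = 1"
      "\<And>x. x \<notin> ball a (2 * (2 * r)) \<Longrightarrow> \<rho>1 x = 0"
    using smooth_plateau_function[of "2 * r" a] r(1) by (auto simp del: mem_ball mem_cball)
  obtain \<rho>0 :: "'e \<Rightarrow> real" where \<rho>0: "smooth_on UNIV \<rho>0" "\<And>x. x \<in> cball a r \<Longrightarrow> \<rho>0 x = 1"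
      "\<And>x. x \<notin> ball a (2 * r) \<Longrightarrow> \<rho>0 x = 0"
    using smooth_plateau_function[OF r(1), of a] by (auto simp del: mem_ball mem_cball)
  have \<rho>s: "smooth_on (\<phi> ` U) \<rho>1" "smooth_on (\<phi> ` U) \<rho>0"
    using \<rho>1(1) \<rho>0(1) by (auto intro: smooth_on_subset dd)
  have ball1: "ball a (2 * (2 * r)) \<subseteq> cball a (2 * (2 * r))"
    and ball0: "ball a (2 * r) \<subseteq> cball a (2 * (2 * r))" using r(1) by auto
  have \<rho>z: "\<rho>1 y = 0" "\<rho>0 y = 0" if "y \<notin> cball a (2 * (2 * r))" for y
    using that \<rho>1(3)[of y] \<rho>0(3)[of y] ball0 ball1 by blast+
  define X where "X q = (if q \<in> U then \<rho>1 (\<phi> q) *\<^sub>R \<phi> q else 0)" for q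
  define E where "E b q f = (if f \<in> smooth_funs \<A> \<and> q \<in> U
      then \<rho>1 (\<phi> q) * frechet_derivative (f \<circ> inv_into U \<phi>) (at (\<phi> q) within \<phi> ` U) b else 0)"
    for b q f
  define \<beta> where "\<beta> q = (if q \<in> U then \<rho>0 (\<phi> q) else 0)" for q
  define N where "N = {q. \<beta> q \<noteq> 0}"
  have \<beta>: "\<beta> \<in> smooth_funs \<A>"
    unfolding \<beta>_def[abs_def]
    by (rule smooth_funs_extend_by_zero[OF U(1) \<rho>s(2) compact_cball r(2)]) (use \<rho>z in auto)
  have X: "(\<lambda>q. X q \<bullet> b) \<in> smooth_funs \<A>" for b
  proof -
    have "(\<lambda>q. if q \<in> U then \<rho>1 (\<phi> q) * (\<phi> q \<bullet> b) else 0) \<in> smooth_funs \<A>"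
      by (rule smooth_funs_extend_by_zero[OF U(1) _ compact_cball r(2)])
         (use \<rho>z in \<open>auto intro!: smooth_on_mult \<rho>s dd smooth_on_id
             smooth_on_linear_comp[OF _ bounded_linear_inner_left]\<close>)
    also have "(\<lambda>q. if q \<in> U then \<rho>1 (\<phi> q) * (\<phi> q \<bullet> b) else 0) = (\<lambda>q. X q \<bullet> b)"
      by (auto simp: X_def)
    finally show ?thesis .
  qed
  have D: "(f \<circ> inv_into U \<phi> has_derivative frechet_derivative (f \<circ> inv_into U \<phi>) (at y))
      (at y)" if "f \<in> smooth_funs \<A>" "y \<in> \<phi> ` U" for f y
    using smooth_on_has_derivative[OF smooth_funsD[OF that(1) U(1)] that(2)]
    unfolding at_within_open[OF that(2) oS] .
  have Eb: "E b q f = \<rho>1 (\<phi> q) * frechet_derivative (f \<circ> inv_into U \<phi>) (at (\<phi> q)) b"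
    if "f \<in> smooth_funs \<A>" "q \<in> U" for b q f
    using that at_within_open[OF imageI[OF that(2)] oS] by (simp add: E_def)
  have E: "E b \<in> vector_fields \<A>" for b
    unfolding vector_fields_def
  proof (intro CollectI conjI allI ballI)
    fix q show "E b q \<in> tangent_space \<A> q"
    proof (cases "q \<in> U")
      case False
      then show ?thesis by (intro tangent_spaceI) (auto simp: E_def)
    next
      case q: True
      then have y: "\<phi> q \<in> \<phi> ` U" by auto
      show ?thesis
      proof (rule tangent_spaceI)
        fix f h assume fh: "f \<in> smooth_funs \<A>" "h \<in> smooth_funs \<A>"
        note Df = D[OF fh(1) y] and Dh = D[OF fh(2) y]
        have "((\<lambda>q. f q + h q) \<circ> inv_into U \<phi> has_derivative
            (\<lambda>v. frechet_derivative (f \<circ> inv_into U \<phi>) (at (\<phi> q)) v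
               + frechet_derivative (h \<circ> inv_into U \<phi>) (at (\<phi> q)) v)) (at (\<phi> q))"
          using has_derivative_add[OF Df Dh] by (simp add: o_def)
        then have "frechet_derivative ((\<lambda>q. f q + h q) \<circ> inv_into U \<phi>) (at (\<phi> q)) =
            (\<lambda>v. frechet_derivative (f \<circ> inv_into U \<phi>) (at (\<phi> q)) v
               + frechet_derivative (h \<circ> inv_into U \<phi>) (at (\<phi> q)) v)"
          by (rule frechet_derivative_at[symmetric])
        then show "E b q (\<lambda>q. f q + h q) = E b q f + E b q h"
          by (simp add: Eb[OF smooth_funs_add[OF fh] q] Eb[OF fh(1) q] Eb[OF fh(2) q] distrib_left)
        have "((\<lambda>q. f q * h q) \<circ> inv_into U \<phi> has_derivative
            (\<lambda>v. f q * frechet_derivative (h \<circ> inv_into U \<phi>) (at (\<phi> q)) v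
               + frechet_derivative (f \<circ> inv_into U \<phi>) (at (\<phi> q)) v * h q)) (at (\<phi> q))"
          using has_derivative_mult[OF Df Dh] inv(1)[OF q] by (simp add: o_def)
        then have "frechet_derivative ((\<lambda>q. f q * h q) \<circ> inv_into U \<phi>) (at (\<phi> q)) =
            (\<lambda>v. f q * frechet_derivative (h \<circ> inv_into U \<phi>) (at (\<phi> q)) v
               + frechet_derivative (f \<circ> inv_into U \<phi>) (at (\<phi> q)) v * h q)"
          by (rule frechet_derivative_at[symmetric])
        then show "E b q (\<lambda>q. f q * h q) = f q * E b q h + h q * E b q f"
          by (simp add: Eb[OF smooth_funs_mult[OF fh] q] Eb[OF fh(1) q] Eb[OF fh(2) q] algebra_simps)
      next
        fix f c assume f: "f \<in> smooth_funs \<A>"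
        have "((\<lambda>q. c * f q) \<circ> inv_into U \<phi> has_derivative
            (\<lambda>v. c * frechet_derivative (f \<circ> inv_into U \<phi>) (at (\<phi> q)) v)) (at (\<phi> q))"
          using has_derivative_mult_right[OF D[OF f y], of c] by (simp add: o_def)
        then have "frechet_derivative ((\<lambda>q. c * f q) \<circ> inv_into U \<phi>) (at (\<phi> q)) =
            (\<lambda>v. c * frechet_derivative (f \<circ> inv_into U \<phi>) (at (\<phi> q)) v)"
          by (rule frechet_derivative_at[symmetric])
        then show "E b q (\<lambda>q. c * f q) = c * E b q f"
          by (simp add: Eb[OF smooth_funs_cmult[OF f] q] Eb[OF f q])
      qed (simp add: E_def)
    qed
  next
    fix f assume f: "f \<in> smooth_funs \<A>"
    have "(\<lambda>q. if q \<in> U then \<rho>1 (\<phi> q) *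
        frechet_derivative (f \<circ> inv_into U \<phi>) (at (\<phi> q) within \<phi> ` U) b else 0) \<in> smooth_funs \<A>"
      by (rule smooth_funs_extend_by_zero[OF U(1) _ compact_cball r(2)])
         (intro smooth_on_mult \<rho>s dd smooth_on_frechet_derivative smooth_funsD[OF f U(1)],
           use \<rho>z in auto)
    moreover have "(\<lambda>q. E b q f) = (\<lambda>q. if q \<in> U then \<rho>1 (\<phi> q) *
        frechet_derivative (f \<circ> inv_into U \<phi>) (at (\<phi> q) within \<phi> ` U) b else 0)"
      using f by (auto simp: E_def)
    ultimately show "(\<lambda>q. E b q f) \<in> smooth_funs \<A>" by simp
  qed
  have Nb: "q \<in> U" "\<phi> q \<in> ball a (2 * r)" "\<rho>1 (\<phi> q) = 1" if "\<beta> q \<noteq> 0" for q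
  proof -
    show q: "q \<in> U" using that by (auto simp: \<beta>_def split: if_splits)
    show b: "\<phi> q \<in> ball a (2 * r)" using that q \<rho>0(3) by (auto simp: \<beta>_def)
    show "\<rho>1 (\<phi> q) = 1" by (rule \<rho>1(2)) (use b in auto)
  qed
  \<comment> \<open>On the plateau the cut-off coordinates are the chart itself.\<close>
  have dX: "frechet_derivative ((\<lambda>q. X q \<bullet> b) \<circ> inv_into U \<phi>) (at (\<phi> q)) v = v \<bullet> b"
    if "\<beta> q \<noteq> 0" for q b v
  proof -
    have "((\<lambda>y. y \<bullet> b) has_derivative (\<lambda>v. v \<bullet> b)) (at (\<phi> q))"
      by (auto intro!: derivative_eq_intros)
    then have "((\<lambda>q. X q \<bullet> b) \<circ> inv_into U \<phi> has_derivative (\<lambda>v. v \<bullet> b)) (at (\<phi> q))"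
    proof (rule has_derivative_transform_within_open[OF _ open_ball Nb(2)[OF that]])
      fix y assume y: "y \<in> ball a (2 * r)"
      then have "y \<in> \<phi> ` U" using ball0 r(2) by blast
      then show "y \<bullet> b = ((\<lambda>q. X q \<bullet> b) \<circ> inv_into U \<phi>) y"
        using \<rho>1(2)[of y] y inv(2,3)[of y] by (simp add: X_def)
    qed
    then have "frechet_derivative ((\<lambda>q. X q \<bullet> b) \<circ> inv_into U \<phi>) (at (\<phi> q)) = (\<lambda>v. v \<bullet> b)"
      by (rule frechet_derivative_at[symmetric])
    then show ?thesis by simp
  qed
  have XN: "X q = \<phi> q" if "q \<in> N" for q
    using Nb[of q] that by (simp add: X_def N_def)
  have XNim: "X ` N = {y. \<rho>0 y \<noteq> 0}"
  proof (intro set_eqI iffI)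
    fix y assume "y \<in> X ` N"
    then obtain q where q: "q \<in> N" "y = \<phi> q" using XN by auto
    then show "y \<in> {y. \<rho>0 y \<noteq> 0}" by (auto simp: N_def \<beta>_def split: if_splits)
  next
    fix y assume y: "y \<in> {y. \<rho>0 y \<noteq> 0}"
    then have "y \<in> ball a (2 * r)" using \<rho>0(3) by auto
    then have yU: "y \<in> \<phi> ` U" using ball0 r(2) by blast
    then have "inv_into U \<phi> y \<in> N" using y inv by (auto simp: N_def \<beta>_def)
    then show "y \<in> X ` N" using XN inv(2)[OF yU] by (metis image_eqI)
  qed
  have injX: "inj_on X N"
    using chart_inj[OF U(1)] XN Nb(1) by (auto simp: inj_on_def N_def)
  have invX: "inv_into N X y = inv_into U \<phi> y" if y: "y \<in> X ` N" for y
  proof -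
    obtain q where q: "q \<in> N" "y = X q" using y by auto
    then have "inv_into N X y = q" using injX by simp
    moreover have "inv_into U \<phi> y = q" using q XN inv(1) Nb(1) by (auto simp: N_def)
    ultimately show ?thesis by simp
  qed
  have XNsub: "X ` N \<subseteq> \<phi> ` U" using XN Nb(1) by (auto simp: N_def)
  have oXN: "open (X ` N)"
  proof -
    have "continuous_on UNIV \<rho>0" by (rule smooth_on_imp_continuous_on[OF \<rho>0(1)])
    then show ?thesis unfolding XNim by (intro open_Collect_neq continuous_on_const)
  qed
  have "\<beta> p \<noteq> 0" using U(2) \<rho>0(2)[of a] r(1) by (simp add: \<beta>_def a_def)
  moreover have "adapted_frame X E \<beta>"
    unfolding adapted_frame_def
  proof (intro conjI allI impI \<beta> X E)
    fix \<gamma> :: "real \<Rightarrow> 'p" and t :: real and f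
    assume *: "smooth_curve \<A> \<gamma>" "t \<in> {0..1}" "\<beta> (\<gamma> t) \<noteq> 0" "f \<in> smooth_funs \<A>"
    have q: "\<gamma> t \<in> U" using Nb(1)[OF *(3)] .
    then have y: "\<phi> (\<gamma> t) \<in> \<phi> ` U" by auto
    obtain d where d: "\<And>f. f \<in> smooth_funs \<A> \<Longrightarrow>
        velocity \<A> \<gamma> t f = frechet_derivative (f \<circ> inv_into U \<phi>) (at (\<phi> (\<gamma> t))) d"
      using velocity_in_chart[OF U(1) q *(1,2), unfolded at_within_open[OF y oS]] by blast
    interpret bounded_linear "frechet_derivative (f \<circ> inv_into U \<phi>) (at (\<phi> (\<gamma> t)))"
      using D[OF *(4) y] by (rule has_derivative_bounded_linear)
    have "velocity \<A> \<gamma> t f = frechet_derivative (f \<circ> inv_into U \<phi>) (at (\<phi> (\<gamma> t))) (\<Sum>b\<in>Basis. (d \<bullet> b) *\<^sub>R b)"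
      by (simp add: d[OF *(4)] euclidean_representation)
    also have "\<dots> = (\<Sum>b\<in>Basis. (d \<bullet> b) * frechet_derivative (f \<circ> inv_into U \<phi>) (at (\<phi> (\<gamma> t))) b)"
      by (simp add: sum scaleR)
    also have "\<dots> = (\<Sum>b\<in>Basis. velocity \<A> \<gamma> t (\<lambda>q. X q \<bullet> b) * E b (\<gamma> t) f)"
      by (simp add: d[OF X] dX[OF *(3)] Eb[OF *(4) q] Nb(3)[OF *(3)])
    finally show "velocity \<A> \<gamma> t f = (\<Sum>b\<in>Basis. velocity \<A> \<gamma> t (\<lambda>q. X q \<bullet> b) * E b (\<gamma> t) f)" .
  next
    fix q b b' assume q: "\<beta> q \<noteq> 0"
    show "E b q (\<lambda>q. X q \<bullet> b') = b \<bullet> b'"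
      by (simp add: Eb[OF X Nb(1)[OF q]] Nb(3)[OF q] dX[OF q])
  next
    show "inj_on X {q. \<beta> q \<noteq> 0}" "open (X ` {q. \<beta> q \<noteq> 0})" using injX oXN by (simp_all add: N_def)
  next
    fix f assume f: "f \<in> smooth_funs \<A>"
    have "smooth_on (X ` N) (f \<circ> inv_into U \<phi>)"
      by (rule smooth_on_subset[OF smooth_funsD[OF f U(1)] XNsub determines_derivatives_open[OF oXN]])
    then have "smooth_on (X ` N) (f \<circ> inv_into N X)"
      by (rule smooth_on_cong) (simp add: invX)
    then show "smooth_on (X ` {q. \<beta> q \<noteq> 0}) (f \<circ> inv_into {q. \<beta> q \<noteq> 0} X)" by (simp add: N_def)
  qed
  ultimately show ?thesis by blast
qed

section \<open>Push-forward of vector fields and connections\<close>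

lemma tangent_space_zero: "0 \<in> tangent_space \<A> p"
  by (rule tangent_spaceI) simp_all

lemma tangent_space_add:
  "\<lbrakk>u \<in> tangent_space \<A> p; v \<in> tangent_space \<A> p\<rbrakk> \<Longrightarrow> u + v \<in> tangent_space \<A> p"
  by (rule tangent_spaceI) (simp_all add: tangent_spaceD[of _ p] algebra_simps)

lemma tangent_space_scale: "u \<in> tangent_space \<A> p \<Longrightarrow> c *\<^sub>T u \<in> tangent_space \<A> p"
  by (rule tangent_spaceI) (simp_all add: tangent_spaceD[of _ p] tscale_def algebra_simps)

lemma tangent_diff_eq: "u - v = u + (- 1) *\<^sub>T v" for u v :: "'p tvec"
  by (rule ext) (simp add: tscale_def)

lemma tangent_minus_eq: "- v = (- 1) *\<^sub>T v" for v :: "'p tvec"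
  by (rule ext) (simp add: tscale_def)

lemma tangent_space_diff:
  "\<lbrakk>u \<in> tangent_space \<A> p; v \<in> tangent_space \<A> p\<rbrakk> \<Longrightarrow> u - v \<in> tangent_space \<A> p"
  unfolding tangent_diff_eq by (intro tangent_space_add tangent_space_scale)

lemma tangent_vector_zero_fun:
  assumes "v \<in> tangent_space \<A> p"
  shows "v (\<lambda>q. 0) = 0"
  using tangent_spaceD(2)[OF assms smooth_funs_const, of 0 0] by simp

lemma vector_fieldsD:
  assumes "X \<in> vector_fields \<A>"
  shows "X p \<in> tangent_space \<A> p" "f \<in> smooth_funs \<A> \<Longrightarrow> (\<lambda>p. X p f) \<in> smooth_funs \<A>"
  using assms by (auto simp: vector_fields_def)

lemma vector_fields_diff:
  assumes "X \<in> vector_fields \<A>" "Y \<in> vector_fields \<A>"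
  shows "X - Y \<in> vector_fields \<A>"
  using assms by (auto simp: vector_fields_def intro!: tangent_space_diff smooth_funs_diff)

lemma diffeomorphismD:
  assumes "diffeomorphism \<A> s"
  shows "bij s" "smooth_map \<A> s" "smooth_map \<A> (inv s)" "inv s (s p) = p" "s (inv s p) = p"
    "inv (inv s) = s" "diffeomorphism \<A> (inv s)"
  using assms
  by (auto simp: diffeomorphism_def bij_imp_bij_inv inv_inv_eq bij_is_inj bij_is_surj surj_f_inv_f)

lemma differential_apply: "f \<in> smooth_funs \<A> \<Longrightarrow> differential \<A> s v f = v (f \<circ> s)"
  by (simp add: differential_def)

lemma differential_tangent:
  assumes s: "smooth_map \<A> s" and v: "v \<in> tangent_space \<A> p"
  shows "differential \<A> s v \<in> tangent_space \<A> (s p)"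
proof (rule tangent_spaceI)
  fix f h assume fh: "f \<in> smooth_funs \<A>" "h \<in> smooth_funs \<A>"
  note fs = smooth_funs_compose_smooth_map[OF fh(1) s] smooth_funs_compose_smooth_map[OF fh(2) s]
  have "(\<lambda>q. f q + h q) \<circ> s = (\<lambda>q. (f \<circ> s) q + (h \<circ> s) q)"
    "(\<lambda>q. f q * h q) \<circ> s = (\<lambda>q. (f \<circ> s) q * (h \<circ> s) q)" by auto
  then show "differential \<A> s v (\<lambda>q. f q + h q) = differential \<A> s v f + differential \<A> s v h"
    "differential \<A> s v (\<lambda>q. f q * h q) = f (s p) * differential \<A> s v h + h (s p) * differential \<A> s v f"
    using tangent_spaceD(1,3)[OF v fs] fh
    by (simp_all only: differential_apply smooth_funs_add smooth_funs_mult o_apply)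
next
  fix f c assume f: "f \<in> smooth_funs \<A>"
  have "(\<lambda>q. c * f q) \<circ> s = (\<lambda>q. c * (f \<circ> s) q)" by auto
  then show "differential \<A> s v (\<lambda>q. c * f q) = c * differential \<A> s v f"
    using tangent_spaceD(2)[OF v smooth_funs_compose_smooth_map[OF f s]] f
    by (simp only: differential_apply smooth_funs_cmult)
qed (simp add: differential_def)

lemma differential_linear:
  "differential \<A> s (u + v) = differential \<A> s u + differential \<A> s v"
  "differential \<A> s (u - v) = differential \<A> s u - differential \<A> s v"
  "differential \<A> s (- v) = - differential \<A> s v"
  "differential \<A> s 0 = 0"
  "differential \<A> s (c *\<^sub>T v) = c *\<^sub>T differential \<A> s v"
  by (auto simp: differential_def tscale_def fun_eq_iff)

lemma differential_inverse:
  assumes s: "diffeomorphism \<A> s" and v: "v \<in> tangent_space \<A> p"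
  shows "differential \<A> s (differential \<A> (inv s) v) = v"
    and "differential \<A> (inv s) (differential \<A> s v) = v"
proof -
  note d = diffeomorphismD[OF s]
  have c: "f \<circ> s \<circ> inv s = f" "f \<circ> inv s \<circ> s = f" for f :: "'p \<Rightarrow> real"
    using d(4,5) by (auto simp: fun_eq_iff)
  show "differential \<A> s (differential \<A> (inv s) v) = v"
    "differential \<A> (inv s) (differential \<A> s v) = v"
    using tangent_spaceD(4)[OF v] smooth_funs_compose_smooth_map[OF _ d(2)]
      smooth_funs_compose_smooth_map[OF _ d(3)]
    by (auto simp: differential_def c fun_eq_iff)
qed

lemma push_field_at:
  "diffeomorphism \<A> s \<Longrightarrow> push_field \<A> s X (s p) = differential \<A> s (X p)"
  by (simp add: push_field_def diffeomorphismD)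

lemma push_field_vector_field:
  assumes s: "diffeomorphism \<A> s" and X: "X \<in> vector_fields \<A>"
  shows "push_field \<A> s X \<in> vector_fields \<A>"
  unfolding vector_fields_def
proof (intro CollectI conjI allI ballI)
  note d = diffeomorphismD[OF s]
  fix p
  show "push_field \<A> s X p \<in> tangent_space \<A> p"
    using differential_tangent[OF d(2) vector_fieldsD(1)[OF X, of "inv s p"]] d(5)
    by (simp add: push_field_def)
next
  note d = diffeomorphismD[OF s]
  fix f assume f: "f \<in> smooth_funs \<A>"
  have "(\<lambda>p. push_field \<A> s X p f) = (\<lambda>p. X p (f \<circ> s)) \<circ> inv s"
    using f by (auto simp: push_field_def differential_def)
  also have "\<dots> \<in> smooth_funs \<A>"
    by (intro smooth_funs_compose_smooth_map d vector_fieldsD(2)[OF X] f)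
  finally show "(\<lambda>p. push_field \<A> s X p f) \<in> smooth_funs \<A>" .
qed

lemma push_field_inverse:
  assumes s: "diffeomorphism \<A> s" and X: "X \<in> vector_fields \<A>"
  shows "push_field \<A> s (push_field \<A> (inv s) X) = X"
  using differential_inverse(1)[OF s vector_fieldsD(1)[OF X]] diffeomorphismD[OF s]
  by (simp add: push_field_def fun_eq_iff)

lemma push_field_inv_apply:
  assumes s: "diffeomorphism \<A> s" and f: "f \<in> smooth_funs \<A>"
  shows "push_field \<A> (inv s) X q (f \<circ> s) = X (s q) f"
proof -
  note d = diffeomorphismD[OF s]
  have "f \<circ> s \<circ> inv s = f" using d(5) by (auto simp: fun_eq_iff)
  then show ?thesis
    using d(6) smooth_funs_compose_smooth_map[OF f d(2)] by (simp add: push_field_def differential_def)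
qed

lemma affine_connection_vector_field:
  "\<lbrakk>affine_connection \<A> D; X \<in> vector_fields \<A>; Y \<in> vector_fields \<A>\<rbrakk> \<Longrightarrow> D X Y \<in> vector_fields \<A>"
  by (simp add: affine_connection_def)

lemma push_connection_vector_field:
  assumes "diffeomorphism \<A> s" "affine_connection \<A> D" "X \<in> vector_fields \<A>" "Y \<in> vector_fields \<A>"
  shows "push_connection \<A> s D X Y \<in> vector_fields \<A>"
  unfolding push_connection_def
  by (intro push_field_vector_field affine_connection_vector_field[OF assms(2)] assms
      diffeomorphismD(7)[OF assms(1)])

lemma metricD:
  assumes "riemannian_metric \<A> g" "u \<in> tangent_space \<A> p" "v \<in> tangent_space \<A> p" "w \<in> tangent_space \<A> p"
  shows "g p u v = g p v u" "g p (u + v) w = g p u w + g p v w"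
    "g p (c *\<^sub>T u) v = c * g p u v" "u \<noteq> 0 \<Longrightarrow> g p u u > 0"
  using assms unfolding riemannian_metric_def by blast+

lemma metric_smooth:
  "\<lbrakk>riemannian_metric \<A> g; X \<in> vector_fields \<A>; Y \<in> vector_fields \<A>\<rbrakk>
    \<Longrightarrow> (\<lambda>p. g p (X p) (Y p)) \<in> smooth_funs \<A>"
  unfolding riemannian_metric_def by blast

lemma metric_diff:
  assumes g: "riemannian_metric \<A> g"
    and uvw: "u \<in> tangent_space \<A> p" "v \<in> tangent_space \<A> p" "w \<in> tangent_space \<A> p"
  shows "g p (u - v) w = g p u w - g p v w"
  using metricD(2)[OF g uvw(1) tangent_space_scale[OF uvw(2)] uvw(3)] metricD(3)[OF g uvw(2,3,3)]
  by (simp add: tangent_diff_eq)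

text \<open>
  Positivity of \<open>g\<close> at the vector \<open>u - v\<close>. The test vector is the difference itself so that, when
  \<open>u\<close> and \<open>v\<close> are values of global fields, it is the value of a global field too.
\<close>

lemma metric_eqI:
  assumes g: "riemannian_metric \<A> g" and uv: "u \<in> tangent_space \<A> p" "v \<in> tangent_space \<A> p"
    and eq: "g p u (u - v) = g p v (u - v)"
  shows "u = v"
proof (rule ccontr)
  assume "u \<noteq> v"
  then have "u - v \<noteq> 0" by simp
  moreover have d: "u - v \<in> tangent_space \<A> p" using uv by (rule tangent_space_diff)
  ultimately have "g p (u - v) (u - v) > 0" using metricD(4)[OF g d d d] by simp
  then show False using metric_diff[OF g uv d] eq by simp
qed

lemma dual_connectionD:
  assumes "dual_connection \<A> g D D'" "X \<in> vector_fields \<A>" "Y \<in> vector_fields \<A>" "Z \<in> vector_fields \<A>"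
  shows "X p (\<lambda>q. g q (Y q) (Z q)) = g p (D X Y p) (Z p) + g p (Y p) (D' X Z p)"
  using assms by (simp add: dual_connection_def)

text \<open>
  Duality is a statement about \<open>g\<close> and the pair of connections alone, so an isometry carries a dual
  pair to a dual pair. The Levi-Civita connection is dual to itself, so this also covers the
  compatibility of its push-forward with the metric.
\<close>

lemma dual_connection_push:
  assumes g: "riemannian_metric \<A> g" and s: "isometry \<A> g s"
    and aff: "affine_connection \<A> D" and dual: "dual_connection \<A> g D D'"
    and X: "X \<in> vector_fields \<A>" and Y: "Y \<in> vector_fields \<A>" and Z: "Z \<in> vector_fields \<A>"
  shows "X p (\<lambda>q. g q (Y q) (Z q)) =
    g p (push_connection \<A> s D X Y p) (Z p) + g p (Y p) (push_connection \<A> s D' X Z p)"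
proof -
  have diff: "diffeomorphism \<A> s" using s by (simp add: isometry_def)
  note d = diffeomorphismD[OF diff]
  have aff': "affine_connection \<A> D'" using dual by (simp add: dual_connection_def)
  have iso: "g (s q) (differential \<A> s v) (differential \<A> s w) = g q v w"
    if "v \<in> tangent_space \<A> q" "w \<in> tangent_space \<A> q" for q v w
    using s that by (simp add: isometry_def)
  define X0 Y0 Z0 r where "X0 = push_field \<A> (inv s) X" and "Y0 = push_field \<A> (inv s) Y"
    and "Z0 = push_field \<A> (inv s) Z" and "r = inv s p"
  have v0: "X0 \<in> vector_fields \<A>" "Y0 \<in> vector_fields \<A>" "Z0 \<in> vector_fields \<A>"
    unfolding X0_def Y0_def Z0_def using X Y Z d(7) by (auto intro: push_field_vector_field)
  have sr: "s r = p" using d(5) by (simp add: r_def)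
  have lift: "differential \<A> s (Y0 q) = Y (s q)" "differential \<A> s (Z0 q) = Z (s q)" for q
    using push_field_inverse[OF diff Y] push_field_inverse[OF diff Z] push_field_at[OF diff]
    by (metis Y0_def, metis Z0_def)
  let ?F = "\<lambda>q. g q (Y q) (Z q)"
  have F: "?F \<circ> s = (\<lambda>q. g q (Y0 q) (Z0 q))"
  proof
    fix q
    have "g q (Y0 q) (Z0 q) = g (s q) (differential \<A> s (Y0 q)) (differential \<A> s (Z0 q))"
      by (rule iso[symmetric]) (use v0 vector_fieldsD(1) in auto)
    then show "(?F \<circ> s) q = g q (Y0 q) (Z0 q)" by (simp add: lift)
  qed
  have "X p ?F = X0 r (?F \<circ> s)"
    unfolding X0_def push_field_inv_apply[OF diff metric_smooth[OF g Y Z]] sr ..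
  also have "\<dots> = g r (D X0 Y0 r) (Z0 r) + g r (Y0 r) (D' X0 Z0 r)"
    unfolding F by (rule dual_connectionD[OF dual v0])
  also have "g r (D X0 Y0 r) (Z0 r) = g (s r) (differential \<A> s (D X0 Y0 r)) (differential \<A> s (Z0 r))"
    by (rule iso[symmetric]) (intro vector_fieldsD(1) affine_connection_vector_field[OF aff] v0)+
  also have "g r (Y0 r) (D' X0 Z0 r) = g (s r) (differential \<A> s (Y0 r)) (differential \<A> s (D' X0 Z0 r))"
    by (rule iso[symmetric]) (intro vector_fieldsD(1) affine_connection_vector_field[OF aff'] v0)+
  finally have "X p ?F = g (s r) (differential \<A> s (D X0 Y0 r)) (differential \<A> s (Z0 r)) +
      g (s r) (differential \<A> s (Y0 r)) (differential \<A> s (D' X0 Z0 r))" .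
  moreover have "push_connection \<A> s D X Y p = differential \<A> s (D X0 Y0 r)"
    "push_connection \<A> s D' X Z p = differential \<A> s (D' X0 Z0 r)"
    by (simp_all only: push_connection_def push_field_def[of _ s] X0_def Y0_def Z0_def r_def)
  ultimately show ?thesis by (simp only: lift sr)
qed

text \<open>
  \<open>s\<^sub>*D'\<close> is dual to \<open>s\<^sub>*D\<close>, which is \<open>D'\<close> on \<open>U\<close>; as a connection is determined by its dual and the
  dual of \<open>D'\<close> is \<open>D\<close>, \<open>s\<^sub>*D'\<close> is \<open>D\<close> there.
\<close>

lemma dual_connection_push_swap:
  assumes g: "riemannian_metric \<A> g" and s: "isometry \<A> g s"
    and aff: "affine_connection \<A> D" and dual: "dual_connection \<A> g D D'"
    and agree: "connections_agree_on \<A> U (push_connection \<A> s D) D'"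
  shows "connections_agree_on \<A> U (push_connection \<A> s D') D"
  unfolding connections_agree_on_def
proof (intro ballI)
  fix X Y p assume X: "X \<in> vector_fields \<A>" and Y: "Y \<in> vector_fields \<A>" and p: "p \<in> U"
  have diff: "diffeomorphism \<A> s" using s by (simp add: isometry_def)
  have aff': "affine_connection \<A> D'" using dual by (simp add: dual_connection_def)
  define W where "W = push_connection \<A> s D' X Y - D X Y"
  have vf: "push_connection \<A> s D' X Y \<in> vector_fields \<A>" "D X Y \<in> vector_fields \<A>"
    using push_connection_vector_field[OF diff aff' X Y] affine_connection_vector_field[OF aff X Y] .
  then have W: "W \<in> vector_fields \<A>" unfolding W_def by (rule vector_fields_diff)
  note tan = vector_fieldsD(1)[of _ p]
  have sym: "g q (W q) (Y q) = g q (Y q) (W q)" for q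
    using metricD(1)[OF g] vector_fieldsD(1) W Y by metis
  have "g p (D' X W p) (Y p) + g p (W p) (push_connection \<A> s D' X Y p) =
      g p (push_connection \<A> s D X W p) (Y p) + g p (W p) (push_connection \<A> s D' X Y p)"
    using agree X W p by (simp add: connections_agree_on_def)
  also have "\<dots> = X p (\<lambda>q. g q (W q) (Y q))"
    by (rule dual_connection_push[OF g s aff dual X W Y, symmetric])
  also have "\<dots> = g p (D X Y p) (W p) + g p (Y p) (D' X W p)"
    unfolding sym by (rule dual_connectionD[OF dual X Y W])
  finally have "g p (push_connection \<A> s D' X Y p) (W p) = g p (D X Y p) (W p)"
    using metricD(1)[OF g tan[OF W] tan[OF vf(1)]] metricD(1)[OF g tan[OF Y]] tan[OF W]
      tan[OF affine_connection_vector_field[OF aff' X W]] by simp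
  then show "push_connection \<A> s D' X Y p = D X Y p"
    by (intro metric_eqI[OF g tan[OF vf(1)] tan[OF vf(2)]]) (simp add: W_def)
qed

lemma push_field_lie_bracket:
  assumes s: "diffeomorphism \<A> s" and X: "X \<in> vector_fields \<A>" and Y: "Y \<in> vector_fields \<A>"
  shows "push_field \<A> s (lie_bracket (push_field \<A> (inv s) X) (push_field \<A> (inv s) Y)) =
    lie_bracket X Y"
proof (intro ext)
  fix p f
  note d = diffeomorphismD[OF s]
  show "push_field \<A> s (lie_bracket (push_field \<A> (inv s) X) (push_field \<A> (inv s) Y)) p f =
    lie_bracket X Y p f"
  proof (cases "f \<in> smooth_funs \<A>")
    case True
    let ?X = "push_field \<A> (inv s) X" and ?Y = "push_field \<A> (inv s) Y"
    have lift: "(\<lambda>q. push_field \<A> (inv s) Z q (f \<circ> s)) = (\<lambda>q. Z q f) \<circ> s" for Z :: "'p vfield"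
      using push_field_inv_apply[OF s True] by (simp add: fun_eq_iff)
    have "push_field \<A> s (lie_bracket ?X ?Y) p f = lie_bracket ?X ?Y (inv s p) (f \<circ> s)"
      using True by (simp only: push_field_def[of \<A> s] differential_apply)
    also have "\<dots> = ?X (inv s p) ((\<lambda>q. Y q f) \<circ> s) - ?Y (inv s p) ((\<lambda>q. X q f) \<circ> s)"
      by (simp only: lie_bracket_def lift)
    also have "\<dots> = lie_bracket X Y p f"
      by (simp only: lie_bracket_def push_field_inv_apply[OF s vector_fieldsD(2)[OF X True]]
          push_field_inv_apply[OF s vector_fieldsD(2)[OF Y True]] d(5))
    finally show ?thesis .
  next
    case False
    then have "X q f = 0" "Y q f = 0" for q
      using tangent_spaceD(4)[OF vector_fieldsD(1)] X Y by blast+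
    then show ?thesis
      using False tangent_vector_zero_fun[OF vector_fieldsD(1)[OF X]]
        tangent_vector_zero_fun[OF vector_fieldsD(1)[OF Y]]
      by (simp add: push_field_def[of \<A> s] differential_def lie_bracket_def)
  qed
qed

text \<open>
  Uniqueness of the Levi-Civita connection, applied to its push-forward: the difference
  \<open>B(X, Y)\<close> of two such connections is symmetric because neither has torsion, and \<open>g(B(X, Y), Z)\<close> is
  skew in \<open>Y\<close> and \<open>Z\<close> because both are metric; a trilinear form with both symmetries vanishes.
\<close>

lemma levi_civita_push:
  assumes g: "riemannian_metric \<A> g" and s: "isometry \<A> g s" and lc: "levi_civita \<A> g D"
  shows "connections_agree_on \<A> UNIV (push_connection \<A> s D) D"
  unfolding connections_agree_on_def
proof (intro ballI)
  fix X Y p assume X: "X \<in> vector_fields \<A>" and Y: "Y \<in> vector_fields \<A>"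
  have diff: "diffeomorphism \<A> s" using s by (simp add: isometry_def)
  note d = diffeomorphismD[OF diff]
  have aff: "affine_connection \<A> D" and dual: "dual_connection \<A> g D D"
    using lc by (simp_all add: levi_civita_def dual_connection_def)
  define D2 where "D2 = push_connection \<A> s D"
  define b where "b X Y = D2 X Y - D X Y" for X Y
  note tan = vector_fieldsD(1)[of _ p]
  have vf: "D2 X Y \<in> vector_fields \<A>" "D X Y \<in> vector_fields \<A>" "b X Y \<in> vector_fields \<A>"
    if "X \<in> vector_fields \<A>" "Y \<in> vector_fields \<A>" for X Y
    using push_connection_vector_field[OF diff aff that] affine_connection_vector_field[OF aff that]
    by (auto simp: b_def D2_def intro: vector_fields_diff)
  have sym: "b X Y = b Y X" if XY: "X \<in> vector_fields \<A>" "Y \<in> vector_fields \<A>" for X Y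
  proof -
    have t: "D X Y - D Y X = lie_bracket X Y"
      if "X \<in> vector_fields \<A>" "Y \<in> vector_fields \<A>" for X Y
      using lc that by (simp add: levi_civita_def)
    have "D2 X Y - D2 Y X = lie_bracket X Y"
    proof -
      let ?X = "push_field \<A> (inv s) X" and ?Y = "push_field \<A> (inv s) Y"
      have "D2 X Y - D2 Y X = push_field \<A> s (D ?X ?Y - D ?Y ?X)"
        by (simp add: D2_def push_connection_def push_field_def[of _ s] differential_linear fun_eq_iff)
      also have "\<dots> = push_field \<A> s (lie_bracket ?X ?Y)"
        using t push_field_vector_field[OF d(7)] XY by simp
      finally show ?thesis using push_field_lie_bracket[OF diff XY] by simp
    qed
    then show ?thesis using t[OF XY] by (simp add: b_def algebra_simps)
  qed
  define c where "c X Y Z = g p (b X Y p) (Z p)" for X Y Z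
  have c1: "c X Y Z = c Y X Z" if "X \<in> vector_fields \<A>" "Y \<in> vector_fields \<A>" for X Y Z
    using sym[OF that] by (simp add: c_def)
  have c2: "c X Y Z = - c X Z Y"
    if v: "X \<in> vector_fields \<A>" "Y \<in> vector_fields \<A>" "Z \<in> vector_fields \<A>" for X Y Z
  proof -
    note XY = vf[OF v(1,2)] and XZ = vf[OF v(1,3)]
    have "g p (D2 X Y p) (Z p) + g p (Y p) (D2 X Z p) = g p (D X Y p) (Z p) + g p (Y p) (D X Z p)"
      using dual_connection_push[OF g s aff dual v, of p] dual_connectionD[OF dual v, of p]
      by (simp add: D2_def)
    moreover have "g p (Y p) (D2 X Z p) = g p (D2 X Z p) (Y p)"
      "g p (Y p) (D X Z p) = g p (D X Z p) (Y p)"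
      using metricD(1)[OF g tan[OF v(2)]] tan XZ by blast+
    ultimately show ?thesis
      using metric_diff[OF g tan[OF XY(1)] tan[OF XY(2)] tan[OF v(3)]]
        metric_diff[OF g tan[OF XZ(1)] tan[OF XZ(2)] tan[OF v(2)]]
      by (simp add: c_def b_def)
  qed
  have c0: "c X Y Z = 0"
    if v: "X \<in> vector_fields \<A>" "Y \<in> vector_fields \<A>" "Z \<in> vector_fields \<A>" for X Y Z
    using c1[of X Y Z] c2[of X Y Z] c1[of X Z Y] c2[of Z X Y] c1[of Z Y X] c2[of Y Z X] v by simp
  have "D2 X Y p = D X Y p"
  proof (rule metric_eqI[OF g tan tan])
    show "g p (D2 X Y p) (D2 X Y p - D X Y p) = g p (D X Y p) (D2 X Y p - D X Y p)"
      using c0[OF X Y vf(3)[OF X Y]]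
        metric_diff[OF g tan[OF vf(1)[OF X Y]] tan[OF vf(2)[OF X Y]] tan[OF vf(3)[OF X Y]]]
      by (simp add: c_def b_def)
  qed (use vf[OF X Y] in auto)
  then show "push_connection \<A> s D X Y p = D X Y p" by (simp add: D2_def)
qed

section \<open>Images, reversals and restrictions of geodesics\<close>

lemma fields_alongD:
  assumes "V \<in> fields_along \<A> \<gamma>"
  shows "t \<in> {0..1} \<Longrightarrow> V t \<in> tangent_space \<A> (\<gamma> t)"
    "f \<in> smooth_funs \<A> \<Longrightarrow> smooth_on {0..1} (\<lambda>t. V t f)"
  using assms by (auto simp: fields_along_def)

lemma fields_alongI:
  assumes "\<And>t. t \<in> {0..1} \<Longrightarrow> V t \<in> tangent_space \<A> (\<gamma> t)"
    "\<And>f. f \<in> smooth_funs \<A> \<Longrightarrow> smooth_on {0..1} (\<lambda>t. V t f)"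
  shows "V \<in> fields_along \<A> \<gamma>"
  using assms by (auto simp: fields_along_def)

lemma fields_along_vector_field:
  assumes "Y \<in> vector_fields \<A>" "smooth_curve \<A> \<gamma>"
  shows "Y \<circ> \<gamma> \<in> fields_along \<A> \<gamma>"
proof (rule fields_alongI)
  show "smooth_on {0..1} (\<lambda>t. (Y \<circ> \<gamma>) t f)" if "f \<in> smooth_funs \<A>" for f
    using smooth_fun_along_curve[OF vector_fieldsD(2)[OF assms(1) that] assms(2)] by (simp add: o_def)
qed (simp add: vector_fieldsD(1)[OF assms(1)])

lemma fields_along_add:
  assumes "V \<in> fields_along \<A> \<gamma>" "W \<in> fields_along \<A> \<gamma>"
  shows "V + W \<in> fields_along \<A> \<gamma>"
  using assms
  by (intro fields_alongI)
     (auto simp: fields_alongD intro!: tangent_space_add smooth_on_add determines_derivatives_unit_interval)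

lemma fields_along_scale:
  assumes "V \<in> fields_along \<A> \<gamma>" "smooth_on {0..1} h"
  shows "(\<lambda>t. h t *\<^sub>T V t) \<in> fields_along \<A> \<gamma>"
proof (rule fields_alongI)
  show "smooth_on {0..1} (\<lambda>t. (h t *\<^sub>T V t) f)" if "f \<in> smooth_funs \<A>" for f
    unfolding tscale_def
    by (intro smooth_on_mult determines_derivatives_unit_interval assms fields_alongD(2)[OF assms(1) that])
qed (simp add: tangent_space_scale fields_alongD(1)[OF assms(1)])

lemma fields_along_cong:
  assumes "V \<in> fields_along \<A> \<gamma>" "\<And>t. t \<in> {0..1} \<Longrightarrow> \<gamma>' t = \<gamma> t" "\<And>t. t \<in> {0..1} \<Longrightarrow> W t = V t"
  shows "W \<in> fields_along \<A> \<gamma>'"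
proof (rule fields_alongI)
  show "W t \<in> tangent_space \<A> (\<gamma>' t)" if "t \<in> {0..1}" for t
    using fields_alongD(1)[OF assms(1) that] assms(2,3)[OF that] by simp
  show "smooth_on {0..1} (\<lambda>t. W t f)" if "f \<in> smooth_funs \<A>" for f
    by (rule smooth_on_cong[OF fields_alongD(2)[OF assms(1) that]]) (simp add: assms(3))
qed

lemma velocity_field_along:
  assumes \<gamma>: "smooth_curve \<A> \<gamma>"
  shows "velocity \<A> \<gamma> \<in> fields_along \<A> \<gamma>"
proof (rule fields_alongI)
  fix t :: real assume t: "t \<in> {0..1}"
  note vd = velocity_has_derivative[OF _ \<gamma> t]
  show "velocity \<A> \<gamma> t \<in> tangent_space \<A> (\<gamma> t)"
  proof (rule tangent_spaceI)
    fix f h assume fh: "f \<in> smooth_funs \<A>" "h \<in> smooth_funs \<A>"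
    show "velocity \<A> \<gamma> t (\<lambda>q. f q + h q) = velocity \<A> \<gamma> t f + velocity \<A> \<gamma> t h"
      using has_vector_derivative_add[OF vd[OF fh(1)] vd[OF fh(2)]]
      by (intro velocity_eqI[OF smooth_funs_add[OF fh] t]) (simp add: o_def)
    show "velocity \<A> \<gamma> t (\<lambda>q. f q * h q) = f (\<gamma> t) * velocity \<A> \<gamma> t h + h (\<gamma> t) * velocity \<A> \<gamma> t f"
      using has_vector_derivative_mult[OF vd[OF fh(1)] vd[OF fh(2)]]
      by (intro velocity_eqI[OF smooth_funs_mult[OF fh] t]) (simp add: o_def mult.commute)
  next
    fix f c assume f: "f \<in> smooth_funs \<A>"
    show "velocity \<A> \<gamma> t (\<lambda>q. c * f q) = c * velocity \<A> \<gamma> t f"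
      using has_vector_derivative_mult_right[OF vd[OF f], of c]
      by (intro velocity_eqI[OF smooth_funs_cmult[OF f] t]) (simp add: o_def)
  qed (simp add: velocity_def)
next
  fix f assume f: "f \<in> smooth_funs \<A>"
  have "smooth_on {0..1} (\<lambda>t. frechet_derivative (f \<circ> \<gamma>) (at t within {0..1}) 1)"
    by (rule smooth_on_frechet_derivative[OF smooth_fun_along_curve[OF f \<gamma>]])
  then show "smooth_on {0..1} (\<lambda>t. velocity \<A> \<gamma> t f)"
  proof (rule smooth_on_cong)
    fix t :: real assume t: "t \<in> {0..1}"
    have "((f \<circ> \<gamma>) has_derivative frechet_derivative (f \<circ> \<gamma>) (at t within {0..1})) (at t within {0..1})"
      by (rule smooth_on_has_derivative[OF smooth_fun_along_curve[OF f \<gamma>] t])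
    then have "((f \<circ> \<gamma>) has_vector_derivative frechet_derivative (f \<circ> \<gamma>) (at t within {0..1}) 1)
        (at t within {0..1})"
      by (metis has_derivative_imp_has_field_derivative has_real_derivative_iff_has_vector_derivative
          has_derivative_bounded_linear real_bounded_linear mult.commute mult_1)
    then show "frechet_derivative (f \<circ> \<gamma>) (at t within {0..1}) 1 = velocity \<A> \<gamma> t f"
      using velocity_eqI[OF f t] by metis
  qed
qed

lemma covariant_derivativeD:
  assumes "covariant_derivative_along \<A> D \<gamma> T"
  shows "V \<in> fields_along \<A> \<gamma> \<Longrightarrow> T V \<in> fields_along \<A> \<gamma>"
    "\<lbrakk>V \<in> fields_along \<A> \<gamma>; W \<in> fields_along \<A> \<gamma>; t \<in> {0..1}\<rbrakk> \<Longrightarrow> T (V + W) t = T V t + T W t"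
    "\<lbrakk>V \<in> fields_along \<A> \<gamma>; smooth_on {0..1} h; t \<in> {0..1}\<rbrakk> \<Longrightarrow>
      T (\<lambda>r. h r *\<^sub>T V r) t = vector_derivative h (at t within {0..1}) *\<^sub>T V t + h t *\<^sub>T T V t"
    "\<lbrakk>X \<in> vector_fields \<A>; Y \<in> vector_fields \<A>; t \<in> {0..1}; X (\<gamma> t) = velocity \<A> \<gamma> t\<rbrakk> \<Longrightarrow>
      T (Y \<circ> \<gamma>) t = D X Y (\<gamma> t)"
  using assms by (auto simp: covariant_derivative_along_def)

text \<open>
  A field vanishing on \<open>{0..1}\<close> is its own multiple by a function that is \<open>0\<close> there, so the product
  rule kills its covariant derivative.
\<close>

lemma covariant_derivative_cong:
  assumes T: "covariant_derivative_along \<A> D \<gamma> T" and V: "V \<in> fields_along \<A> \<gamma>"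
    and eq: "\<And>t. t \<in> {0..1} \<Longrightarrow> V t = W t" and t: "t \<in> {0..1}"
  shows "T V t = T W t"
proof -
  have W: "W \<in> fields_along \<A> \<gamma>" by (rule fields_along_cong[OF V]) (simp_all add: eq)
  define Z where "Z r = V r - W r" for r
  define h :: "real \<Rightarrow> real" where "h r = (if r \<in> {0..1} then 0 else 1)" for r
  have dd: "determines_derivatives {0..1::real}" by (rule determines_derivatives_unit_interval)
  have h: "smooth_on {0..1} h"
    by (rule smooth_on_cong[OF smooth_on_const[OF dd, of 0]]) (simp add: h_def)
  have Z: "Z \<in> fields_along \<A> \<gamma>"
  proof (rule fields_alongI)
    show "smooth_on {0..1} (\<lambda>t. Z t f)" for f
      by (rule smooth_on_cong[OF smooth_on_const[OF dd, of 0]]) (simp add: Z_def eq)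
  qed (simp add: Z_def eq tangent_space_zero)
  have "(h has_vector_derivative 0) (at t within {0..1})"
    by (rule has_vector_derivative_transform[OF t, of h "\<lambda>_. 0"]) (auto simp: h_def)
  then have "vector_derivative h (at t within {0..1}) = 0"
    by (rule vector_derivative_within[OF at_within_unit_interval_nontrivial[OF t]])
  moreover have hZ: "(\<lambda>r. h r *\<^sub>T Z r) = Z"
    by (auto simp: h_def Z_def eq tscale_def fun_eq_iff)
  ultimately have "T Z t = 0"
    using covariant_derivativeD(3)[OF T Z h t, unfolded hZ] t
    by (simp add: h_def tscale_def fun_eq_iff)
  moreover have "V = W + Z" by (auto simp: Z_def)
  ultimately show ?thesis using covariant_derivativeD(2)[OF T W Z t] by simp
qed

lemma smooth_curve_cong:
  assumes \<gamma>: "smooth_curve \<A> \<gamma>" and eq: "\<And>t. t \<in> {0..1} \<Longrightarrow> \<gamma>' t = \<gamma> t"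
  shows "smooth_curve \<A> \<gamma>'"
proof -
  have "{0..1} \<inter> \<gamma>' -` U = {0..1} \<inter> \<gamma> -` U" for U using eq by auto
  moreover have "smooth_on ({0..1} \<inter> \<gamma> -` U) (\<phi> \<circ> \<gamma>')" if "(U, \<phi>) \<in> \<A>" for U \<phi>
    by (rule smooth_on_cong[OF smooth_curveD(2)[OF \<gamma> that]]) (simp add: eq)
  moreover have "continuous_on {0..1} \<gamma>'"
    by (rule continuous_on_eq[OF smooth_curveD(1)[OF \<gamma>]]) (simp add: eq)
  ultimately show ?thesis by (auto simp: smooth_curve_def)
qed

lemma velocity_cong:
  assumes eq: "\<And>t. t \<in> {0..1} \<Longrightarrow> \<gamma>' t = \<gamma> t" and \<gamma>: "smooth_curve \<A> \<gamma>" and t: "t \<in> {0..1}"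
  shows "velocity \<A> \<gamma>' t = velocity \<A> \<gamma> t"
proof
  fix f
  show "velocity \<A> \<gamma>' t f = velocity \<A> \<gamma> t f"
  proof (cases "f \<in> smooth_funs \<A>")
    case True
    have "((f \<circ> \<gamma>') has_vector_derivative velocity \<A> \<gamma> t f) (at t within {0..1})"
      by (rule has_vector_derivative_transform[OF t _ velocity_has_derivative[OF True \<gamma> t]])
         (simp add: eq)
    then show ?thesis by (rule velocity_eqI[OF True t])
  qed (simp add: velocity_def)
qed

lemma geodesic_cong:
  assumes geo: "geodesic \<A> D \<gamma>" and eq: "\<And>t. t \<in> {0..1} \<Longrightarrow> \<gamma>' t = \<gamma> t"
  shows "geodesic \<A> D \<gamma>'"
proof -
  obtain T where \<gamma>: "smooth_curve \<A> \<gamma>" and T: "covariant_derivative_along \<A> D \<gamma> T"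
    and T0: "\<And>t. t \<in> {0..1} \<Longrightarrow> T (velocity \<A> \<gamma>) t = 0"
    using geo by (auto simp: geodesic_def)
  have fa: "fields_along \<A> \<gamma>' = fields_along \<A> \<gamma>"
    using fields_along_cong[of _ \<gamma> \<gamma>'] fields_along_cong[of _ \<gamma>' \<gamma>] eq by fastforce
  have vel: "velocity \<A> \<gamma>' t = velocity \<A> \<gamma> t" if "t \<in> {0..1}" for t
    by (rule velocity_cong[OF eq \<gamma> that])
  have "covariant_derivative_along \<A> D \<gamma>' T"
    unfolding covariant_derivative_along_def fa
  proof (intro conjI ballI allI impI)
    fix X Y t assume *: "X \<in> vector_fields \<A>" "Y \<in> vector_fields \<A>" "t \<in> {0..1}"
      "X (\<gamma>' t) = velocity \<A> \<gamma>' t"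
    have "T (Y \<circ> \<gamma>) t = T (Y \<circ> \<gamma>') t"
      by (rule covariant_derivative_cong[OF T fields_along_vector_field[OF *(2) \<gamma>] _ *(3)])
         (simp add: eq)
    then show "T (Y \<circ> \<gamma>') t = D X Y (\<gamma>' t)"
      using covariant_derivativeD(4)[OF T *(1-3)] *(4) vel eq[OF *(3)] *(3) by simp
  qed (use covariant_derivativeD[OF T] in auto)
  moreover have "T (velocity \<A> \<gamma>') t = 0" if "t \<in> {0..1}" for t
    using covariant_derivative_cong[OF T velocity_field_along[OF \<gamma>] _ that, of "velocity \<A> \<gamma>'"]
      vel T0[OF that] by simp
  ultimately show ?thesis
    unfolding geodesic_def using smooth_curve_cong[OF \<gamma> eq] by blast
qed

lemma fields_along_push:
  assumes s: "smooth_map \<A> s" and V: "V \<in> fields_along \<A> \<gamma>"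
  shows "(\<lambda>t. differential \<A> s (V t)) \<in> fields_along \<A> (s \<circ> \<gamma>)"
proof (rule fields_alongI)
  show "smooth_on {0..1} (\<lambda>t. differential \<A> s (V t) f)" if "f \<in> smooth_funs \<A>" for f
    using fields_alongD(2)[OF V smooth_funs_compose_smooth_map[OF that s]]
    by (simp add: differential_apply[OF that])
qed (simp add: differential_tangent[OF s] fields_alongD(1)[OF V])

lemma velocity_image:
  assumes "smooth_map \<A> s"
  shows "velocity \<A> (s \<circ> \<gamma>) t = differential \<A> s (velocity \<A> \<gamma> t)"
  using smooth_funs_compose_smooth_map[OF _ assms]
  by (auto simp: velocity_def differential_def comp_assoc fun_eq_iff)

text \<open>
  The covariant derivative along \<open>\<gamma>\<close>, conjugated by \<open>s\<^sub>*\<close>, is the covariant derivative along \<open>s \<circ> \<gamma>\<close>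
  of any connection that agrees with \<open>s\<^sub>*D\<close> on the image.
\<close>

lemma geodesic_image:
  assumes s: "diffeomorphism \<A> s" and geo: "geodesic \<A> D \<gamma>"
    and agree: "connections_agree_on \<A> U (push_connection \<A> s D) D'"
    and U: "\<And>t. t \<in> {0..1} \<Longrightarrow> s (\<gamma> t) \<in> U"
  shows "geodesic \<A> D' (s \<circ> \<gamma>)"
proof -
  note d = diffeomorphismD[OF s]
  obtain T where \<gamma>: "smooth_curve \<A> \<gamma>" and T: "covariant_derivative_along \<A> D \<gamma> T"
    and T0: "\<And>t. t \<in> {0..1} \<Longrightarrow> T (velocity \<A> \<gamma>) t = 0"
    using geo by (auto simp: geodesic_def)
  define pull :: "(real \<Rightarrow> 'p tvec) \<Rightarrow> real \<Rightarrow> 'p tvec"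
    where "pull = (\<lambda>V t. differential \<A> (inv s) (V t))"
  define T' where "T' V t = differential \<A> s (T (pull V) t)" for V t
  have cancel\<gamma>: "inv s \<circ> (s \<circ> \<gamma>) = \<gamma>" using d(4) by (auto simp: fun_eq_iff)
  have pull: "pull V \<in> fields_along \<A> \<gamma>" if "V \<in> fields_along \<A> (s \<circ> \<gamma>)" for V
    using fields_along_push[OF d(3) that] by (simp add: pull_def cancel\<gamma>)
  have cancel: "differential \<A> s (pull V t) = V t"
    if "V \<in> fields_along \<A> (s \<circ> \<gamma>)" "t \<in> {0..1}" for V t
    unfolding pull_def by (rule differential_inverse(1)[OF s fields_alongD(1)[OF that]])
  have pull_push: "pull (\<lambda>t. differential \<A> s (V t)) t = V t"
    if "V \<in> fields_along \<A> \<gamma>" "t \<in> {0..1}" for V t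
    unfolding pull_def by (rule differential_inverse(2)[OF s fields_alongD(1)[OF that]])
  have vel: "velocity \<A> (s \<circ> \<gamma>) = (\<lambda>t. differential \<A> s (velocity \<A> \<gamma> t))"
    using velocity_image[OF d(2)] by auto
  have "covariant_derivative_along \<A> D' (s \<circ> \<gamma>) T'"
    unfolding covariant_derivative_along_def
  proof (intro conjI ballI allI impI)
    fix V assume V: "V \<in> fields_along \<A> (s \<circ> \<gamma>)"
    show "T' V \<in> fields_along \<A> (s \<circ> \<gamma>)"
      using fields_along_push[OF d(2) covariant_derivativeD(1)[OF T pull[OF V]]]
      by (simp add: T'_def[abs_def])
  next
    fix V W t assume *: "V \<in> fields_along \<A> (s \<circ> \<gamma>)" "W \<in> fields_along \<A> (s \<circ> \<gamma>)" "t \<in> {0..1::real}"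
    have "pull (V + W) = pull V + pull W" by (auto simp: pull_def differential_linear fun_eq_iff)
    then show "T' (V + W) t = T' V t + T' W t"
      using covariant_derivativeD(2)[OF T pull[OF *(1)] pull[OF *(2)] *(3)]
      by (simp add: T'_def differential_linear)
  next
    fix V h t assume *: "V \<in> fields_along \<A> (s \<circ> \<gamma>)" "smooth_on {0..1::real} (h :: real \<Rightarrow> real)" "t \<in> {0..1::real}"
    have "pull (\<lambda>r. h r *\<^sub>T V r) = (\<lambda>r. h r *\<^sub>T pull V r)"
      by (auto simp: pull_def differential_linear fun_eq_iff)
    then show "T' (\<lambda>r. h r *\<^sub>T V r) t =
        vector_derivative h (at t within {0..1}) *\<^sub>T V t + h t *\<^sub>T T' V t"
      using covariant_derivativeD(3)[OF T pull[OF *(1)] *(2,3)] cancel[OF *(1,3)]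
      by (simp add: T'_def differential_linear)
  next
    fix X Y t assume *: "X \<in> vector_fields \<A>" "Y \<in> vector_fields \<A>" "t \<in> {0..1}"
      "X ((s \<circ> \<gamma>) t) = velocity \<A> (s \<circ> \<gamma>) t"
    let ?X = "push_field \<A> (inv s) X" and ?Y = "push_field \<A> (inv s) Y"
    have v: "?X \<in> vector_fields \<A>" "?Y \<in> vector_fields \<A>"
      using push_field_vector_field[OF d(7)] * by auto
    have "?X (\<gamma> t) = velocity \<A> \<gamma> t"
      using *(4) differential_inverse(2)[OF s fields_alongD(1)[OF velocity_field_along[OF \<gamma>] *(3)]]
      by (simp add: push_field_def d(6) vel)
    then have "T (?Y \<circ> \<gamma>) t = D ?X ?Y (\<gamma> t)" by (rule covariant_derivativeD(4)[OF T v *(3)])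
    moreover have "pull (Y \<circ> (s \<circ> \<gamma>)) = ?Y \<circ> \<gamma>"
      by (auto simp: pull_def push_field_def d(6))
    ultimately have "T' (Y \<circ> (s \<circ> \<gamma>)) t = push_connection \<A> s D X Y (s (\<gamma> t))"
      by (simp add: T'_def push_connection_def push_field_at[OF s])
    then show "T' (Y \<circ> (s \<circ> \<gamma>)) t = D' X Y ((s \<circ> \<gamma>) t)"
      using agree U[OF *(3)] * by (simp add: connections_agree_on_def)
  qed
  moreover have "T' (velocity \<A> (s \<circ> \<gamma>)) t = 0" if t: "t \<in> {0..1}" for t
  proof -
    have v: "velocity \<A> \<gamma> \<in> fields_along \<A> \<gamma>" by (rule velocity_field_along[OF \<gamma>])
    have "T (velocity \<A> \<gamma>) t = T (pull (velocity \<A> (s \<circ> \<gamma>))) t"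
      by (rule covariant_derivative_cong[OF T v _ t]) (simp add: vel pull_push[OF v])
    then show ?thesis using T0[OF t] by (simp add: T'_def differential_linear)
  qed
  ultimately show ?thesis
    unfolding geodesic_def using smooth_curve_image[OF d(2) \<gamma>] by blast
qed

lemma affine_connectionD:
  assumes "affine_connection \<A> D" "X \<in> vector_fields \<A>" "Y \<in> vector_fields \<A>"
  shows "Z \<in> vector_fields \<A> \<Longrightarrow> D (X + Y) Z = D X Z + D Y Z"
    "f \<in> smooth_funs \<A> \<Longrightarrow> D (\<lambda>p. f p *\<^sub>T X p) Y = (\<lambda>p. f p *\<^sub>T D X Y p)"
  using assms unfolding affine_connection_def by blast+

lemma reflect_unit_interval: "(\<lambda>t. 1 - t) ` {0..1::real} = {0..1}"
  by (auto intro: image_eqI[of _ _ "1 - x" for x])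

lemma smooth_on_reflect:
  fixes h :: "real \<Rightarrow> 'b::real_normed_vector"
  assumes "smooth_on {0..1} h"
  shows "smooth_on {0..1} (\<lambda>t. h (1 - t))"
  by (rule smooth_on_compose[OF determines_derivatives_unit_interval _ assms])
     (auto intro!: smooth_on_diff smooth_on_const smooth_on_id determines_derivatives_unit_interval)

lemma has_vector_derivative_reflect:
  fixes h :: "real \<Rightarrow> 'b::real_normed_vector"
  assumes "(h has_vector_derivative d) (at (1 - t) within {0..1})"
  shows "((\<lambda>t. h (1 - t)) has_vector_derivative - d) (at t within {0..1})"
proof -
  have "((\<lambda>t. 1 - t) has_vector_derivative (- 1)) (at t within {0..1})"
    by (auto intro!: derivative_eq_intros)
  from vector_diff_chain_within[OF this, of h d] show ?thesis
    using assms by (simp add: reflect_unit_interval o_def)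
qed

lemma smooth_curve_reverse:
  assumes \<gamma>: "smooth_curve \<A> \<gamma>"
  shows "smooth_curve \<A> (\<lambda>t. \<gamma> (1 - t))"
proof -
  have c: "continuous_on {0..1} (\<lambda>t. \<gamma> (1 - t))"
    by (rule continuous_on_compose2[OF smooth_curveD(1)[OF \<gamma>]]) (auto intro!: continuous_intros)
  moreover have "smooth_on ({0..1} \<inter> (\<lambda>t. \<gamma> (1 - t)) -` U) (\<phi> \<circ> (\<lambda>t. \<gamma> (1 - t)))"
    if U: "(U, \<phi>) \<in> \<A>" for U \<phi>
  proof -
    note dd = determines_derivatives_curve_preimage[OF c chart_props(1)[OF U]]
    have "smooth_on ({0..1} \<inter> (\<lambda>t. \<gamma> (1 - t)) -` U) (\<lambda>t. (\<phi> \<circ> \<gamma>) (1 - t))"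
      by (rule smooth_on_compose[OF dd _ smooth_curveD(2)[OF \<gamma> U]])
         (auto intro!: smooth_on_diff smooth_on_const smooth_on_id dd)
    then show ?thesis by (simp add: o_def)
  qed
  ultimately show ?thesis by (auto simp: smooth_curve_def)
qed

lemma velocity_reverse:
  assumes "smooth_curve \<A> \<gamma>" "t \<in> {0..1}"
  shows "velocity \<A> (\<lambda>t. \<gamma> (1 - t)) t = - velocity \<A> \<gamma> (1 - t)"
proof
  fix f
  show "velocity \<A> (\<lambda>t. \<gamma> (1 - t)) t f = (- velocity \<A> \<gamma> (1 - t)) f"
  proof (cases "f \<in> smooth_funs \<A>")
    case True
    have "((f \<circ> \<gamma>) has_vector_derivative velocity \<A> \<gamma> (1 - t) f) (at (1 - t) within {0..1})"
      using assms by (intro velocity_has_derivative True) auto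
    from has_vector_derivative_reflect[OF this] show ?thesis
      using assms(2) by (intro velocity_eqI[OF True]) (simp_all add: o_def)
  qed (simp add: velocity_def)
qed

lemma fields_along_reverse:
  assumes "V \<in> fields_along \<A> \<gamma>"
  shows "(\<lambda>t. V (1 - t)) \<in> fields_along \<A> (\<lambda>t. \<gamma> (1 - t))"
  using fields_alongD[OF assms] by (intro fields_alongI) (auto intro: smooth_on_reflect)

text \<open>
  Reversal of time turns the covariant derivative into its negative; since the velocity changes sign
  as well, the defining identity \<open>D/dt (Y \<circ> \<gamma>) = D\<^bsub>\<gamma>'\<^esub> Y\<close> is preserved.
\<close>

lemma geodesic_reverse:
  assumes aff: "affine_connection \<A> D" and geo: "geodesic \<A> D \<gamma>"
  shows "geodesic \<A> D (\<lambda>t. \<gamma> (1 - t))"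
proof -
  obtain T where \<gamma>: "smooth_curve \<A> \<gamma>" and T: "covariant_derivative_along \<A> D \<gamma> T"
    and T0: "\<And>t. t \<in> {0..1} \<Longrightarrow> T (velocity \<A> \<gamma>) t = 0"
    using geo by (auto simp: geodesic_def)
  let ?\<gamma> = "\<lambda>t. \<gamma> (1 - t)"
  define T' where "T' V t = - T (\<lambda>r. V (1 - r)) (1 - t)" for V t
  have rev: "(\<lambda>t. V (1 - t)) \<in> fields_along \<A> \<gamma>" if "V \<in> fields_along \<A> ?\<gamma>" for V
    using fields_along_reverse[OF that] by simp
  have i: "1 - t \<in> {0..1}" if "t \<in> {0..1}" for t :: real using that by auto
  have "covariant_derivative_along \<A> D ?\<gamma> T'"
    unfolding covariant_derivative_along_def
  proof (intro conjI ballI allI impI)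
    fix V assume V: "V \<in> fields_along \<A> ?\<gamma>"
    have "(\<lambda>t. (- 1) *\<^sub>T T (\<lambda>r. V (1 - r)) (1 - t)) \<in> fields_along \<A> ?\<gamma>"
      by (intro fields_along_scale fields_along_reverse covariant_derivativeD(1)[OF T] rev[OF V]
          smooth_on_const determines_derivatives_unit_interval)
    then show "T' V \<in> fields_along \<A> ?\<gamma>" by (simp add: T'_def[abs_def] tangent_minus_eq)
  next
    fix V W t assume *: "V \<in> fields_along \<A> ?\<gamma>" "W \<in> fields_along \<A> ?\<gamma>" "t \<in> {0..1::real}"
    have "(\<lambda>r. (V + W) (1 - r)) = (\<lambda>r. V (1 - r)) + (\<lambda>r. W (1 - r))" by auto
    then show "T' (V + W) t = T' V t + T' W t"
      using covariant_derivativeD(2)[OF T rev[OF *(1)] rev[OF *(2)] i[OF *(3)]]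
      by (simp add: T'_def)
  next
    fix V h t assume *: "V \<in> fields_along \<A> ?\<gamma>" "smooth_on {0..1::real} (h :: real \<Rightarrow> real)" "t \<in> {0..1::real}"
    have "(h has_vector_derivative vector_derivative h (at t within {0..1})) (at (1 - (1 - t)) within {0..1})"
      using smooth_on_has_vector_derivative[OF *(2,3)] by simp
    from vector_derivative_within[OF at_within_unit_interval_nontrivial has_vector_derivative_reflect[OF this]]
    have "vector_derivative (\<lambda>r. h (1 - r)) (at (1 - t) within {0..1}) =
        - vector_derivative h (at t within {0..1})"
      using i[OF *(3)] by blast
    then show "T' (\<lambda>r. h r *\<^sub>T V r) t =
        vector_derivative h (at t within {0..1}) *\<^sub>T V t + h t *\<^sub>T T' V t"
      using covariant_derivativeD(3)[OF T rev[OF *(1)] smooth_on_reflect[OF *(2)] i[OF *(3)]]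
      by (simp add: T'_def tscale_def fun_eq_iff)
  next
    fix X Y t assume *: "X \<in> vector_fields \<A>" "Y \<in> vector_fields \<A>" "t \<in> {0..1}"
      "X (?\<gamma> t) = velocity \<A> ?\<gamma> t"
    let ?X = "\<lambda>p. (- 1) *\<^sub>T X p"
    have X: "?X \<in> vector_fields \<A>"
      using smooth_funs_cmult[OF vector_fieldsD(2)[OF *(1)], of _ "-1"]
        tangent_space_scale[OF vector_fieldsD(1)[OF *(1)], of "-1"]
      by (auto simp: vector_fields_def tscale_def)
    have "?X (\<gamma> (1 - t)) = velocity \<A> \<gamma> (1 - t)"
      using *(4) velocity_reverse[OF \<gamma> *(3)] by (simp add: tscale_def fun_eq_iff)
    then have "T (Y \<circ> \<gamma>) (1 - t) = D ?X Y (\<gamma> (1 - t))"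
      by (rule covariant_derivativeD(4)[OF T X *(2) i[OF *(3)]])
    moreover have "D ?X Y = (\<lambda>p. (- 1) *\<^sub>T D X Y p)"
      by (rule affine_connectionD(2)[OF aff *(1,2) smooth_funs_const])
    ultimately show "T' (Y \<circ> ?\<gamma>) t = D X Y (?\<gamma> t)"
      by (simp add: T'_def o_def tscale_def fun_eq_iff)
  qed
  moreover have "T' (velocity \<A> ?\<gamma>) t = 0" if t: "t \<in> {0..1}" for t
  proof -
    note v = velocity_field_along[OF \<gamma>]
    note c = smooth_on_const[OF determines_derivatives_unit_interval, of "- 1 :: real"]
    have "T (\<lambda>r. (- 1) *\<^sub>T velocity \<A> \<gamma> r) (1 - t) = T (\<lambda>r. velocity \<A> ?\<gamma> (1 - r)) (1 - t)"
      by (rule covariant_derivative_cong[OF T fields_along_scale[OF v c] _ i[OF t]])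
         (use velocity_reverse[OF \<gamma> i] in \<open>auto simp: tangent_minus_eq\<close>)
    moreover have "vector_derivative (\<lambda>r. - 1 :: real) (at (1 - t) within {0..1}) = 0"
      by (rule vector_derivative_within[OF at_within_unit_interval_nontrivial[OF i[OF t]]
            has_vector_derivative_const])
    then have "T (\<lambda>r. (- 1) *\<^sub>T velocity \<A> \<gamma> r) (1 - t) = 0"
      using covariant_derivativeD(3)[OF T v c i[OF t]] T0[OF i[OF t]]
      by (simp add: tscale_def fun_eq_iff)
    ultimately show ?thesis by (simp add: T'_def)
  qed
  ultimately show ?thesis
    unfolding geodesic_def using smooth_curve_reverse[OF \<gamma>] by blast
qed

lemma geodesic_segment_geodesic:
  assumes "uniquely_joined \<A> D P Q"
  shows "geodesic \<A> D (geodesic_segment \<A> D P Q)"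
    "geodesic_segment \<A> D P Q 0 = P" "geodesic_segment \<A> D P Q 1 = Q"
proof -
  have "geodesic_segment \<A> D P Q \<in> geodesics_between \<A> D P Q"
    using theI'[of "\<lambda>\<gamma>. \<gamma> \<in> geodesics_between \<A> D P Q"] assms
    by (simp add: geodesic_segment_def uniquely_joined_def)
  then show "geodesic \<A> D (geodesic_segment \<A> D P Q)"
    "geodesic_segment \<A> D P Q 0 = P" "geodesic_segment \<A> D P Q 1 = Q"
    by (auto simp: geodesics_between_def)
qed

text \<open>
  The curve \<open>\<gamma>\<close> itself need not be the segment, which is normalised outside \<open>{0..1}\<close>; its
  restriction is.
\<close>

lemma geodesic_segment_eq:
  assumes uj: "uniquely_joined \<A> D P Q" and geo: "geodesic \<A> D \<gamma>"
    and ends: "\<gamma> 0 = P" "\<gamma> 1 = Q" and t: "t \<in> {0..1}"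
  shows "geodesic_segment \<A> D P Q t = \<gamma> t"
proof -
  have "geodesic \<A> D (restrict \<gamma> {0..1})" by (rule geodesic_cong[OF geo]) simp
  then have "restrict \<gamma> {0..1} \<in> geodesics_between \<A> D P Q"
    using ends by (simp add: geodesics_between_def)
  then have "geodesic_segment \<A> D P Q = restrict \<gamma> {0..1}"
    using uj unfolding geodesic_segment_def uniquely_joined_def by (rule the1_equality[rotated])
  then show ?thesis using t by simp
qed

end

section \<open>Uniqueness of geodesics with given initial velocity\<close>

text \<open>
  On a short interval around \<open>t\<^sub>0\<close> the mean value inequality bounds the distance of the two solutions
  by half of its own supremum, so that it vanishes. This treats both sides of \<open>t\<^sub>0\<close> at once.
\<close>

lemma ode_locally_unique:
  fixes z1 z2 :: "real \<Rightarrow> 'a::euclidean_space" and H :: "'a \<Rightarrow> 'a"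
  assumes W: "open W" and H: "smooth_on W H"
    and J: "convex J" "compact J" and t0: "t0 \<in> J"
    and cont: "continuous_on J z1" "continuous_on J z2"
    and init: "z1 t0 = z2 t0" "z1 t0 \<in> W" and \<eta>: "\<eta> > 0"
    and d1: "\<And>t. \<lbrakk>t \<in> J; \<bar>t - t0\<bar> < \<eta>\<rbrakk> \<Longrightarrow> (z1 has_vector_derivative H (z1 t)) (at t within J)"
    and d2: "\<And>t. \<lbrakk>t \<in> J; \<bar>t - t0\<bar> < \<eta>\<rbrakk> \<Longrightarrow> (z2 has_vector_derivative H (z2 t)) (at t within J)"
  shows "\<exists>\<delta>>0. \<forall>t\<in>J. \<bar>t - t0\<bar> < \<delta> \<longrightarrow> z1 t = z2 t"
proof -
  obtain r where r: "r > 0" "cball (z1 t0) r \<subseteq> W"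
    using W init(2) open_contains_cball by blast
  define K where "K = cball (z1 t0) r"
  define H' where "H' x = frechet_derivative H (at x within W)" for x
  have KW: "K \<subseteq> W" using r(2) by (simp add: K_def)
  have H': "(H has_derivative H' x) (at x within K)" if "x \<in> K" for x
    unfolding H'_def
    by (rule has_derivative_subset[OF smooth_on_has_derivative[OF H] KW]) (use that KW in auto)
  have "continuous_on K (\<lambda>x. \<Sum>b\<in>Basis. norm (H' x b))"
    unfolding H'_def
    by (intro continuous_on_sum continuous_on_norm continuous_on_subset[OF _ KW]
        smooth_on_imp_continuous_on[OF smooth_on_frechet_derivative[OF H]])
  then have "bounded ((\<lambda>x. \<Sum>b\<in>Basis. norm (H' x b)) ` K)"
    by (intro compact_imp_bounded compact_continuous_image) (auto simp: K_def)
  then obtain B where B: "B > 0" "\<And>x. x \<in> K \<Longrightarrow> norm (\<Sum>b\<in>Basis. norm (H' x b)) \<le> B"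
    unfolding bounded_pos by auto
  have lip: "norm (H x - H y) \<le> B * norm (x - y)" if "x \<in> K" "y \<in> K" for x y
  proof (rule differentiable_bound[OF _ H' _ that])
    show "onorm (H' x) \<le> B" if "x \<in> K" for x
      using onorm_componentwise[OF has_derivative_bounded_linear[OF H'[OF that]]] B(2)[OF that]
      by simp
  qed (simp add: K_def)
  have near: "\<exists>\<epsilon>>0. \<forall>t\<in>J. \<bar>t - t0\<bar> < \<epsilon> \<longrightarrow> z t \<in> K"
    if "continuous_on J z" "z t0 = z1 t0" for z
  proof -
    have "\<exists>\<epsilon>>0. \<forall>t\<in>J. dist t t0 < \<epsilon> \<longrightarrow> dist (z t) (z t0) < r"
      using that(1) t0 r(1) unfolding continuous_on_iff by simp
    then show ?thesis
      using that(2) unfolding K_def dist_real_def mem_cball by (metis dist_commute less_imp_le)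
  qed
  obtain \<epsilon>1 where \<epsilon>1: "\<epsilon>1 > 0" "\<And>t. t \<in> J \<Longrightarrow> \<bar>t - t0\<bar> < \<epsilon>1 \<Longrightarrow> z1 t \<in> K"
    using near[OF cont(1)] by auto
  obtain \<epsilon>2 where \<epsilon>2: "\<epsilon>2 > 0" "\<And>t. t \<in> J \<Longrightarrow> \<bar>t - t0\<bar> < \<epsilon>2 \<Longrightarrow> z2 t \<in> K"
    using near[OF cont(2)] init(1) by auto
  define \<delta> where "\<delta> = Min {\<epsilon>1 / 2, \<epsilon>2 / 2, \<eta> / 2, 1 / (2 * B)}"
  have "\<delta> \<le> \<epsilon>1 / 2" "\<delta> \<le> \<epsilon>2 / 2" "\<delta> \<le> \<eta> / 2" "\<delta> \<le> 1 / (2 * B)"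
    unfolding \<delta>_def by (rule Min_le; simp)+
  moreover have "\<delta> > 0"
    using \<epsilon>1(1) \<epsilon>2(1) \<eta> B(1) unfolding \<delta>_def by (subst Min_gr_iff) auto
  ultimately have \<delta>: "\<delta> > 0" "\<delta> < \<epsilon>1" "\<delta> < \<epsilon>2" "\<delta> < \<eta>" "B * \<delta> \<le> 1 / 2"
    using \<epsilon>1(1) \<epsilon>2(1) \<eta> B(1) by (simp_all add: pos_le_divide_eq algebra_simps)
  define I where "I = J \<inter> cball t0 \<delta>"
  have I: "t \<in> J" "\<bar>t - t0\<bar> \<le> \<delta>" "\<bar>t - t0\<bar> < \<eta>" "z1 t \<in> K" "z2 t \<in> K" if "t \<in> I" for t
    using that \<delta> \<epsilon>1(2)[of t] \<epsilon>2(2)[of t] by (auto simp: I_def dist_real_def abs_minus_commute)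
  have IJ: "I \<subseteq> J" and cI: "compact I" "convex I" and t0I: "t0 \<in> I"
    using J t0 \<delta>(1) by (auto simp: I_def intro: compact_Int convex_Int)
  define w where "w t = z1 t - z2 t" for t
  have "continuous_on I (\<lambda>t. norm (w t))"
    unfolding w_def using cont IJ by (intro continuous_intros) (auto intro: continuous_on_subset)
  then obtain s where s: "s \<in> I" "\<And>t. t \<in> I \<Longrightarrow> norm (w t) \<le> norm (w s)"
    using continuous_attains_sup[OF cI(1)] t0I by blast
  define m where "m = norm (w s)"
  have "norm (w s - w t0) \<le> (B * m) * norm (s - t0)"
  proof (rule differentiable_bound[OF cI(2) _ _ s(1) t0I])
    fix t assume t: "t \<in> I"
    have "(w has_vector_derivative H (z1 t) - H (z2 t)) (at t within J)"
      unfolding w_def[abs_def] using I[OF t] by (intro has_vector_derivative_diff d1 d2) auto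
    then show "(w has_derivative (\<lambda>h. h *\<^sub>R (H (z1 t) - H (z2 t)))) (at t within I)"
      unfolding has_vector_derivative_def using IJ by (rule has_derivative_subset)
    have "norm (H (z1 t) - H (z2 t)) \<le> B * norm (w t)"
      unfolding w_def using I[OF t] by (intro lip) auto
    also have "\<dots> \<le> B * m" unfolding m_def using B(1) s(2)[OF t] by (intro mult_left_mono) auto
    finally have b: "norm (H (z1 t) - H (z2 t)) \<le> B * m" .
    show "onorm (\<lambda>h. h *\<^sub>R (H (z1 t) - H (z2 t))) \<le> B * m"
    proof (rule onorm_bound)
      show "0 \<le> B * m" using B(1) by (simp add: m_def)
      show "norm (h *\<^sub>R (H (z1 t) - H (z2 t))) \<le> B * m * norm h" for h
        using mult_right_mono[OF b norm_ge_zero[of h]] by (simp add: mult.commute)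
    qed
  qed
  also have "\<dots> \<le> (B * m) * \<delta>"
    using I(2)[OF s(1)] B(1) by (intro mult_left_mono) (auto simp: m_def)
  also have "\<dots> \<le> m / 2"
    using mult_right_mono[OF \<delta>(5), of m] by (simp add: m_def algebra_simps)
  finally have "m \<le> m / 2" using init(1) by (simp add: w_def m_def)
  then have "m = 0" by (simp add: m_def)
  then have "z1 t = z2 t" if "t \<in> I" for t
    using s(2)[OF that] by (simp add: m_def w_def)
  then show ?thesis
    using \<delta>(1) by (intro exI[of _ \<delta>]) (auto simp: I_def dist_real_def)
qed

lemma sum_fun_apply: "(\<Sum>i\<in>I. f i) x = (\<Sum>i\<in>I. f i x)"
  by (induction I rule: infinite_finite_induct) auto

context smooth_manifold
begin

lemma vector_fields_zero: "0 \<in> vector_fields \<A>"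
  using tangent_space_zero smooth_funs_const[of 0] by (auto simp: vector_fields_def)

lemma vector_fields_add:
  "\<lbrakk>X \<in> vector_fields \<A>; Y \<in> vector_fields \<A>\<rbrakk> \<Longrightarrow> X + Y \<in> vector_fields \<A>"
  by (auto simp: vector_fields_def intro!: tangent_space_add smooth_funs_add)

lemma vector_fields_scale:
  assumes "X \<in> vector_fields \<A>" "h \<in> smooth_funs \<A>"
  shows "(\<lambda>p. h p *\<^sub>T X p) \<in> vector_fields \<A>"
  unfolding vector_fields_def
proof (intro CollectI conjI allI ballI)
  show "(\<lambda>p. (h p *\<^sub>T X p) f) \<in> smooth_funs \<A>" if "f \<in> smooth_funs \<A>" for f
    unfolding tscale_def by (rule smooth_funs_mult[OF assms(2) vector_fieldsD(2)[OF assms(1) that]])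
qed (intro tangent_space_scale vector_fieldsD(1)[OF assms(1)])

lemma vector_fields_sum:
  "(\<And>i. i \<in> I \<Longrightarrow> X i \<in> vector_fields \<A>) \<Longrightarrow> (\<Sum>i\<in>I. X i) \<in> vector_fields \<A>"
  by (induction I rule: infinite_finite_induct) (simp_all add: vector_fields_zero vector_fields_add)

lemma affine_connection_sum:
  assumes D: "affine_connection \<A> D" and Y: "Y \<in> vector_fields \<A>"
    and X: "\<And>i. i \<in> I \<Longrightarrow> X i \<in> vector_fields \<A>"
  shows "D (\<Sum>i\<in>I. X i) Y = (\<Sum>i\<in>I. D (X i) Y)"
proof -
  have "D (\<lambda>p. 0 *\<^sub>T Y p) Y = (\<lambda>p. 0 *\<^sub>T D Y Y p)"
    by (rule affine_connectionD(2)[OF D Y Y smooth_funs_const])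
  then have D0: "D 0 Y = 0" by (simp add: tscale_def fun_eq_iff zero_fun_def)
  show ?thesis
    using X
  proof (induction I rule: infinite_finite_induct)
    case (insert i I)
    have "D (X i + (\<Sum>i\<in>I. X i)) Y = D (X i) Y + D (\<Sum>i\<in>I. X i) Y"
      using insert.prems by (intro affine_connectionD(1)[OF D] vector_fields_sum Y) auto
    moreover have "D (\<Sum>i\<in>I. X i) Y = (\<Sum>i\<in>I. D (X i) Y)" using insert by blast
    ultimately show ?case by (simp only: sum.insert[OF insert.hyps])
  qed (simp_all add: D0)
qed

lemma fields_along_zero: "0 \<in> fields_along \<A> \<gamma>"
  by (rule fields_alongI)
     (simp_all add: tangent_space_zero smooth_on_const determines_derivatives_unit_interval)

lemma fields_along_sum:
  "(\<And>i. i \<in> I \<Longrightarrow> V i \<in> fields_along \<A> \<gamma>) \<Longrightarrow> (\<Sum>i\<in>I. V i) \<in> fields_along \<A> \<gamma>"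
  by (induction I rule: infinite_finite_induct) (simp_all add: fields_along_zero fields_along_add)

lemma covariant_derivative_sum:
  assumes T: "covariant_derivative_along \<A> D \<gamma> T" and t: "t \<in> {0..1}"
    and V: "\<And>i. i \<in> I \<Longrightarrow> V i \<in> fields_along \<A> \<gamma>"
  shows "T (\<Sum>i\<in>I. V i) t = (\<Sum>i\<in>I. T (V i) t)"
proof -
  have "T (0 + 0) t = T 0 t + T 0 t"
    by (rule covariant_derivativeD(2)[OF T fields_along_zero fields_along_zero t])
  then have T0: "T 0 t = 0" by simp
  show ?thesis
    using V
  proof (induction I rule: infinite_finite_induct)
    case (insert i I)
    have "T (V i + (\<Sum>i\<in>I. V i)) t = T (V i) t + T (\<Sum>i\<in>I. V i) t"
      using insert.prems by (intro covariant_derivativeD(2)[OF T _ _ t] fields_along_sum) auto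
    moreover have "T (\<Sum>i\<in>I. V i) t = (\<Sum>i\<in>I. T (V i) t)" using insert by blast
    ultimately show ?case by (simp only: sum.insert[OF insert.hyps])
  qed (simp_all add: T0)
qed

text \<open>
  The classical equation \<open>x\<^sub>m'' = - \<Sum>\<^sub>i\<^sub>k \<Gamma>\<^sub>i\<^sub>k\<^sub>m x\<^sub>i' x\<^sub>k'\<close> in an adapted frame. The frame only spans
  where \<open>\<beta> \<noteq> 0\<close>, but \<open>\<beta>\<close> times the velocity is a combination of the frame fields along all of \<open>\<gamma>\<close>;
  differentiating this combination, the terms with the derivative of \<open>\<beta>\<close> cancel.
\<close>

lemma geodesic_equation:
  fixes X :: "'p \<Rightarrow> 'e" and E :: "'e \<Rightarrow> 'p vfield" and \<beta> :: "'p \<Rightarrow> real"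
  assumes aff: "affine_connection \<A> D" and geo: "geodesic \<A> D \<gamma>" and t: "t \<in> {0..1}"
    and frame: "adapted_frame X E \<beta>" and \<beta>t: "\<beta> (\<gamma> t) \<noteq> 0"
    and m: "m \<in> Basis"
  shows "((\<lambda>t. velocity \<A> \<gamma> t (\<lambda>q. X q \<bullet> m)) has_vector_derivative
    - (\<Sum>k\<in>Basis. \<Sum>i\<in>Basis. velocity \<A> \<gamma> t (\<lambda>q. X q \<bullet> i) * velocity \<A> \<gamma> t (\<lambda>q. X q \<bullet> k) *
        D (E i) (E k) (\<gamma> t) (\<lambda>q. X q \<bullet> m))) (at t within {0..1})"
proof -
  obtain T where \<gamma>: "smooth_curve \<A> \<gamma>" and T: "covariant_derivative_along \<A> D \<gamma> T"
    and T0: "\<And>t. t \<in> {0..1} \<Longrightarrow> T (velocity \<A> \<gamma>) t = 0"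
    using geo by (auto simp: geodesic_def)
  note dd = determines_derivatives_unit_interval
  note \<beta> = adapted_frameD(1)[OF frame] and X = adapted_frameD(2)[OF frame]
    and E = adapted_frameD(3)[OF frame] and span = adapted_frameD(4)[OF frame \<gamma>]
    and dual = adapted_frameD(5)[OF frame]
  define x where "x b = (\<lambda>q. X q \<bullet> b)" for b
  define u where "u b = (\<lambda>t. velocity \<A> \<gamma> t (x b))" for b
  define h where "h = \<beta> \<circ> \<gamma>"
  note V = velocity_field_along[OF \<gamma>]
  have xs: "x b \<in> smooth_funs \<A>" for b using X by (simp add: x_def)
  have h: "smooth_on {0..1} h" unfolding h_def by (rule smooth_fun_along_curve[OF \<beta> \<gamma>])
  have u: "smooth_on {0..1} (u b)" for b unfolding u_def by (rule fields_alongD(2)[OF V xs])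
  have hu: "smooth_on {0..1} (\<lambda>t. h t * u b t)" for b by (intro smooth_on_mult dd h u)
  have Ea: "E k \<circ> \<gamma> \<in> fields_along \<A> \<gamma>" for k by (rule fields_along_vector_field[OF E \<gamma>])
  define h' u' where "h' = vector_derivative h (at t within {0..1})"
    and "u' b = vector_derivative (u b) (at t within {0..1})" for b
  have dh: "(h has_vector_derivative h') (at t within {0..1})"
    and du: "(u b has_vector_derivative u' b) (at t within {0..1})" for b
    unfolding h'_def u'_def by (rule smooth_on_has_vector_derivative[OF _ t]; rule h u)+
  have dhu: "vector_derivative (\<lambda>t. h t * u b t) (at t within {0..1}) = h t * u' b + h' * u b t" for b
    by (rule vector_derivative_within[OF at_within_unit_interval_nontrivial[OF t]
          has_vector_derivative_mult[OF dh du]])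
  define F where "F k = (\<lambda>r. (h r * u k r) *\<^sub>T (E k \<circ> \<gamma>) r)" for k
  have F: "F k \<in> fields_along \<A> \<gamma>" for k unfolding F_def by (rule fields_along_scale[OF Ea hu])
  have hV: "(\<lambda>r. h r *\<^sub>T velocity \<A> \<gamma> r) \<in> fields_along \<A> \<gamma>" by (rule fields_along_scale[OF V h])
  have combination: "h r *\<^sub>T velocity \<A> \<gamma> r = (\<Sum>k\<in>Basis. F k) r" if r: "r \<in> {0..1}" for r
  proof
    fix f
    show "(h r *\<^sub>T velocity \<A> \<gamma> r) f = (\<Sum>k\<in>Basis. F k) r f"
    proof (cases "f \<in> smooth_funs \<A> \<and> \<beta> (\<gamma> r) \<noteq> 0")
      case True
      then show ?thesis
        using span[OF r, of f]
        by (simp add: sum_fun_apply F_def tscale_def u_def x_def sum_distrib_left mult.assoc)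
    next
      case False
      then show ?thesis
        using tangent_spaceD(4)[OF vector_fieldsD(1)[OF E]]
        by (auto simp: sum_fun_apply F_def tscale_def h_def velocity_def)
    qed
  qed
  have left: "T (\<lambda>r. h r *\<^sub>T velocity \<A> \<gamma> r) t (x m) = h' * u m t"
    using covariant_derivativeD(3)[OF T V h t] T0[OF t] by (simp add: h'_def u_def tscale_def)
  \<comment> \<open>A global field through the velocity at the one time \<open>t\<close>: its coefficients are constants.\<close>
  define Z where "Z = (\<Sum>i\<in>Basis. (\<lambda>p. u i t *\<^sub>T E i p))"
  have Zi: "(\<lambda>p. u i t *\<^sub>T E i p) \<in> vector_fields \<A>" for i
    by (rule vector_fields_scale[OF E smooth_funs_const])
  have Z: "Z \<in> vector_fields \<A>" unfolding Z_def by (intro vector_fields_sum Zi)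
  have ZV: "Z (\<gamma> t) = velocity \<A> \<gamma> t"
  proof
    fix f show "Z (\<gamma> t) f = velocity \<A> \<gamma> t f"
    proof (cases "f \<in> smooth_funs \<A>")
      case True
      then show ?thesis
        using span[OF t \<beta>t True] by (simp add: Z_def sum_fun_apply tscale_def u_def x_def)
    next
      case False
      then show ?thesis
        using tangent_spaceD(4)[OF vector_fieldsD(1)[OF E]]
        by (simp add: Z_def sum_fun_apply tscale_def velocity_def)
    qed
  qed
  have TE: "T (E k \<circ> \<gamma>) t (x m) = (\<Sum>i\<in>Basis. u i t * D (E i) (E k) (\<gamma> t) (x m))" for k
  proof -
    have "D Z (E k) = (\<Sum>i\<in>Basis. D (\<lambda>p. u i t *\<^sub>T E i p) (E k))"
      unfolding Z_def by (rule affine_connection_sum[OF aff E Zi])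
    also have "\<dots> = (\<Sum>i\<in>Basis. (\<lambda>p. u i t *\<^sub>T D (E i) (E k) p))"
      by (intro sum.cong refl affine_connectionD(2)[OF aff E E smooth_funs_const])
    finally show ?thesis
      using covariant_derivativeD(4)[OF T Z E t ZV] by (simp add: sum_fun_apply tscale_def)
  qed
  have TF: "T (F k) t (x m) = (h t * u' k + h' * u k t) * (k \<bullet> m) +
      h t * (\<Sum>i\<in>Basis. u i t * u k t * D (E i) (E k) (\<gamma> t) (x m))" for k
    using covariant_derivativeD(3)[OF T Ea hu t, of k k, folded F_def] dual[OF \<beta>t, of k m] TE[of k]
    by (simp add: dhu tscale_def x_def[symmetric] sum_distrib_left algebra_simps)
  have "T (\<lambda>r. h r *\<^sub>T velocity \<A> \<gamma> r) t = T (\<Sum>k\<in>Basis. F k) t"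
    by (rule covariant_derivative_cong[OF T hV _ t]) (rule combination)
  then have "h' * u m t = (\<Sum>k\<in>Basis. T (F k) t) (x m)"
    using left covariant_derivative_sum[OF T t, of Basis F, OF F] by simp
  then have "h' * u m t = (\<Sum>k\<in>Basis. T (F k) t (x m))"
    by (simp only: sum_fun_apply)
  also have "\<dots> = (\<Sum>k\<in>Basis. (h t * u' k + h' * u k t) * (k \<bullet> m)) +
      h t * (\<Sum>k\<in>Basis. \<Sum>i\<in>Basis. u i t * u k t * D (E i) (E k) (\<gamma> t) (x m))"
    by (simp add: TF sum.distrib sum_distrib_left)
  also have "(\<Sum>k\<in>Basis. (h t * u' k + h' * u k t) * (k \<bullet> m)) =
      (\<Sum>k\<in>Basis. if k = m then h t * u' k + h' * u k t else 0)"
    using m by (intro sum.cong refl) (auto simp: inner_Basis)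
  also have "\<dots> = h t * u' m + h' * u m t" using m by simp
  finally have "h t * (u' m + (\<Sum>k\<in>Basis. \<Sum>i\<in>Basis. u i t * u k t * D (E i) (E k) (\<gamma> t) (x m))) = 0"
    by (simp add: algebra_simps)
  then have "u' m = - (\<Sum>k\<in>Basis. \<Sum>i\<in>Basis. u i t * u k t * D (E i) (E k) (\<gamma> t) (x m))"
    using \<beta>t by (simp add: h_def eq_neg_iff_add_eq_0)
  then show ?thesis using du[of m] by (simp add: u_def x_def)
qed

text \<open>
  The coordinates of position and velocity of both geodesics solve the same first-order system, and
  in an adapted frame they determine position and velocity.
\<close>

lemma geodesics_locally_equal:
  assumes aff: "affine_connection \<A> D" and geo: "geodesic \<A> D \<gamma>1" "geodesic \<A> D \<gamma>2"
    and t0: "t0 \<in> {0..1}" and init: "\<gamma>1 t0 = \<gamma>2 t0" "velocity \<A> \<gamma>1 t0 = velocity \<A> \<gamma>2 t0"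
  shows "\<exists>\<delta>>0. \<forall>t\<in>{0..1}. \<bar>t - t0\<bar> < \<delta> \<longrightarrow> \<gamma>1 t = \<gamma>2 t \<and> velocity \<A> \<gamma>1 t = velocity \<A> \<gamma>2 t"
proof -
  have c: "smooth_curve \<A> \<gamma>1" "smooth_curve \<A> \<gamma>2" using geo by (auto simp: geodesic_def)
  obtain X :: "'p \<Rightarrow> 'e" and E :: "'e \<Rightarrow> 'p vfield" and \<beta> :: "'p \<Rightarrow> real"
    where frame: "adapted_frame X E \<beta>" and \<beta>0: "\<beta> (\<gamma>1 t0) \<noteq> 0"
    using adapted_frame_exists by blast
  note \<beta> = adapted_frameD(1)[OF frame] and X = adapted_frameD(2)[OF frame]
    and E = adapted_frameD(3)[OF frame] and span = adapted_frameD(4)[OF frame]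
  define N where "N = {q. \<beta> q \<noteq> 0}"
  note inj = adapted_frameD(6)[OF frame, folded N_def] and op = adapted_frameD(7)[OF frame, folded N_def]
    and coord = adapted_frameD(8)[OF frame, folded N_def]
  define \<Gamma> where "\<Gamma> i k m = (\<lambda>q. D (E i) (E k) q (\<lambda>q. X q \<bullet> m))" for i k m
  have \<Gamma>: "\<Gamma> i k m \<in> smooth_funs \<A>" for i k m
    unfolding \<Gamma>_def by (rule vector_fieldsD(2)[OF affine_connection_vector_field[OF aff E E] X])
  \<comment> \<open>The geodesic equation as a first-order system for position and velocity coordinates.\<close>
  define H :: "'e \<times> 'e \<Rightarrow> 'e \<times> 'e" where "H z = (snd z, \<Sum>m\<in>Basis. - (\<Sum>k\<in>Basis. \<Sum>i\<in>Basis.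
      (snd z \<bullet> i) * (snd z \<bullet> k) * (\<Gamma> i k m \<circ> inv_into N X) (fst z)) *\<^sub>R m)" for z
  define W where "W = X ` N \<times> (UNIV :: 'e set)"
  have W: "open W" unfolding W_def using op by (intro open_Times) auto
  have ddW: "determines_derivatives W" by (rule determines_derivatives_open[OF W])
  have fst: "smooth_on W fst" and snd: "smooth_on W snd"
    using smooth_on_linear_comp[OF ddW bounded_linear_fst smooth_on_id[OF ddW]]
      smooth_on_linear_comp[OF ddW bounded_linear_snd smooth_on_id[OF ddW]] by simp_all
  have H: "smooth_on W H"
  proof -
    have "smooth_on W (\<lambda>z. (\<Gamma> i k m \<circ> inv_into N X) (fst z))" for i k m
      by (rule smooth_on_compose[OF ddW fst coord[OF \<Gamma>]]) (auto simp: W_def)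
    then have "smooth_on W (\<lambda>z. \<Sum>m\<in>Basis. - (\<Sum>k\<in>Basis. \<Sum>i\<in>Basis.
        (snd z \<bullet> i) * (snd z \<bullet> k) * (\<Gamma> i k m \<circ> inv_into N X) (fst z)) *\<^sub>R m)" (is "smooth_on W ?F")
      by (intro smooth_on_sum smooth_on_scaleR smooth_on_minus smooth_on_mult smooth_on_const ddW
          smooth_on_linear_comp[OF _ bounded_linear_inner_left] snd)
    then have "smooth_on W (\<lambda>z. (snd z, 0) + (0, ?F z))"
      by (intro smooth_on_add ddW
          smooth_on_linear_comp[OF ddW bounded_linear_Pair[OF bounded_linear_ident bounded_linear_zero]]
          smooth_on_linear_comp[OF ddW bounded_linear_Pair[OF bounded_linear_zero bounded_linear_ident]] snd)
    then show ?thesis by (rule smooth_on_cong) (simp add: H_def)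
  qed
  define z where "z \<gamma> t = (X (\<gamma> t), \<Sum>b\<in>Basis. velocity \<A> \<gamma> t (\<lambda>q. X q \<bullet> b) *\<^sub>R b)" for \<gamma> t
  have position: "((\<lambda>t. X (\<gamma> t)) has_vector_derivative
      (\<Sum>b\<in>Basis. velocity \<A> \<gamma> t (\<lambda>q. X q \<bullet> b) *\<^sub>R b)) (at t within {0..1})"
    if "smooth_curve \<A> \<gamma>" "t \<in> {0..1}" for \<gamma> t
  proof -
    have "((\<lambda>t. \<Sum>b\<in>Basis. (X (\<gamma> t) \<bullet> b) *\<^sub>R b) has_vector_derivative
      (\<Sum>b\<in>Basis. velocity \<A> \<gamma> t (\<lambda>q. X q \<bullet> b) *\<^sub>R b)) (at t within {0..1})"
      using velocity_has_derivative[OF X that]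
      by (intro has_vector_derivative_sum bounded_linear.has_vector_derivative[OF bounded_linear_scaleR_left])
         (simp add: o_def)
    then show ?thesis by (simp add: euclidean_representation)
  qed
  have zc: "continuous_on {0..1} (z \<gamma>)" if "smooth_curve \<A> \<gamma>" for \<gamma>
    unfolding z_def
  proof (intro continuous_on_Pair continuous_on_sum continuous_on_scaleR continuous_on_const)
    show "continuous_on {0..1} (\<lambda>t. X (\<gamma> t))"
      using position[OF that] by (meson continuous_on_eq_continuous_within has_vector_derivative_continuous)
    show "continuous_on {0..1} (\<lambda>t. velocity \<A> \<gamma> t (\<lambda>q. X q \<bullet> b))" for b
      by (rule smooth_on_imp_continuous_on[OF fields_alongD(2)[OF velocity_field_along[OF that] X]])
  qed
  have zd: "(z \<gamma> has_vector_derivative H (z \<gamma> t)) (at t within {0..1})"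
    if g: "geodesic \<A> D \<gamma>" and t: "t \<in> {0..1}" and N: "\<gamma> t \<in> N" for \<gamma> t
  proof -
    have sc: "smooth_curve \<A> \<gamma>" using g by (simp add: geodesic_def)
    have b: "\<beta> (\<gamma> t) \<noteq> 0" using N by (simp add: N_def)
    have iX: "inv_into N X (X (\<gamma> t)) = \<gamma> t" using inj N by simp
    have "((\<lambda>t. \<Sum>m\<in>Basis. velocity \<A> \<gamma> t (\<lambda>q. X q \<bullet> m) *\<^sub>R m) has_vector_derivative
        (\<Sum>m\<in>Basis. - (\<Sum>k\<in>Basis. \<Sum>i\<in>Basis. velocity \<A> \<gamma> t (\<lambda>q. X q \<bullet> i) *
          velocity \<A> \<gamma> t (\<lambda>q. X q \<bullet> k) * \<Gamma> i k m (\<gamma> t)) *\<^sub>R m)) (at t within {0..1})"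
      unfolding \<Gamma>_def
      by (intro has_vector_derivative_sum bounded_linear.has_vector_derivative[OF bounded_linear_scaleR_left]
          geodesic_equation[OF aff g t frame b])
    from has_vector_derivative_Pair[OF position[OF sc t] this]
    show ?thesis
      by (simp add: z_def[abs_def] H_def iX)
  qed
  have near: "\<exists>\<eta>>0. \<forall>t\<in>{0..1}. \<bar>t - t0\<bar> < \<eta> \<longrightarrow> \<gamma> t \<in> N"
    if "smooth_curve \<A> \<gamma>" "\<gamma> t0 = \<gamma>1 t0" for \<gamma>
  proof -
    have "continuous_on {0..1} (\<beta> \<circ> \<gamma>)"
      by (rule smooth_on_imp_continuous_on[OF smooth_fun_along_curve[OF \<beta> that(1)]])
    moreover have "\<bar>\<beta> (\<gamma>1 t0)\<bar> > 0" using \<beta>0 by simp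
    ultimately have "\<exists>\<eta>>0. \<forall>t\<in>{0..1}. dist t t0 < \<eta> \<longrightarrow>
        dist ((\<beta> \<circ> \<gamma>) t) ((\<beta> \<circ> \<gamma>) t0) < \<bar>\<beta> (\<gamma>1 t0)\<bar>"
      using t0 unfolding continuous_on_iff by blast
    then obtain \<eta> where \<eta>: "\<eta> > 0" "\<And>t. t \<in> {0..1} \<Longrightarrow> dist t t0 < \<eta> \<Longrightarrow>
        dist ((\<beta> \<circ> \<gamma>) t) ((\<beta> \<circ> \<gamma>) t0) < \<bar>\<beta> (\<gamma>1 t0)\<bar>"
      by blast
    have "\<gamma> t \<in> N" if "t \<in> {0..1}" "\<bar>t - t0\<bar> < \<eta>" for t
      using \<eta>(2)[of t] that \<open>\<gamma> t0 = \<gamma>1 t0\<close> by (auto simp: N_def dist_real_def)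
    then show ?thesis using \<eta>(1) by blast
  qed
  obtain \<eta>1 where \<eta>1: "\<eta>1 > 0" "\<And>t. t \<in> {0..1} \<Longrightarrow> \<bar>t - t0\<bar> < \<eta>1 \<Longrightarrow> \<gamma>1 t \<in> N"
    using near[OF c(1)] by auto
  obtain \<eta>2 where \<eta>2: "\<eta>2 > 0" "\<And>t. t \<in> {0..1} \<Longrightarrow> \<bar>t - t0\<bar> < \<eta>2 \<Longrightarrow> \<gamma>2 t \<in> N"
    using near[OF c(2)] init(1) by auto
  define \<eta> where "\<eta> = min \<eta>1 \<eta>2"
  have \<eta>: "\<eta> > 0" using \<eta>1 \<eta>2 by (simp add: \<eta>_def)
  have inN: "\<gamma>1 t \<in> N" "\<gamma>2 t \<in> N" if "t \<in> {0..1}" "\<bar>t - t0\<bar> < \<eta>" for t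
    using that \<eta>1(2) \<eta>2(2) by (auto simp: \<eta>_def)
  have "\<exists>\<delta>>0. \<forall>t\<in>{0..1}. \<bar>t - t0\<bar> < \<delta> \<longrightarrow> z \<gamma>1 t = z \<gamma>2 t"
  proof (rule ode_locally_unique[OF W H _ _ t0 zc[OF c(1)] zc[OF c(2)] _ _ \<eta>])
    show "z \<gamma>1 t0 = z \<gamma>2 t0" using init by (simp add: z_def)
    show "z \<gamma>1 t0 \<in> W" using \<beta>0 by (auto simp: z_def W_def N_def)
  qed (use zd geo inN in auto)
  then obtain \<delta> where \<delta>: "\<delta> > 0" "\<And>t. t \<in> {0..1} \<Longrightarrow> \<bar>t - t0\<bar> < \<delta> \<Longrightarrow> z \<gamma>1 t = z \<gamma>2 t"
    by blast
  have "\<gamma>1 t = \<gamma>2 t \<and> velocity \<A> \<gamma>1 t = velocity \<A> \<gamma>2 t"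
    if t: "t \<in> {0..1}" "\<bar>t - t0\<bar> < min \<eta> \<delta>" for t
  proof -
    have zz: "z \<gamma>1 t = z \<gamma>2 t" using \<delta>(2) t by auto
    have nN: "\<gamma>1 t \<in> N" "\<gamma>2 t \<in> N" using inN t by auto
    then have eq: "\<gamma>1 t = \<gamma>2 t" using zz inj by (auto simp: z_def inj_on_def)
    have vb: "velocity \<A> \<gamma>1 t (\<lambda>q. X q \<bullet> b) = velocity \<A> \<gamma>2 t (\<lambda>q. X q \<bullet> b)" if "b \<in> Basis" for b
    proof -
      have "snd (z \<gamma> t) \<bullet> b = velocity \<A> \<gamma> t (\<lambda>q. X q \<bullet> b)" for \<gamma>
        using that by (simp add: z_def inner_sum_left_Basis)
      then show ?thesis using zz by metis
    qed
    have "velocity \<A> \<gamma>1 t f = velocity \<A> \<gamma>2 t f" for f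
    proof (cases "f \<in> smooth_funs \<A>")
      case True
      have "\<beta> (\<gamma>1 t) \<noteq> 0" "\<beta> (\<gamma>2 t) \<noteq> 0" using nN by (auto simp: N_def)
      then show ?thesis
        using span[OF c(1) t(1) _ True] span[OF c(2) t(1) _ True] by (simp add: vb eq)
    qed (simp add: velocity_def)
    then show ?thesis using eq by auto
  qed
  then show ?thesis using \<eta> \<delta>(1) by (intro exI[of _ "min \<eta> \<delta>"]) auto
qed

text \<open>
  The times at which position and velocity coincide form a set that is relatively open by the local
  statement, closed by continuity, and nonempty; the unit interval is connected.
\<close>

lemma geodesic_unique:
  assumes aff: "affine_connection \<A> D" and geo: "geodesic \<A> D \<gamma>1" "geodesic \<A> D \<gamma>2"
    and t0: "t0 \<in> {0..1}" and init: "\<gamma>1 t0 = \<gamma>2 t0" "velocity \<A> \<gamma>1 t0 = velocity \<A> \<gamma>2 t0"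
    and t: "t \<in> {0..1}"
  shows "\<gamma>1 t = \<gamma>2 t"
proof -
  have c: "smooth_curve \<A> \<gamma>1" "smooth_curve \<A> \<gamma>2" using geo by (auto simp: geodesic_def)
  define S where "S = {t \<in> {0..1}. \<gamma>1 t = \<gamma>2 t \<and> velocity \<A> \<gamma>1 t = velocity \<A> \<gamma>2 t}"
  have "openin (top_of_set {0..1}) S"
    unfolding openin_contains_ball
  proof (intro conjI ballI)
    fix r assume "r \<in> S"
    then obtain \<delta> where "\<delta> > 0" "\<And>t. t \<in> {0..1} \<Longrightarrow> \<bar>t - r\<bar> < \<delta> \<Longrightarrow>
        \<gamma>1 t = \<gamma>2 t \<and> velocity \<A> \<gamma>1 t = velocity \<A> \<gamma>2 t"
      using geodesics_locally_equal[OF aff geo, of r] unfolding S_def by blast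
    then show "\<exists>e>0. ball r e \<inter> {0..1} \<subseteq> S"
      by (intro exI[of _ \<delta>]) (auto simp: S_def dist_real_def abs_minus_commute)
  qed (auto simp: S_def)
  moreover have "closed S"
    unfolding closed_sequential_limits
  proof (intro allI impI)
    fix x :: "nat \<Rightarrow> real" and l assume x: "(\<forall>n. x n \<in> S) \<and> x \<longlonglongrightarrow> l"
    then have xS: "\<And>n. x n \<in> {0..1}" by (auto simp: S_def)
    have l: "l \<in> {0..1}"
      by (rule closed_sequentially[of "{0..1}" x l]) (use x xS in auto)
    have lim: "(\<lambda>n. f (x n)) \<longlonglongrightarrow> f l" if "continuous_on {0..1} f" for f :: "real \<Rightarrow> 'b::t2_space"
      by (rule continuous_on_tendsto_compose[OF that]) (use x xS l in auto)
    have "\<gamma>1 l = \<gamma>2 l"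
      using lim[OF smooth_curveD(1)[OF c(1)]] lim[OF smooth_curveD(1)[OF c(2)]] x
      by (simp add: S_def LIMSEQ_unique)
    moreover have "velocity \<A> \<gamma>1 l f = velocity \<A> \<gamma>2 l f" for f
    proof (cases "f \<in> smooth_funs \<A>")
      case True
      have "continuous_on {0..1} (\<lambda>t. velocity \<A> \<gamma> t f)" if "smooth_curve \<A> \<gamma>" for \<gamma>
        by (rule smooth_on_imp_continuous_on[OF fields_alongD(2)[OF velocity_field_along[OF that] True]])
      from lim[OF this[OF c(1)]] lim[OF this[OF c(2)]] show ?thesis
        using x by (simp add: S_def LIMSEQ_unique)
    qed (simp add: velocity_def)
    ultimately show "l \<in> S" using l by (auto simp: S_def)
  qed
  then have "closedin (top_of_set {0..1}) S" by (rule closed_subset[rotated]) (auto simp: S_def)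
  moreover have "t0 \<in> S" using t0 init by (simp add: S_def)
  moreover have "connected {0..1::real}" by simp
  ultimately have "S = {0..1}" unfolding connected_clopen by blast
  then have "t \<in> S" using t by simp
  then show ?thesis by (simp add: S_def)
qed

end

section \<open>The geodesic symmetry and the midpoints\<close>

context smooth_manifold
begin

text \<open>
  The reversed image of a geodesic under an isometry that acts as \<open>- id\<close> on the tangent space at the
  midpoint has the same position and velocity there, hence is the same geodesic.
\<close>

lemma isometry_reverses_geodesic:
  assumes g: "riemannian_metric \<A> g" and lc: "levi_civita \<A> g D" and s: "isometry \<A> g s"
    and geo: "geodesic \<A> D \<gamma>" and mid: "\<gamma> (1/2) = c"
    and fix_c: "s c = c" and ds: "\<forall>v\<in>tangent_space \<A> c. differential \<A> s v = - v"
    and t: "t \<in> {0..1}"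
  shows "s (\<gamma> (1 - t)) = \<gamma> t"
proof -
  have aff: "affine_connection \<A> D" using lc by (simp add: levi_civita_def)
  have diff: "diffeomorphism \<A> s" using s by (simp add: isometry_def)
  have \<gamma>: "smooth_curve \<A> \<gamma>" using geo by (simp add: geodesic_def)
  have h: "(1/2 :: real) \<in> {0..1}" by simp
  have image: "geodesic \<A> D (s \<circ> \<gamma>)"
    by (rule geodesic_image[OF diff geo levi_civita_push[OF g s lc]]) simp
  then have rev: "geodesic \<A> D (\<lambda>t. (s \<circ> \<gamma>) (1 - t))" by (rule geodesic_reverse[OF aff])
  have "smooth_curve \<A> (s \<circ> \<gamma>)" using image by (simp add: geodesic_def)
  then have "velocity \<A> (\<lambda>t. (s \<circ> \<gamma>) (1 - t)) (1/2) = - velocity \<A> (s \<circ> \<gamma>) (1 - 1/2)"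
    by (rule velocity_reverse[OF _ h])
  also have "\<dots> = - differential \<A> s (velocity \<A> \<gamma> (1/2))"
    by (simp add: velocity_image[OF diffeomorphismD(2)[OF diff]])
  also have "\<dots> = velocity \<A> \<gamma> (1/2)"
    using ds fields_alongD(1)[OF velocity_field_along[OF \<gamma>] h] mid by simp
  finally show ?thesis
    using geodesic_unique[OF aff rev geo h _ _ t] mid fix_c by simp
qed

text \<open>
  The image of the segment from \<open>P\<close> to \<open>Q\<close> runs from \<open>Q'\<close> to \<open>P'\<close>, so it is compared with the segment
  from \<open>P'\<close> to \<open>Q'\<close> after a reversal, which fixes the parameter \<open>1/2\<close>.
\<close>

lemma image_of_geodesic_segment:
  assumes s: "diffeomorphism \<A> s" and inU: "s ` U = U"
    and agree: "connections_agree_on \<A> U (push_connection \<A> s D) D'" and aff: "affine_connection \<A> D'"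
    and uj: "uniquely_joined \<A> D P Q" and uj': "uniquely_joined \<A> D' P' Q'"
    and seg: "geodesic_segment \<A> D P Q ` {0..1} \<subseteq> U"
    and ends: "s P = Q'" "s Q = P'"
  shows "midpoint_mean \<A> D' P' Q' = s (midpoint_mean \<A> D P Q)"
proof -
  let ?\<gamma> = "geodesic_segment \<A> D P Q"
  note \<gamma> = geodesic_segment_geodesic[OF uj]
  have "geodesic \<A> D' (s \<circ> ?\<gamma>)"
    by (rule geodesic_image[OF s \<gamma>(1) agree]) (use seg inU in blast)
  then have "geodesic \<A> D' (\<lambda>t. (s \<circ> ?\<gamma>) (1 - t))" by (rule geodesic_reverse[OF aff])
  then have "geodesic_segment \<A> D' P' Q' (1/2) = (s \<circ> ?\<gamma>) (1 - 1/2)"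
    by (rule geodesic_segment_eq[OF uj']) (use \<gamma>(2,3) ends in auto)
  then show ?thesis by (simp add: midpoint_mean_def)
qed

end

theorem theorem4p1:
  fixes \<A> :: "('p::{second_countable_topology,t2_space}, 'e::euclidean_space) chart set"
    and g :: "'p metric"
    and D D' Dg :: "'p connection"
    and P Q c :: 'p
    and s :: "'p \<Rightarrow> 'p"
    and U :: "'p set"
  assumes "smooth_atlas \<A>"
    and "riemannian_metric \<A> g"
    and "affine_connection \<A> D"
    and "dual_connection \<A> g D D'"
    and "levi_civita \<A> g Dg"
    and "c = midpoint_mean \<A> Dg P Q"
    and "uniquely_joined \<A> D P Q"
    and "uniquely_joined \<A> D' P Q"
    and "uniquely_joined \<A> Dg P Q"
    and "uniquely_joined \<A> Dg (midpoint_mean \<A> D P Q) (midpoint_mean \<A> D' P Q)"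
    and "isometry \<A> g s"
    and "open U" and "connected U" and "s ` U = U"
    and "P \<in> U" and "Q \<in> U"
    and "geodesic_segment \<A> D P Q ` {0..1} \<subseteq> U"
    and "geodesic_segment \<A> D' P Q ` {0..1} \<subseteq> U"
    and "geodesic_segment \<A> Dg P Q ` {0..1} \<subseteq> U"
    and "geodesic_segment \<A> Dg (midpoint_mean \<A> D P Q) (midpoint_mean \<A> D' P Q) ` {0..1} \<subseteq> U"
    and "s c = c" and "\<forall>v\<in>tangent_space \<A> c. differential \<A> s v = - v"
    and "connections_agree_on \<A> U (push_connection \<A> s D) D'"
    and "{x. s x = x} \<inter> U = {c}"
  shows "midpoint_mean \<A> Dg (midpoint_mean \<A> D P Q) (midpoint_mean \<A> D' P Q)
           = midpoint_mean \<A> Dg P Q"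
proof -
  interpret smooth_manifold \<A> by unfold_locales (rule assms(1))
  let ?A = "midpoint_mean \<A> D P Q" and ?M = "midpoint_mean \<A> D' P Q"
  note g = assms(2) and aff = assms(3) and dual = assms(4) and lc = assms(5) and iso = assms(11)
    and sU = assms(14) and agree = assms(23)
  have s: "diffeomorphism \<A> s" using iso by (simp add: isometry_def)
  have aff': "affine_connection \<A> D'" and affg: "affine_connection \<A> Dg"
    using dual lc by (simp_all add: dual_connection_def levi_civita_def)
  note \<gamma> = geodesic_segment_geodesic[OF assms(9)]
  have mid: "geodesic_segment \<A> Dg P Q (1/2) = c" by (simp add: assms(6) midpoint_mean_def)
  have swap: "s P = Q" "s Q = P"
    using isometry_reverses_geodesic[OF g lc iso \<gamma>(1) mid assms(21,22), of 0]
      isometry_reverses_geodesic[OF g lc iso \<gamma>(1) mid assms(21,22), of 1] \<gamma>(2,3) by simp_all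
  have sA: "s ?A = ?M"
    using image_of_geodesic_segment[OF s sU agree aff' assms(7,8,17) swap] by simp
  \<comment> \<open>Applying \<open>s\<close> backwards would only give \<open>s ?A = ?M\<close> again; the converse exchange is where
     duality enters.\<close>
  have sM: "s ?M = ?A"
    using image_of_geodesic_segment[OF s sU dual_connection_push_swap[OF g iso aff dual agree] aff
        assms(8,7,18) swap] by simp
  have "connections_agree_on \<A> U (push_connection \<A> s Dg) Dg"
    using levi_civita_push[OF g iso lc] by (simp add: connections_agree_on_def)
  then have "midpoint_mean \<A> Dg ?A ?M = s (midpoint_mean \<A> Dg ?A ?M)"
    using sA sM by (intro image_of_geodesic_segment[OF s sU _ affg assms(10,10,20)])
  moreover have "midpoint_mean \<A> Dg ?A ?M \<in> U"
    using assms(20) by (auto simp: midpoint_mean_def image_subset_iff)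
  ultimately have "midpoint_mean \<A> Dg ?A ?M \<in> {x. s x = x} \<inter> U" by simp
  then show ?thesis using assms(6,24) by simp
qed

end
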